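(* Let $\mathcal M=(E,\mathcal L)$ be a finite simple oriented matroid with underlying matroid $M$ and tope graph $G$. For every tope $C$, crossing vector $w\in\mathbb N^E$ and degree $k$, there is an isomorphism of abelian groups $$\operatorname{MH}_{k,w}(G;\mathbb Z)_{\bullet\to C}\cong\mathbb Z[\operatorname{Flag}_{k,w}(\mathcal M)_C].$$ Equivalently, $$\operatorname{MH}_{k,w}(G;\mathbb Z)_{\bullet\to C}\cong\begin{cases}\mathbb Z,&(w,C)\text{ is admissible and }k=\kappa(w),\\0,&\text{otherwise}.\end{cases}$$ Consequently all integral magnitude homology groups of $G$ are free abelian.
   Context: $\mathbb N=\mathbb Z_{\ge0}$. For $X,Y\in\{+,0,-\}^E$ put $(X\circ Y)_e=X_e$ if $X_e\ne0$, else $Y_e$, and $S(X,Y)=\{e:X_e=-Y_e\ne0\}$. An oriented matroid $(E,\mathcal L)$ has covector set $\mathcal L\subseteq\{+,0,-\}^E$ containing $0$, closed under negation and $\circ$, and satisfying strong elimination: if $X,Y\in\mathcal L$, $e\in S(X,Y)$, there is $Z\in\mathcal L$ with $Z_e=0$ and $Z_f=(X\circ Y)_f$ for $f\notin S(X,Y)$. The flats of the underlying matroid $M$ (rank function $r_M$) are the zero sets $Z(X)$ of covectors; $\mathcal M$ is simple if $M$ is. Covectors are ordered by $X\le Y\iff X_e\in\{0,Y_e\}$ for all $e$; topes are the maximal covectors. For simple $\mathcal M$ the tope graph joins topes differing in exactly one coordinate and has distance $d(B,C)=|S(B,C)|$. Magnitude homology: $\operatorname{MC}_{k,\ell}(G;\mathbb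 Z)$ is free on tuples $(B_0,\dots,B_k)$ of vertices with $B_{i-1}\neq B_i$ and $\sum_id(B_{i-1},B_i)=\ell$; $\partial=\sum_{i=1}^{k-1}(-1)^i\partial_i$, where $\partial_i$ deletes $B_i$ if $d(B_{i-1},B_{i+1})=d(B_{i-1},B_i)+d(B_i,B_{i+1})$ and is zero otherwise; $\operatorname{MH}_{k,\ell}$ is its homology. The crossing vector of a tuple is $\sum_{i=1}^k\mathbf 1_{S(B_{i-1},B_i)}\in\mathbb N^E$; $\partial$ preserves the crossing vector and both endpoints. $\operatorname{MH}_{k,w}(G;\mathbb Z)_{\bullet\to C}$ is the degree-$k$ homology of the subcomplex spanned by tuples of crossing vector $w$ with terminal tope $B_k=C$ (any initial tope). A face flag incident to $C$ is a possibly empty weakly decreasing sequence $(X_1\ge\cdots\ge X_m)$ of covectors strictly below $C$; its degree is $\sum_ir_M(Z(X_i))$ and its crossing vector is $\sum_i\mathbf 1_{Z(X_i)}$. $\operatorname{Flag}_{k,w}(\mathcal M)_C$ is the set of those of degree $k$ and crossing vector $w$. Put $U_j(w)=\{e:w_e\ge j\}$ and $\kappa(w)=\sum_{j\ge1}r_M(U_j(w))$ (equal to the maximal $w$-weight of a basis of $M$). $C\setminus U$ denotes $C$ with coordinates in $U$ set to zero. The pair $(w,C)$ is admissible if $C\setminus U_j(w)$ is a covector for every nonempty $U_j(w)$, $j\ge1$ (vacuous for $w=0$). *)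

theory Defs
  imports
    "HOL-Algebra.Free_Abelian_Groups"
    "HOL-Algebra.Elementary_Groups"
    "HOL-Library.Extended_Nat"
    "HOL-Library.Indicator_Function"
begin

section \<open>Oriented matroids\<close>

text \<open>Signs are the integers 1, 0, -1, and a sign vector on the ground set \<open>E\<close> is a function
  that vanishes outside \<open>E\<close>, so that equality of sign vectors is equality of functions.\<close>

definition sign_vectors :: "'e set \<Rightarrow> ('e \<Rightarrow> int) set" where
  "sign_vectors E = {X. (\<forall>e\<in>E. X e \<in> {1, 0, -1}) \<and> (\<forall>e. e \<notin> E \<longrightarrow> X e = 0)}"

definition sv_comp :: "('e \<Rightarrow> int) \<Rightarrow> ('e \<Rightarrow> int) \<Rightarrow> 'e \<Rightarrow> int" where
  "sv_comp X Y = (\<lambda>e. if X e \<noteq> 0 then X e else Y e)"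

definition sep :: "('e \<Rightarrow> int) \<Rightarrow> ('e \<Rightarrow> int) \<Rightarrow> 'e set" where
  "sep X Y = {e. X e = - Y e \<and> X e \<noteq> 0}"

locale oriented_matroid =
  fixes E :: "'e set" and L :: "('e \<Rightarrow> int) set"
  assumes covectors_sign: "L \<subseteq> sign_vectors E"
    and zero_covector: "(\<lambda>_. 0) \<in> L"
    and neg_closed: "X \<in> L \<Longrightarrow> (\<lambda>e. - X e) \<in> L"
    and comp_closed: "X \<in> L \<Longrightarrow> Y \<in> L \<Longrightarrow> sv_comp X Y \<in> L"
    and strong_elimination: "X \<in> L \<Longrightarrow> Y \<in> L \<Longrightarrow> e \<in> sep X Y \<Longrightarrow>
      \<exists>Z\<in>L. Z e = 0 \<and> (\<forall>f\<in>E. f \<notin> sep X Y \<longrightarrow> Z f = sv_comp X Y f)"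

definition zero_set :: "'e set \<Rightarrow> ('e \<Rightarrow> int) \<Rightarrow> 'e set" where
  "zero_set E X = {e \<in> E. X e = 0}"

text \<open>The underlying matroid is given by its flats; closure, independence and rank are those
  of the matroid with these flats.\<close>

definition flats :: "'e set \<Rightarrow> ('e \<Rightarrow> int) set \<Rightarrow> 'e set set" where
  "flats E L = zero_set E ` L"

definition matroid_closure :: "'e set \<Rightarrow> ('e \<Rightarrow> int) set \<Rightarrow> 'e set \<Rightarrow> 'e set" where
  "matroid_closure E L A = \<Inter>{F \<in> flats E L. A \<subseteq> F}"

definition matroid_indep :: "'e set \<Rightarrow> ('e \<Rightarrow> int) set \<Rightarrow> 'e set \<Rightarrow> bool" where
  "matroid_indep E L I \<longleftrightarrow> I \<subseteq> E \<and> (\<forall>e\<in>I. e \<notin> matroid_closure E L (I - {e}))"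

definition matroid_rank :: "'e set \<Rightarrow> ('e \<Rightarrow> int) set \<Rightarrow> 'e set \<Rightarrow> nat" where
  "matroid_rank E L A = Max (card ` {I. I \<subseteq> A \<and> matroid_indep E L I})"

text \<open>No loops and no parallel elements (\<open>e = f\<close> is allowed below).\<close>

definition simple_om :: "'e set \<Rightarrow> ('e \<Rightarrow> int) set \<Rightarrow> bool" where
  "simple_om E L \<longleftrightarrow> (\<forall>e\<in>E. \<forall>f\<in>E. matroid_indep E L {e, f})"

definition covector_le :: "('e \<Rightarrow> int) \<Rightarrow> ('e \<Rightarrow> int) \<Rightarrow> bool" where
  "covector_le X Y \<longleftrightarrow> (\<forall>e. X e \<in> {0, Y e})"

definition topes :: "('e \<Rightarrow> int) set \<Rightarrow> ('e \<Rightarrow> int) set" where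
  "topes L = {B \<in> L. \<forall>X\<in>L. covector_le B X \<longrightarrow> X = B}"


section \<open>The tope graph\<close>

definition tope_adj :: "('e \<Rightarrow> int) set \<Rightarrow> ('e \<Rightarrow> int) \<Rightarrow> ('e \<Rightarrow> int) \<Rightarrow> bool" where
  "tope_adj L B C \<longleftrightarrow> B \<in> topes L \<and> C \<in> topes L \<and> (\<exists>!e. B e \<noteq> C e)"

text \<open>Shortest-path distance of the graph with adjacency relation \<open>R\<close>; it is \<open>\<infinity>\<close> when there is
  no path.\<close>

definition graph_dist :: "('v \<Rightarrow> 'v \<Rightarrow> bool) \<Rightarrow> 'v \<Rightarrow> 'v \<Rightarrow> enat" where
  "graph_dist R u v = (INF n \<in> {n. (R ^^ n) u v}. enat n)"

abbreviation tope_dist :: "('e \<Rightarrow> int) set \<Rightarrow> ('e \<Rightarrow> int) \<Rightarrow> ('e \<Rightarrow> int) \<Rightarrow> enat" where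
  "tope_dist L \<equiv> graph_dist (tope_adj L)"


section \<open>Magnitude homology\<close>

text \<open>A tuple \<open>(B\<^sub>0, \<dots>, B\<^sub>k)\<close> is a list of length \<open>k + 1\<close>.\<close>

definition mag_tuples ::
  "'v set \<Rightarrow> ('v \<Rightarrow> 'v \<Rightarrow> enat) \<Rightarrow> nat \<Rightarrow> nat \<Rightarrow> 'v list set" where
  "mag_tuples V d k l = {Bs. length Bs = Suc k \<and> set Bs \<subseteq> V \<and>
     (\<forall>i<k. Bs ! i \<noteq> Bs ! Suc i) \<and> (\<Sum>i<k. d (Bs ! i) (Bs ! Suc i)) = enat l}"

definition mag_face :: "('v \<Rightarrow> 'v \<Rightarrow> enat) \<Rightarrow> nat \<Rightarrow> 'v list \<Rightarrow> 'v list \<Rightarrow>\<^sub>0 int" where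
  "mag_face d i Bs =
     (if d (Bs ! (i - 1)) (Bs ! (i + 1)) = d (Bs ! (i - 1)) (Bs ! i) + d (Bs ! i) (Bs ! (i + 1))
      then frag_of (take i Bs @ drop (Suc i) Bs) else 0)"

definition mag_boundary ::
  "('v \<Rightarrow> 'v \<Rightarrow> enat) \<Rightarrow> ('v list \<Rightarrow>\<^sub>0 int) \<Rightarrow> 'v list \<Rightarrow>\<^sub>0 int" where
  "mag_boundary d =
     frag_extend (\<lambda>Bs. \<Sum>i\<in>{1..<length Bs - 1}. frag_cmul ((-1) ^ i) (mag_face d i Bs))"

text \<open>Degree-\<open>k\<close> homology of the complex whose degree-\<open>j\<close> chain group is free on the set \<open>T j\<close> of
  tuples: cycles modulo boundaries.  The differential on degree 0 is zero, its sum being empty.\<close>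

definition tuple_homology ::
  "('v \<Rightarrow> 'v \<Rightarrow> enat) \<Rightarrow> (nat \<Rightarrow> 'v list set) \<Rightarrow> nat \<Rightarrow> ('v list \<Rightarrow>\<^sub>0 int) set monoid" where
  "tuple_homology d T k =
     subgroup_generated (free_Abelian_group (T k))
       {c \<in> carrier (free_Abelian_group (T k)). mag_boundary d c = 0}
     Mod (mag_boundary d ` carrier (free_Abelian_group (T (Suc k))))"

definition mag_homology ::
  "'v set \<Rightarrow> ('v \<Rightarrow> 'v \<Rightarrow> enat) \<Rightarrow> nat \<Rightarrow> nat \<Rightarrow> ('v list \<Rightarrow>\<^sub>0 int) set monoid" where
  "mag_homology V d k l = tuple_homology d (\<lambda>j. mag_tuples V d j l) k"

definition crossing_vector :: "('e \<Rightarrow> int) list \<Rightarrow> 'e \<Rightarrow> nat" where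
  "crossing_vector Bs = (\<lambda>e. \<Sum>i<length Bs - 1. indicator (sep (Bs ! i) (Bs ! Suc i)) e)"

definition crossing_tuples ::
  "('e \<Rightarrow> int) set \<Rightarrow> ('e \<Rightarrow> nat) \<Rightarrow> ('e \<Rightarrow> int) \<Rightarrow> nat \<Rightarrow> ('e \<Rightarrow> int) list set" where
  "crossing_tuples L w C k =
     {Bs \<in> (\<Union>l. mag_tuples (topes L) (tope_dist L) k l). crossing_vector Bs = w \<and> last Bs = C}"

definition mag_homology_to ::
  "('e \<Rightarrow> int) set \<Rightarrow> ('e \<Rightarrow> nat) \<Rightarrow> ('e \<Rightarrow> int) \<Rightarrow> nat \<Rightarrow> (('e \<Rightarrow> int) list \<Rightarrow>\<^sub>0 int) set monoid" where
  "mag_homology_to L w C k = tuple_homology (tope_dist L) (crossing_tuples L w C) k"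

text \<open>A basis of \<open>G\<close> is a subset of its carrier, so quantifying over \<open>S\<close> of that type is no
  restriction.\<close>

definition is_free_abelian :: "('a, 'b) monoid_scheme \<Rightarrow> bool" where
  "is_free_abelian G \<longleftrightarrow> (\<exists>S. S \<subseteq> carrier G \<and> G \<cong> free_Abelian_group S)"


section \<open>Face flags and admissibility\<close>

definition face_flags ::
  "'e set \<Rightarrow> ('e \<Rightarrow> int) set \<Rightarrow> ('e \<Rightarrow> nat) \<Rightarrow> ('e \<Rightarrow> int) \<Rightarrow> nat \<Rightarrow> ('e \<Rightarrow> int) list set" where
  "face_flags E L w C k = {Xs.
     (\<forall>X\<in>set Xs. X \<in> L \<and> covector_le X C \<and> X \<noteq> C) \<and>
     sorted_wrt (\<lambda>X Y. covector_le Y X) Xs \<and>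
     (\<Sum>X\<leftarrow>Xs. matroid_rank E L (zero_set E X)) = k \<and>
     (\<lambda>e. \<Sum>X\<leftarrow>Xs. indicator (zero_set E X) e) = w}"

definition upper_level :: "'e set \<Rightarrow> ('e \<Rightarrow> nat) \<Rightarrow> nat \<Rightarrow> 'e set" where
  "upper_level E w j = {e \<in> E. w e \<ge> j}"

text \<open>Restricting the sum to nonempty levels makes it finite and omits only terms of rank 0.\<close>

definition kappa :: "'e set \<Rightarrow> ('e \<Rightarrow> int) set \<Rightarrow> ('e \<Rightarrow> nat) \<Rightarrow> nat" where
  "kappa E L w = (\<Sum>j | j \<ge> 1 \<and> upper_level E w j \<noteq> {}. matroid_rank E L (upper_level E w j))"

definition zero_on :: "('e \<Rightarrow> int) \<Rightarrow> 'e set \<Rightarrow> 'e \<Rightarrow> int" where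
  "zero_on C U = (\<lambda>e. if e \<in> U then 0 else C e)"

definition admissible :: "'e set \<Rightarrow> ('e \<Rightarrow> int) set \<Rightarrow> ('e \<Rightarrow> nat) \<Rightarrow> ('e \<Rightarrow> int) \<Rightarrow> bool" where
  "admissible E L w C \<longleftrightarrow>
     (\<forall>j\<ge>1. upper_level E w j \<noteq> {} \<longrightarrow> zero_on C (upper_level E w j) \<in> L)"

end

theory Submission
  imports Defs
begin

text \<open>Fix a tope \<open>C\<close> and a crossing vector \<open>w \<noteq> 0\<close>, and let \<open>X\<close> be the largest face of \<open>C\<close> that
  vanishes on the support of \<open>w\<close>. Append to every tuple of topes \<open>(B\<^sub>0, \<dots>, B\<^sub>m, C)\<close> of crossing vector
  \<open>w\<close> a descending chain of covectors strictly between \<open>C\<close> and \<open>X\<close>, each of which vanishes somewhere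
  on the separation of \<open>B\<^sub>m\<close> and \<open>C\<close>, followed by \<open>X\<close>. The complex of these longer lists is compared
  with two smaller ones. The lists with empty chain form a copy of the original complex, and the
  quotient is acyclic, because inserting or deleting the gate \<open>Y \<circ> t\<close> of the last tope \<open>t\<close> outside the
  star of the top covector \<open>Y\<close> of the chain matches the remaining lists in pairs. The lists with
  \<open>B\<^sub>m = X \<circ> (-C)\<close> form another subcomplex; its quotient is acyclic too, because for other \<open>B\<^sub>m\<close> the
  admitted covectors form a contractible part of the interval between \<open>X\<close> and \<open>C\<close>. In that
  subcomplex the chain runs through the whole open interval, which is a homology sphere of
  dimension \<open>r(Z(X)) - 2\<close>. If \<open>w\<close> vanishes somewhere on \<open>Z(X)\<close>, no tuple ends with
  \<open>X \<circ> (-C), C\<close> and the homology is zero; otherwise it is the homology for \<open>X \<circ> (-C)\<close> and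
  \<open>w - 1\<^bsub>Z(X)\<^esub>\<close>, shifted by \<open>r(Z(X))\<close>. Induction on the sum of \<open>w\<close> gives the theorem.\<close>

section \<open>Complexes on a basis\<close>

text \<open>The obstacle is that a matching by gates needs a face \<open>Y\<close> to define gates
  and must never treat the terminal tope as the gate to be removed, since that tope always stays.
  The top covector of the chain supplies \<open>Y\<close>, and the requirement that it vanish
  somewhere on the separation of the last step says exactly that the gate of the tope before
  \<open>C\<close> is not \<open>C\<close>. Seen from the chain, the same requirement selects the
  faces of \<open>C\<close> that are visible from that tope: an acyclic family, unless the tope is
  the antipode of \<open>C\<close>, from which the whole boundary is visible. One condition thus
  serves both comparisons. The final \<open>X\<close> is never removed and makes the empty chain a
  genuine basis element, which is how reduced homology enters. All complexes are spans of sets of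
  lists with the deletion boundary restricted to the set, quotients are differences of sets, and
  homology that is zero or infinite cyclic is recorded by a single cycle. The degree of a list is
  its length, one more than its homological degree.\<close>

abbreviation keys :: "('a \<Rightarrow>\<^sub>0 int) \<Rightarrow> 'a set" where "keys \<equiv> Poly_Mapping.keys"

definition restrict_frag :: "'a set \<Rightarrow> ('a \<Rightarrow>\<^sub>0 int) \<Rightarrow> 'a \<Rightarrow>\<^sub>0 int" where
  "restrict_frag S = frag_extend (\<lambda>b. if b \<in> S then frag_of b else 0)"

lemma lookup_frag_extend:
  "Poly_Mapping.lookup (frag_extend f c) b =
    (\<Sum>a\<in>keys c. Poly_Mapping.lookup c a * Poly_Mapping.lookup (f a) b)"
  by (simp add: frag_extend_def lookup_sum)

lemma lookup_restrict_frag [simp]: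
  "Poly_Mapping.lookup (restrict_frag S c) b = (if b \<in> S then Poly_Mapping.lookup c b else 0)"
proof -
  have "Poly_Mapping.lookup (restrict_frag S c) b =
      (\<Sum>a\<in>keys c. if a = b then (if b \<in> S then Poly_Mapping.lookup c a else 0) else 0)"
    unfolding restrict_frag_def lookup_frag_extend by (rule sum.cong) auto
  also have "\<dots> = (if b \<in> S then Poly_Mapping.lookup c b else 0)"
    by (subst sum.delta) (auto simp: in_keys_iff)
  finally show ?thesis .
qed

lemma keys_restrict_frag [simp]: "keys (restrict_frag S c) = keys c \<inter> S"
  by (auto simp: in_keys_iff split: if_splits)

lemma restrict_frag_add: "restrict_frag S (a + b) = restrict_frag S a + restrict_frag S b"
  and restrict_frag_diff: "restrict_frag S (a - b) = restrict_frag S a - restrict_frag S b"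
  and restrict_frag_cmul: "restrict_frag S (frag_cmul k a) = frag_cmul k (restrict_frag S a)"
  and restrict_frag_0 [simp]: "restrict_frag S 0 = 0"
  by (simp_all add: restrict_frag_def frag_extend_add frag_extend_diff frag_extend_cmul)

lemma restrict_frag_sum: "restrict_frag S (\<Sum>i\<in>I. f i) = (\<Sum>i\<in>I. restrict_frag S (f i))"
  by (induction I rule: infinite_finite_induct) (auto simp: restrict_frag_add)

lemma restrict_frag_restrict_frag: "restrict_frag S (restrict_frag T c) = restrict_frag (S \<inter> T) c"
  by (rule poly_mapping_eqI) auto

lemma restrict_frag_id: "keys c \<subseteq> S \<Longrightarrow> restrict_frag S c = c"
  by (rule poly_mapping_eqI) (auto simp: in_keys_iff)

lemma restrict_frag_eq_0: "keys c \<inter> S = {} \<Longrightarrow> restrict_frag S c = 0"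
  by (rule poly_mapping_eqI) (auto simp: in_keys_iff)

lemma keys_subset_if_restrict_frag_eq_0:
  assumes "keys c \<subseteq> S" "restrict_frag (S - S1) c = 0"
  shows "keys c \<subseteq> S1"
  using assms keys_restrict_frag[of "S - S1" c] by auto

lemma restrict_frag_split: "S1 \<subseteq> S \<Longrightarrow> keys c \<subseteq> S \<Longrightarrow> c = restrict_frag S1 c + restrict_frag (S - S1) c"
  by (rule poly_mapping_eqI) (auto simp: lookup_add in_keys_iff)

lemma keys_add_subset: "keys a \<subseteq> S \<Longrightarrow> keys b \<subseteq> S \<Longrightarrow> keys (a + b) \<subseteq> S"
  by (meson Un_least dual_order.trans keys_add)

lemma keys_diff_subset: "keys a \<subseteq> S \<Longrightarrow> keys b \<subseteq> S \<Longrightarrow> keys (a - b) \<subseteq> S"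
  by (meson Un_least dual_order.trans keys_diff)

lemma keys_cmul_subset: "keys a \<subseteq> S \<Longrightarrow> keys (frag_cmul k a) \<subseteq> S"
  by auto

lemma keys_sum_subset: "(\<And>i. i \<in> I \<Longrightarrow> keys (f i) \<subseteq> S) \<Longrightarrow> keys (\<Sum>i\<in>I. f i) \<subseteq> S"
  by (induction I rule: infinite_finite_induct) (simp_all add: keys_add_subset)

section \<open>Relative chain complexes spanned by subsets of a basis\<close>

locale based_complex =
  fixes bd :: "'b \<Rightarrow> 'b \<Rightarrow>\<^sub>0 int" and deg :: "'b \<Rightarrow> nat"
  assumes bd_bd: "frag_extend bd (bd b) = 0"
    and deg_bd: "b' \<in> keys (bd b) \<Longrightarrow> deg b = Suc (deg b')"
begin

definition rbd :: "'b set \<Rightarrow> ('b \<Rightarrow>\<^sub>0 int) \<Rightarrow> 'b \<Rightarrow>\<^sub>0 int" where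
  "rbd S c = restrict_frag S (frag_extend bd c)"

text \<open>A convex set of basis elements is a difference of two subcomplexes, so that \<open>rbd S\<close>
  squares to zero on its span.\<close>

definition convex :: "'b set \<Rightarrow> bool" where
  "convex S \<longleftrightarrow> (\<forall>a\<in>S. \<forall>c\<in>S. \<forall>b. b \<in> keys (bd a) \<longrightarrow> c \<in> keys (bd b) \<longrightarrow> b \<in> S)"

text \<open>Only the faces that lie in \<open>S\<close> have to stay in \<open>S1\<close>, so that
  the notion also applies when \<open>S\<close> is itself a subquotient.\<close>

definition subcomplex :: "'b set \<Rightarrow> 'b set \<Rightarrow> bool" where
  "subcomplex S1 S \<longleftrightarrow> S1 \<subseteq> S \<and> (\<forall>a\<in>S1. keys (bd a) \<inter> S \<subseteq> S1)"

text \<open>Cycles of mixed degree are included; the homogeneous version is recovered in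
  \<open>acyclic_homogeneous\<close>.\<close>

definition acyclic :: "'b set \<Rightarrow> bool" where
  "acyclic S \<longleftrightarrow> (\<forall>c. keys c \<subseteq> S \<longrightarrow> rbd S c = 0 \<longrightarrow> (\<exists>d. keys d \<subseteq> S \<and> rbd S d = c))"

text \<open>The homology on \<open>S\<close> is free on the class of the homogeneous cycle \<open>z\<close>, or zero when \<open>z = 0\<close>.\<close>

definition hgen :: "'b set \<Rightarrow> nat \<Rightarrow> ('b \<Rightarrow>\<^sub>0 int) \<Rightarrow> bool" where
  "hgen S n z \<longleftrightarrow> keys z \<subseteq> S \<inter> {b. deg b = n} \<and> rbd S z = 0 \<and>
     (\<forall>c. keys c \<subseteq> S \<longrightarrow> rbd S c = 0 \<longrightarrow> (\<exists>m d. keys d \<subseteq> S \<and> c = frag_cmul m z + rbd S d)) \<and>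
     (\<forall>m d. keys d \<subseteq> S \<longrightarrow> rbd S d = frag_cmul m z \<longrightarrow> frag_cmul m z = 0)"

lemma rbd_add: "rbd S (a + b) = rbd S a + rbd S b"
  and rbd_diff: "rbd S (a - b) = rbd S a - rbd S b"
  and rbd_cmul: "rbd S (frag_cmul k a) = frag_cmul k (rbd S a)"
  and rbd_0 [simp]: "rbd S 0 = 0"
  by (simp_all add: rbd_def restrict_frag_add restrict_frag_diff restrict_frag_cmul
      frag_extend_add frag_extend_diff frag_extend_cmul)

lemma rbd_sum: "rbd S (\<Sum>i\<in>I. f i) = (\<Sum>i\<in>I. rbd S (f i))"
  by (induction I rule: infinite_finite_induct) (auto simp: rbd_add)

lemma keys_rbd: "keys (rbd S c) \<subseteq> S"
  by (auto simp: rbd_def)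

lemma lookup_rbd: "Poly_Mapping.lookup (rbd S c) b =
   (if b \<in> S then (\<Sum>a\<in>keys c. Poly_Mapping.lookup c a * Poly_Mapping.lookup (bd a) b) else 0)"
  by (simp add: rbd_def lookup_frag_extend)

lemma keys_rbdE:
  assumes "b \<in> keys (rbd S c)"
  obtains a where "a \<in> keys c" "b \<in> keys (bd a)" "b \<in> S"
  using assms keys_frag_extend[of bd c] by (auto simp: rbd_def)

lemma extend_bd_extend_bd: "frag_extend bd (frag_extend bd c) = 0"
proof -
  have "keys c \<subseteq> UNIV" by simp
  then show ?thesis by (induction c rule: frag_induction) (auto simp: bd_bd frag_extend_diff)
qed

text \<open>The part \<open>e\<close> of the full boundary that \<open>rbd\<close> discards consists
  of faces outside \<open>S\<close>. By convexity they have no faces in \<open>S\<close>, so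
  discarding them does not affect the second restricted boundary.\<close>

lemma rbd_rbd:
  assumes "convex S" "keys c \<subseteq> S"
  shows "rbd S (rbd S c) = 0"
proof -
  define e where "e = frag_extend bd c - rbd S c"
  have e: "keys e \<inter> S = {}" "keys e \<subseteq> (\<Union>a\<in>keys c. keys (bd a))"
  proof -
    show "keys e \<inter> S = {}"
      by (auto simp: e_def rbd_def in_keys_iff lookup_minus)
    have "keys e \<subseteq> keys (frag_extend bd c)"
      by (auto simp: e_def rbd_def in_keys_iff lookup_minus split: if_splits)
    then show "keys e \<subseteq> (\<Union>a\<in>keys c. keys (bd a))"
      using keys_frag_extend by fast
  qed
  have "rbd S e = 0"
  proof (rule ccontr)
    assume "rbd S e \<noteq> 0"
    then obtain b where "b \<in> keys (rbd S e)" by fastforce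
    then obtain a where "a \<in> keys e" "b \<in> keys (bd a)" "b \<in> S" by (rule keys_rbdE)
    with e assms show False unfolding convex_def by blast
  qed
  moreover have "rbd S (rbd S c + e) = 0"
    by (simp add: e_def rbd_def extend_bd_extend_bd)
  ultimately show ?thesis by (simp add: rbd_add)
qed

lemma rbd_subcomplex:
  assumes "subcomplex S1 S" "keys c \<subseteq> S1"
  shows "rbd S c = rbd S1 c"
proof (rule poly_mapping_eqI)
  fix b
  have "b \<notin> keys (rbd S c)" if "b \<notin> S1"
    using that assms keys_rbdE[of b S c] unfolding subcomplex_def by blast
  then have "Poly_Mapping.lookup (rbd S c) b = 0" if "b \<notin> S1"
    using that by (simp add: in_keys_iff)
  then show "Poly_Mapping.lookup (rbd S c) b = Poly_Mapping.lookup (rbd S1 c) b"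
    using assms by (auto simp: lookup_rbd subcomplex_def)
qed

text \<open>The boundary of the part in \<open>S1\<close> stays in \<open>S1\<close>, so the
  projection onto the span of \<open>S - S1\<close> is the chain map to the quotient
  complex.\<close>

lemma restrict_rbd_quotient:
  assumes "subcomplex S1 S" "keys c \<subseteq> S"
  shows "restrict_frag (S - S1) (rbd S c) = rbd (S - S1) (restrict_frag (S - S1) c)"
proof -
  have "S1 \<subseteq> S" using assms by (auto simp: subcomplex_def)
  then have c: "c = restrict_frag S1 c + restrict_frag (S - S1) c"
    using assms by (intro restrict_frag_split)
  have "rbd S c = rbd S1 (restrict_frag S1 c) + rbd S (restrict_frag (S - S1) c)"
    by (subst c, subst rbd_add, subst rbd_subcomplex[OF assms(1)]) auto
  moreover have "restrict_frag (S - S1) (rbd S1 x) = 0" for x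
    using keys_rbd[of S1 x] by (intro restrict_frag_eq_0) fast
  moreover have "restrict_frag (S - S1) (rbd S x) = rbd (S - S1) x" for x
    by (auto simp: rbd_def restrict_frag_restrict_frag intro!: arg_cong2[of _ _ _ _ restrict_frag])
  ultimately show ?thesis by (simp add: restrict_frag_add)
qed

lemma convex_subcomplex: "convex S \<Longrightarrow> subcomplex S1 S \<Longrightarrow> convex S1"
  unfolding convex_def subcomplex_def by blast

lemma convex_quotient: "convex S \<Longrightarrow> subcomplex S1 S \<Longrightarrow> convex (S - S1)"
  unfolding convex_def subcomplex_def by blast

lemma
  assumes "hgen S n z"
  shows hgen_cycleE: "keys c \<subseteq> S \<Longrightarrow> rbd S c = 0 \<Longrightarrow> (\<And>m d. keys d \<subseteq> S \<Longrightarrow> c = frag_cmul m z + rbd S d \<Longrightarrow> P) \<Longrightarrow> P"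
    and hgen_unique: "keys d \<subseteq> S \<Longrightarrow> rbd S d = frag_cmul m z \<Longrightarrow> frag_cmul m z = 0"
  using assms unfolding hgen_def by blast+

lemma acyclicE:
  assumes "acyclic S" "keys c \<subseteq> S" "rbd S c = 0"
  obtains d where "keys d \<subseteq> S" "rbd S d = c"
  using assms unfolding acyclic_def by blast

lemma acyclic_iff_hgen: "acyclic S \<longleftrightarrow> hgen S n 0"
  proof -
  have "(\<exists>d. keys d \<subseteq> S \<and> c = rbd S d) \<longleftrightarrow> (\<exists>d. keys d \<subseteq> S \<and> rbd S d = c)" for c by auto
  then show ?thesis by (simp add: acyclic_def hgen_def)
qed

text \<open>The boundary lowers degrees by exactly one. This is what allows fillers and cycles to be
  replaced by their homogeneous components.\<close>

lemma restrict_rbd_deg: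
  "restrict_frag {b. deg b = n} (rbd S c) = rbd S (restrict_frag {b. deg b = Suc n} c)"
proof (rule poly_mapping_eqI)
  fix b
  have *: "Poly_Mapping.lookup (bd a) b = 0" if "deg a \<noteq> Suc (deg b)" for a
    using that deg_bd[of b a] by (auto simp: in_keys_iff)
  have "(\<Sum>a\<in>keys c. Poly_Mapping.lookup c a * Poly_Mapping.lookup (bd a) b) =
        (\<Sum>a\<in>keys c \<inter> {a. deg a = Suc (deg b)}. Poly_Mapping.lookup c a * Poly_Mapping.lookup (bd a) b)"
    by (rule sum.mono_neutral_right) (auto simp: *)
  moreover have "(\<Sum>a\<in>keys c \<inter> {b. deg b = Suc n}.
        Poly_Mapping.lookup (restrict_frag {b. deg b = Suc n} c) a * Poly_Mapping.lookup (bd a) b) = 0"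
    if "deg b \<noteq> n"
    using that by (intro sum.neutral) (auto simp: *)
  ultimately show "Poly_Mapping.lookup (restrict_frag {b. deg b = n} (rbd S c)) b =
      Poly_Mapping.lookup (rbd S (restrict_frag {b. deg b = Suc n} c)) b"
    by (auto simp: lookup_rbd intro!: sum.cong)
qed

lemma acyclic_homogeneous:
  assumes "acyclic S" "keys c \<subseteq> S \<inter> {b. deg b = n}" "rbd S c = 0"
  obtains d where "keys d \<subseteq> S \<inter> {b. deg b = Suc n}" "rbd S d = c"
proof -
  obtain d where d: "keys d \<subseteq> S" "rbd S d = c"
    using assms unfolding acyclic_def by blast
  show ?thesis
  proof
    show "keys (restrict_frag {b. deg b = Suc n} d) \<subseteq> S \<inter> {b. deg b = Suc n}"
      using d by auto
    have "restrict_frag {b. deg b = n} c = c"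
      using assms by (intro restrict_frag_id) auto
    then show "rbd S (restrict_frag {b. deg b = Suc n} d) = c"
      using d by (simp add: restrict_rbd_deg[symmetric])
  qed
qed

text \<open>The inclusion of \<open>S1\<close> is an isomorphism in homology, as in the long exact
  sequence of a pair. Acyclicity of the quotient enters through \<open>lift\<close>: a chain with
  boundary in \<open>S1\<close> can be pushed into \<open>S1\<close> by subtracting a
  boundary.\<close>

lemma hgen_extend:
  assumes conv: "convex S" and sub: "subcomplex S1 S" and ac: "acyclic (S - S1)" and z: "hgen S1 n z"
  shows "hgen S n z"
  unfolding hgen_def
proof (intro conjI allI impI)
  have S1: "S1 \<subseteq> S" using sub by (auto simp: subcomplex_def)
  have kz: "keys z \<subseteq> S1" "keys z \<subseteq> {b. deg b = n}" and bz: "rbd S1 z = 0"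
    using z by (auto simp: hgen_def)
  show "keys z \<subseteq> S \<inter> {b. deg b = n}" using kz S1 by auto
  show "rbd S z = 0" using rbd_subcomplex[OF sub kz(1)] bz by simp
  have lift: "\<exists>e. keys e \<subseteq> S \<and> keys (c - rbd S e) \<subseteq> S1"
    if c: "keys c \<subseteq> S" "keys (rbd S c) \<subseteq> S1" for c
  proof -
    have "rbd (S - S1) (restrict_frag (S - S1) c) = restrict_frag (S - S1) (rbd S c)"
      using restrict_rbd_quotient[OF sub c(1)] by simp
    also have "\<dots> = 0" using c(2) by (intro restrict_frag_eq_0) auto
    finally obtain e where e: "keys e \<subseteq> S - S1" "rbd (S - S1) e = restrict_frag (S - S1) c"
      using ac[unfolded acyclic_def, rule_format, of "restrict_frag (S - S1) c"] by auto
    have "restrict_frag (S - S1) (rbd S e) = restrict_frag (S - S1) c"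
      using e restrict_rbd_quotient[OF sub, of e] by (auto simp: restrict_frag_id)
    then have "keys (c - rbd S e) \<subseteq> S1"
      by (intro keys_subset_if_restrict_frag_eq_0[OF keys_diff_subset[OF c(1) keys_rbd]])
        (simp add: restrict_frag_diff)
    with e show ?thesis by blast
  qed
  show "\<exists>m d. keys d \<subseteq> S \<and> c = frag_cmul m z + rbd S d"
    if c: "keys c \<subseteq> S" "rbd S c = 0" for c
  proof -
    have "keys (rbd S c) \<subseteq> S1" using c by simp
    then obtain e where e: "keys e \<subseteq> S" "keys (c - rbd S e) \<subseteq> S1" using lift[OF c(1)] by blast
    have "rbd S1 (c - rbd S e) = 0"
      using rbd_subcomplex[OF sub e(2)] c rbd_rbd[OF conv e(1)] by (simp add: rbd_diff)
    then obtain m d where d: "keys d \<subseteq> S1" "c - rbd S e = frag_cmul m z + rbd S1 d"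
      using hgen_cycleE[OF z e(2)] by metis
    then have "c = frag_cmul m z + rbd S (d + e)"
      using rbd_subcomplex[OF sub d(1)] by (simp add: rbd_add algebra_simps)
    then show ?thesis using keys_add_subset[OF subset_trans[OF d(1) S1] e(1)] by blast
  qed
  show "frag_cmul m z = 0" if d: "keys d \<subseteq> S" "rbd S d = frag_cmul m z" for m d
  proof -
    have "keys (rbd S d) \<subseteq> S1" using d kz by auto
    then obtain e where e: "keys e \<subseteq> S" "keys (d - rbd S e) \<subseteq> S1" using lift[OF d(1)] by blast
    have "rbd S1 (d - rbd S e) = frag_cmul m z"
      using rbd_subcomplex[OF sub e(2)] d rbd_rbd[OF conv e(1)] by (simp add: rbd_diff)
    then show ?thesis by (rule hgen_unique[OF z e(2)])
  qed
qed

lemma acyclic_extend: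
  assumes "convex S" "subcomplex S1 S" "acyclic (S - S1)" "acyclic S1"
  shows "acyclic S"
  using hgen_extend[OF assms(1-3), of 0 0] assms(4) by (simp add: acyclic_iff_hgen[symmetric])

text \<open>The reverse passage along the same isomorphism. The generator need not lie in
  \<open>S1\<close>, so it is first moved there by a boundary \<open>rbd S e\<close>.\<close>

lemma hgen_restrict:
  assumes conv: "convex S" and sub: "subcomplex S1 S" and ac: "acyclic (S - S1)" and z: "hgen S n z"
  obtains z1 where "hgen S1 n z1" "z1 = 0 \<longleftrightarrow> z = 0"
proof -
  have S1: "S1 \<subseteq> S" using sub by (auto simp: subcomplex_def)
  have kz: "keys z \<subseteq> S" "keys z \<subseteq> {b. deg b = n}" and bz: "rbd S z = 0"
    using z by (auto simp: hgen_def)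
  have "rbd (S - S1) (restrict_frag (S - S1) z) = 0"
    using restrict_rbd_quotient[OF sub kz(1)] bz by simp
  \<comment> \<open>The filler is homogeneous so that \<open>z1\<close> stays in degree
    \<open>n\<close>, and it is zero for \<open>z = 0\<close> so that a vanishing generator stays
    zero.\<close>
  then obtain e where e: "keys e \<subseteq> (S - S1) \<inter> {b. deg b = Suc n}"
      "rbd (S - S1) e = restrict_frag (S - S1) z" "z = 0 \<Longrightarrow> e = 0"
    using acyclic_homogeneous[OF ac, of "restrict_frag (S - S1) z" n] kz
    by (cases "z = 0") auto
  define z1 where "z1 = z - rbd S e"
  have "restrict_frag (S - S1) z1 = 0"
  proof -
    have "keys e \<subseteq> S" "restrict_frag (S - S1) e = e" using e by (auto intro!: restrict_frag_id)
    then show ?thesis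
      using restrict_rbd_quotient[OF sub, of e] e by (simp add: z1_def restrict_frag_diff)
  qed
  then have kz1: "keys z1 \<subseteq> S1"
    using keys_subset_if_restrict_frag_eq_0[OF keys_diff_subset[OF kz(1) keys_rbd]]
    by (simp add: z1_def)
  have "keys (rbd S e) \<subseteq> {b. deg b = n}"
    using e by (auto elim!: keys_rbdE dest!: deg_bd)
  then have kz1': "keys z1 \<subseteq> {b. deg b = n}" unfolding z1_def using kz by (intro keys_diff_subset)
  have eS: "keys e \<subseteq> S" using e by auto
  have bz1: "rbd S z1 = 0" using bz rbd_rbd[OF conv eS] by (simp add: z1_def rbd_diff)
  have filler: "\<exists>x. keys x \<subseteq> S1 \<and> rbd S1 x = rbd S d"
    if d: "keys d \<subseteq> S" "keys (rbd S d) \<subseteq> S1" for d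
  proof -
    have "rbd (S - S1) (restrict_frag (S - S1) d) = restrict_frag (S - S1) (rbd S d)"
      using restrict_rbd_quotient[OF sub d(1)] by simp
    also have "\<dots> = 0" using d(2) by (intro restrict_frag_eq_0) auto
    finally obtain f where f: "keys f \<subseteq> S - S1" "rbd (S - S1) f = restrict_frag (S - S1) d"
      using ac[unfolded acyclic_def, rule_format, of "restrict_frag (S - S1) d"] by auto
    have "restrict_frag (S - S1) (rbd S f) = restrict_frag (S - S1) d"
      using f restrict_rbd_quotient[OF sub, of f] by (auto simp: restrict_frag_id)
    then have k: "keys (d - rbd S f) \<subseteq> S1"
      by (intro keys_subset_if_restrict_frag_eq_0[OF keys_diff_subset[OF d(1) keys_rbd]])
        (simp add: restrict_frag_diff)
    have fS: "keys f \<subseteq> S" using f by auto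
    have "rbd S1 (d - rbd S f) = rbd S d"
      using rbd_subcomplex[OF sub k] rbd_rbd[OF conv fS] by (simp add: rbd_diff)
    with k show ?thesis by blast
  qed
  have zz1: "frag_cmul m z = frag_cmul m z1 + rbd S (frag_cmul m e)" for m
    by (simp add: z1_def rbd_cmul frag_cmul_distrib2[symmetric])
  have z10: "z1 = 0 \<longleftrightarrow> z = 0"
  proof
    assume "z1 = 0"
    then have "rbd S e = frag_cmul 1 z" by (simp add: z1_def)
    then have "frag_cmul 1 z = 0" using hgen_unique[OF z eS] by blast
    then show "z = 0" by simp
  qed (use e in \<open>auto simp: z1_def\<close>)
  have "hgen S1 n z1"
    unfolding hgen_def
  proof (intro conjI allI impI)
    show "keys z1 \<subseteq> S1 \<inter> {b. deg b = n}" "rbd S1 z1 = 0"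
      using kz1 kz1' bz1 rbd_subcomplex[OF sub kz1] by auto
    show "\<exists>m d. keys d \<subseteq> S1 \<and> c = frag_cmul m z1 + rbd S1 d"
      if c: "keys c \<subseteq> S1" "rbd S1 c = 0" for c
    proof -
      have "keys c \<subseteq> S" "rbd S c = 0" using c S1 rbd_subcomplex[OF sub c(1)] by auto
      then obtain m d where d: "keys d \<subseteq> S" "c = frag_cmul m z + rbd S d"
        using hgen_cycleE[OF z] by metis
      then have c': "c - frag_cmul m z1 = rbd S (frag_cmul m e + d)"
        by (simp add: zz1 rbd_add)
      then have "keys (rbd S (frag_cmul m e + d)) \<subseteq> S1"
        using c kz1 by (metis keys_cmul_subset keys_diff_subset)
      moreover have "keys (frag_cmul m e + d) \<subseteq> S"
        using eS d by (intro keys_add_subset) auto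
      ultimately obtain x where "keys x \<subseteq> S1" "rbd S1 x = c - frag_cmul m z1"
        using filler c' by metis
      then show ?thesis by (intro exI[of _ m] exI[of _ x]) simp
    qed
    show "frag_cmul m z1 = 0" if d: "keys d \<subseteq> S1" "rbd S1 d = frag_cmul m z1" for m d
    proof -
      have "rbd S (d + frag_cmul m e) = frag_cmul m z"
        using rbd_subcomplex[OF sub d(1)] d by (simp add: rbd_add zz1)
      moreover have "keys (d + frag_cmul m e) \<subseteq> S"
        using eS d S1 by (intro keys_add_subset) auto
      ultimately have "frag_cmul m z = 0" using hgen_unique[OF z] by blast
      then show ?thesis using z10 by auto
    qed
  qed
  with z10 show ?thesis using that by blast
qed

text \<open>With an acyclic subcomplex the projection to the quotient is an isomorphism in homology.
  A cycle of the quotient has its boundary in \<open>S1\<close>; filling that boundary inside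
  \<open>S1\<close> corrects it to a cycle of \<open>S\<close>.\<close>

lemma hgen_lift:
  assumes conv: "convex S" and sub: "subcomplex S1 S" and ac: "acyclic S1" and z: "hgen (S - S1) n z"
  obtains z1 where "hgen S n z1" "z1 = 0 \<longleftrightarrow> z = 0"
proof -
  have S1: "S1 \<subseteq> S" using sub by (auto simp: subcomplex_def)
  have kz: "keys z \<subseteq> S - S1" "keys z \<subseteq> {b. deg b = n}" and bz: "rbd (S - S1) z = 0"
    using z by (auto simp: hgen_def)
  have kzS: "keys z \<subseteq> S" using kz by auto
  have quot: "restrict_frag (S - S1) (rbd S x) = rbd (S - S1) (restrict_frag (S - S1) x)"
    if "keys x \<subseteq> S" for x using restrict_rbd_quotient[OF sub that] .
  have inS1: "keys x \<subseteq> S1" if "keys x \<subseteq> S" "restrict_frag (S - S1) x = 0" for x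
    using that by (rule keys_subset_if_restrict_frag_eq_0)
  have kbz: "keys (rbd S z) \<subseteq> S1"
    using quot[OF kzS] kz bz by (intro inS1 keys_rbd) (auto simp: restrict_frag_id)
  have "rbd S1 (rbd S z) = 0"
    using rbd_subcomplex[OF sub kbz] rbd_rbd[OF conv kzS] by simp
  moreover have "keys (rbd S z) \<subseteq> S1 \<inter> {b. Suc (deg b) = n}"
    using kbz kz by (auto elim!: keys_rbdE dest!: deg_bd)
  \<comment> \<open>The form needed by \<open>acyclic_homogeneous\<close>. For \<open>n = 0\<close>
    the subtraction truncates, but then the sharper inclusion above forces the boundary to be zero
    and the first case below applies.\<close>
  then have "keys (rbd S z) \<subseteq> S1 \<inter> {b. deg b = n - 1}" by auto
  ultimately obtain e where e: "keys e \<subseteq> S1" "keys e \<subseteq> {b. deg b = n}" "rbd S1 e = rbd S z" "z = 0 \<Longrightarrow> e = 0"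
  proof (cases "rbd S z = 0")
    case True
    then show ?thesis using that[of 0] by simp
  next
    case False
    then obtain b where "b \<in> keys (rbd S z)" by fastforce
    then have "Suc (n - 1) = n" using \<open>keys (rbd S z) \<subseteq> S1 \<inter> {b. Suc (deg b) = n}\<close> by auto
    moreover obtain d where "keys d \<subseteq> S1 \<inter> {b. deg b = Suc (n - 1)}" "rbd S1 d = rbd S z"
      using acyclic_homogeneous[OF ac \<open>keys (rbd S z) \<subseteq> S1 \<inter> {b. deg b = n - 1}\<close>
          \<open>rbd S1 (rbd S z) = 0\<close>] .
    moreover have "z \<noteq> 0" using False by auto
    ultimately show ?thesis using that[of d] by auto
  qed
  define z1 where "z1 = z - e"
  have r1: "restrict_frag (S - S1) z1 = z"
  proof -
    have "restrict_frag (S - S1) e = 0" using e by (intro restrict_frag_eq_0) auto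
    then show ?thesis using restrict_frag_id[OF kz(1)] by (simp add: z1_def restrict_frag_diff)
  qed
  have z10: "z1 = 0 \<longleftrightarrow> z = 0" using r1 e by (auto simp: z1_def)
  have eS: "keys e \<subseteq> S" using e S1 by auto
  have kz1: "keys z1 \<subseteq> S \<inter> {b. deg b = n}"
    unfolding z1_def using kz e S1 by (intro keys_diff_subset) auto
  have bz1: "rbd S z1 = 0" using e rbd_subcomplex[OF sub e(1)] by (simp add: z1_def rbd_diff)
  have "hgen S n z1"
    unfolding hgen_def
  proof (intro conjI allI impI kz1 bz1)
    show "\<exists>m d. keys d \<subseteq> S \<and> c = frag_cmul m z1 + rbd S d"
      if c: "keys c \<subseteq> S" "rbd S c = 0" for c
    proof -
      have "rbd (S - S1) (restrict_frag (S - S1) c) = 0"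
        using quot[OF c(1)] c by simp
      moreover have "keys (restrict_frag (S - S1) c) \<subseteq> S - S1" by auto
      ultimately obtain m d where d: "keys d \<subseteq> S - S1"
          "restrict_frag (S - S1) c = frag_cmul m z + rbd (S - S1) d"
        using hgen_cycleE[OF z] by metis
      have dS: "keys d \<subseteq> S" using d by auto
      define y where "y = c - frag_cmul m z1 - rbd S d"
      have "restrict_frag (S - S1) y = 0"
        using quot[OF dS] d r1 by (simp add: y_def restrict_frag_diff restrict_frag_cmul restrict_frag_id)
      moreover have "keys y \<subseteq> S"
        unfolding y_def using c kz1 by (intro keys_diff_subset keys_cmul_subset keys_rbd) auto
      ultimately have ky: "keys y \<subseteq> S1" by (intro inS1)
      moreover have "rbd S1 y = 0"
        using rbd_subcomplex[OF sub ky] c bz1 rbd_rbd[OF conv dS] by (simp add: y_def rbd_diff rbd_cmul)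
      ultimately obtain x where x: "keys x \<subseteq> S1" "rbd S1 x = y"
        using acyclicE[OF ac] by metis
      then have "c = frag_cmul m z1 + rbd S (d + x)"
        using rbd_subcomplex[OF sub x(1)] by (simp add: y_def rbd_add algebra_simps)
      then show ?thesis using keys_add_subset[OF dS subset_trans[OF x(1) S1]] by blast
    qed
    show "frag_cmul m z1 = 0" if d: "keys d \<subseteq> S" "rbd S d = frag_cmul m z1" for m d
    proof -
      have "rbd (S - S1) (restrict_frag (S - S1) d) = frag_cmul m z"
        using quot[OF d(1)] d r1 by (simp add: restrict_frag_cmul)
      moreover have "keys (restrict_frag (S - S1) d) \<subseteq> S - S1" by auto
      ultimately have "frag_cmul m z = 0" using hgen_unique[OF z] by blast
      then show ?thesis using z10 by auto
    qed
  qed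
  with z10 show ?thesis using that by blast
qed

text \<open>The boundary of a relative cycle bounds inside \<open>S1\<close>; subtracting such a
  filler gives an absolute cycle, which bounds in \<open>S\<close>.\<close>

lemma acyclic_quotient:
  assumes conv: "convex S" and sub: "subcomplex S1 S" and ac: "acyclic S" "acyclic S1"
  shows "acyclic (S - S1)"
  unfolding acyclic_def
proof (intro allI impI)
  fix c assume c: "keys c \<subseteq> S - S1" "rbd (S - S1) c = 0"
  have S1: "S1 \<subseteq> S" using sub by (auto simp: subcomplex_def)
  have cS: "keys c \<subseteq> S" using c by auto
  have "restrict_frag (S - S1) (rbd S c) = 0"
    using restrict_rbd_quotient[OF sub cS] c by (simp add: restrict_frag_id)
  then have k: "keys (rbd S c) \<subseteq> S1"
    by (rule keys_subset_if_restrict_frag_eq_0[OF keys_rbd])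
  then have "rbd S1 (rbd S c) = 0"
    using rbd_subcomplex[OF sub k] rbd_rbd[OF conv cS] by simp
  then obtain e where e: "keys e \<subseteq> S1" "rbd S1 e = rbd S c"
    using acyclicE[OF ac(2) k] by metis
  then have "rbd S (c - e) = 0" using rbd_subcomplex[OF sub e(1)] by (simp add: rbd_diff)
  moreover have "keys (c - e) \<subseteq> S" using e cS S1 by (intro keys_diff_subset) auto
  ultimately obtain d where d: "keys d \<subseteq> S" "rbd S d = c - e"
    using acyclicE[OF ac(1)] by metis
  have "restrict_frag (S - S1) e = 0" using e by (intro restrict_frag_eq_0) auto
  then have "rbd (S - S1) (restrict_frag (S - S1) d) = c"
    using restrict_rbd_quotient[OF sub d(1)] d c by (simp add: restrict_frag_diff restrict_frag_id)
  then show "\<exists>d. keys d \<subseteq> S - S1 \<and> rbd (S - S1) d = c"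
    by (intro exI[of _ "restrict_frag (S - S1) d"]) auto
qed

text \<open>A filtration argument, with \<open>rk\<close> of the key as filtration degree. Distinct
  keys of the same rank do not interact, so the top layer of a cycle splits into cycles of the
  fibres; filling these and subtracting lowers the rank. Every chain is finite, so the induction
  ends even for infinite \<open>S\<close>. With fibres of at most two elements this is the
  acyclicity of a matching.\<close>

lemma acyclicI_fibres:
  fixes key :: "'b \<Rightarrow> 'k" and rk :: "'k \<Rightarrow> nat"
  assumes conv: "convex S"
    and mono: "\<And>a b. a \<in> S \<Longrightarrow> b \<in> S \<Longrightarrow> b \<in> keys (bd a) \<Longrightarrow> key b = key a \<or> rk (key b) < rk (key a)"
    and fibres: "\<And>k. acyclic {a \<in> S. key a = k}"
  shows "acyclic S"
proof -
  define F where "F k = {a \<in> S. key a = k}" for k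
  have main: "\<exists>d. keys d \<subseteq> S \<and> rbd S d = c"
    if "keys c \<subseteq> {a \<in> S. rk (key a) < n}" "rbd S c = 0" for c n
    using that
  proof (induction n arbitrary: c)
    case 0
    then have "c = 0" by auto
    then show ?case by (intro exI[of _ 0]) auto
  next
    case (Suc n)
    \<comment> \<open>The keys of the top layer that occur in \<open>c\<close>; all other keys in
      \<open>c\<close> have smaller rank.\<close>
    define K where "K = {k \<in> key ` keys c. rk k = n}"
    have finK: "finite K" by (auto simp: K_def)
    have "\<exists>d. keys d \<subseteq> F k \<and> rbd (F k) d = restrict_frag (F k) c" if "k \<in> K" for k
    proof -
      \<comment> \<open>A boundary term in the fibre of \<open>k\<close> comes from the fibre itself
        or from a key of larger rank, and \<open>c\<close> has none of the latter.\<close>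
      have "rbd (F k) (restrict_frag (F k) c) = 0"
      proof (rule poly_mapping_eqI)
        fix b
        have "(\<Sum>a\<in>keys c \<inter> F k. Poly_Mapping.lookup (restrict_frag (F k) c) a * Poly_Mapping.lookup (bd a) b)
            = (\<Sum>a\<in>keys c \<inter> F k. Poly_Mapping.lookup c a * Poly_Mapping.lookup (bd a) b)"
          by (rule sum.cong) auto
        also have "\<dots> = (\<Sum>a\<in>keys c. Poly_Mapping.lookup c a * Poly_Mapping.lookup (bd a) b)"
          if b: "b \<in> F k"
        proof (rule sum.mono_neutral_left)
          show "\<forall>a\<in>keys c - keys c \<inter> F k. Poly_Mapping.lookup c a * Poly_Mapping.lookup (bd a) b = 0"
          proof
            fix a assume a: "a \<in> keys c - keys c \<inter> F k"
            then have "a \<in> S" "rk (key a) \<le> n" "key a \<noteq> k" using Suc.prems by (auto simp: F_def)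
            then have "b \<notin> keys (bd a)"
              using mono[of a b] b \<open>k \<in> K\<close> by (auto simp: F_def K_def)
            then show "Poly_Mapping.lookup c a * Poly_Mapping.lookup (bd a) b = 0"
              by (simp add: in_keys_iff)
          qed
        qed auto
        also have "\<dots> = Poly_Mapping.lookup (rbd S c) b" if b: "b \<in> F k"
          using b by (simp add: lookup_rbd F_def)
        finally show "Poly_Mapping.lookup (rbd (F k) (restrict_frag (F k) c)) b = Poly_Mapping.lookup 0 b"
          using Suc.prems by (auto simp: lookup_rbd[of "F k"])
      qed
      moreover have "keys (restrict_frag (F k) c) \<subseteq> F k" by auto
      ultimately show ?thesis using acyclicE[OF fibres[of k, folded F_def]] by metis
    qed
    then obtain d where d: "\<And>k. k \<in> K \<Longrightarrow> keys (d k) \<subseteq> F k"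
        "\<And>k. k \<in> K \<Longrightarrow> rbd (F k) (d k) = restrict_frag (F k) c" by metis
    define e where "e = (\<Sum>k\<in>K. d k)"
    have FS: "F k \<subseteq> S" for k by (auto simp: F_def)
    have eS: "keys e \<subseteq> S"
      unfolding e_def using subset_trans[OF d(1) FS] by (intro keys_sum_subset)
    \<comment> \<open>At rank \<open>n\<close> or above, the boundary of \<open>d k\<close> is
      visible only in its own fibre. Hence \<open>rbd S e\<close> agrees with \<open>c\<close> on
      the top layer.\<close>
    have *: "Poly_Mapping.lookup (rbd S (d k)) b = (if key b = k then Poly_Mapping.lookup c b else 0)"
      if "k \<in> K" "b \<in> S" "n \<le> rk (key b)" for k b
    proof (cases "key b = k")
      case True
      have "Poly_Mapping.lookup (rbd S (d k)) b = Poly_Mapping.lookup (rbd (F k) (d k)) b"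
        using True that by (simp add: lookup_rbd F_def)
      then show ?thesis using True that d by (simp add: F_def)
    next
      case False
      have "b \<notin> keys (bd a)" if "a \<in> keys (d k)" for a
        using d(1)[OF \<open>k \<in> K\<close>] that mono[of a b] \<open>k \<in> K\<close> \<open>b \<in> S\<close> \<open>n \<le> rk (key b)\<close> False
        by (auto simp: F_def K_def)
      then have "b \<notin> keys (rbd S (d k))" by (auto elim: keys_rbdE)
      then show ?thesis using False by (simp add: in_keys_iff)
    qed
    have "keys (c - rbd S e) \<subseteq> {a \<in> S. rk (key a) < n}"
    proof
      fix b assume b: "b \<in> keys (c - rbd S e)"
      then have bS: "b \<in> S"
        using Suc.prems keys_rbd[of S e] keys_diff[of c "rbd S e"] by auto
      moreover have "rk (key b) < n"
      proof (rule ccontr)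
        assume n: "\<not> rk (key b) < n"
        have "Poly_Mapping.lookup (rbd S e) b = (\<Sum>k\<in>K. if key b = k then Poly_Mapping.lookup c b else 0)"
          using n bS by (auto simp: e_def rbd_sum lookup_sum * intro!: sum.cong)
        also have "\<dots> = Poly_Mapping.lookup c b"
        proof (cases "b \<in> keys c")
          case True
          then have "key b \<in> K" using Suc.prems n by (auto simp: K_def)
          then show ?thesis using finK by simp
        next
          case False
          then have "Poly_Mapping.lookup c b = 0" by (simp add: in_keys_iff)
          then show ?thesis by (simp cong: if_cong)
        qed
        finally show False using b by (simp add: in_keys_iff lookup_minus)
      qed
      ultimately show "b \<in> {a \<in> S. rk (key a) < n}" by auto
    qed
    moreover have "rbd S (c - rbd S e) = 0"
      using Suc.prems rbd_rbd[OF conv eS] by (simp add: rbd_diff)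
    ultimately obtain d' where "keys d' \<subseteq> S" "rbd S d' = c - rbd S e"
      using Suc.IH[of "c - rbd S e"] by metis
    then have "keys (d' + e) \<subseteq> S" "rbd S (d' + e) = c"
      using keys_add_subset[of d' S e] eS by (auto simp: rbd_add)
    then show ?case by blast
  qed
  have bounded: "\<exists>n. keys c \<subseteq> {a \<in> S. rk (key a) < n}" if "keys c \<subseteq> S" for c
  proof -
    have "rk (key a) < Suc (Max ((rk \<circ> key) ` keys c))" if "a \<in> keys c" for a
      using that by (auto intro!: le_imp_less_Suc Max_ge)
    then show ?thesis using that by blast
  qed
  show ?thesis
    unfolding acyclic_def using main bounded by metis
qed

lemma convex_fibre:
  fixes key :: "'b \<Rightarrow> 'k" and rk :: "'k \<Rightarrow> nat"
  assumes conv: "convex S"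
    and mono: "\<And>a b. a \<in> S \<Longrightarrow> b \<in> S \<Longrightarrow> b \<in> keys (bd a) \<Longrightarrow> key b = key a \<or> rk (key b) < rk (key a)"
  shows "convex {a \<in> S. key a = k}"
  unfolding convex_def
proof (intro ballI allI impI)
  fix a c b assume *: "a \<in> {a \<in> S. key a = k}" "c \<in> {a \<in> S. key a = k}" "b \<in> keys (bd a)" "c \<in> keys (bd b)"
  then have "b \<in> S" using conv unfolding convex_def by blast
  with * show "b \<in> {a \<in> S. key a = k}" using mono[of a b] mono[of b c] by auto
qed

lemma acyclic_empty [simp]: "acyclic {}"
  by (auto simp: acyclic_def)

text \<open>An elementary collapse: as the incidence coefficient \<open>u\<close> is a unit, no
  nonzero multiple of \<open>b\<close> enters a cycle, and every multiple of \<open>a\<close> bounds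
  a multiple of \<open>b\<close>.\<close>

lemma acyclic_pair:
  assumes "\<bar>Poly_Mapping.lookup (bd b) a\<bar> = 1"
  shows "acyclic {a, b}"
  unfolding acyclic_def
proof (intro allI impI)
  fix c assume c: "keys c \<subseteq> {a, b}" "rbd {a, b} c = 0"
  define u where "u = Poly_Mapping.lookup (bd b) a"
  have u: "u * u = 1" using assms abs_mult_self_eq[of u] by (simp add: u_def)
  have aa: "a \<in> keys (bd b)" using assms by (auto simp: in_keys_iff)
  have z: "Poly_Mapping.lookup (bd a) a = 0" "Poly_Mapping.lookup (bd b) b = 0" "Poly_Mapping.lookup (bd a) b = 0"
    using deg_bd[of a a] deg_bd[of b b] deg_bd[of b a] deg_bd[OF aa] by (force simp: in_keys_iff)+
  have ab: "a \<noteq> b" using deg_bd[OF aa] by auto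
  have sum2: "(\<Sum>x\<in>keys c'. Poly_Mapping.lookup c' x * Poly_Mapping.lookup (bd x) y) =
      (\<Sum>x\<in>{a, b}. Poly_Mapping.lookup c' x * Poly_Mapping.lookup (bd x) y)"
    if "keys c' \<subseteq> {a, b}" for c' y
    using that by (intro sum.mono_neutral_left) (auto simp: in_keys_iff)
  have "Poly_Mapping.lookup (rbd {a, b} c) a = 0" using c by simp
  then have "Poly_Mapping.lookup c b * u = 0"
    using ab z by (simp add: lookup_rbd sum2[OF c(1)] u_def)
  then have cb: "Poly_Mapping.lookup c b = 0" using u by auto
  let ?d = "frag_cmul (u * Poly_Mapping.lookup c a) (frag_of b)"
  have kd: "keys ?d \<subseteq> {a, b}" by auto
  have "Poly_Mapping.lookup (rbd {a, b} ?d) x = Poly_Mapping.lookup c x" for x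
  proof (cases "x = a")
    case True
    have "u * Poly_Mapping.lookup c a * u = Poly_Mapping.lookup c a"
      using u by (simp add: mult.commute mult.left_commute)
    then show ?thesis
      unfolding lookup_rbd sum2[OF kd] using True ab by (simp add: u_def)
  next
    case False
    then have "Poly_Mapping.lookup c x = 0" using c cb by (auto simp: in_keys_iff)
    then show ?thesis
      unfolding lookup_rbd sum2[OF kd] using False ab z by simp
  qed
  then have "rbd {a, b} ?d = c" by (rule poly_mapping_eqI)
  then show "\<exists>d. keys d \<subseteq> {a, b} \<and> rbd {a, b} d = c" by (intro exI[of _ ?d]) auto
qed

end

section \<open>Relabelling a basis\<close>

definition map_frag :: "('a \<Rightarrow> 'b) \<Rightarrow> ('a \<Rightarrow>\<^sub>0 int) \<Rightarrow> 'b \<Rightarrow>\<^sub>0 int" where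
  "map_frag \<phi> = frag_extend (frag_of \<circ> \<phi>)"

lemma map_frag_add: "map_frag \<phi> (a + b) = map_frag \<phi> a + map_frag \<phi> b"
  and map_frag_diff: "map_frag \<phi> (a - b) = map_frag \<phi> a - map_frag \<phi> b"
  and map_frag_cmul: "map_frag \<phi> (frag_cmul k a) = frag_cmul k (map_frag \<phi> a)"
  and map_frag_0 [simp]: "map_frag \<phi> 0 = 0"
  and map_frag_of [simp]: "map_frag \<phi> (frag_of x) = frag_of (\<phi> x)"
  by (simp_all add: map_frag_def frag_extend_add frag_extend_diff frag_extend_cmul)

lemma keys_map_frag: "keys (map_frag \<phi> c) \<subseteq> \<phi> ` keys c"
  using keys_frag_extend[of "frag_of \<circ> \<phi>" c] by (auto simp: map_frag_def)

lemma map_frag_inverse: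
  assumes "\<And>b. b \<in> keys c \<Longrightarrow> \<psi> (\<phi> b) = b"
  shows "map_frag \<psi> (map_frag \<phi> c) = c"
proof -
  have "map_frag \<psi> (map_frag \<phi> c) = frag_extend (frag_of \<circ> \<psi> \<circ> \<phi>) c"
    by (simp add: map_frag_def frag_extend_compose)
  also have "\<dots> = frag_extend frag_of c"
    using assms by (intro frag_extend_eq) auto
  finally show ?thesis using frag_expansion[of c] by simp
qed

context based_complex
begin

lemma rbd_map_frag:
  assumes "\<And>b. b \<in> S \<Longrightarrow> rbd S' (frag_of (\<phi> b)) = map_frag \<phi> (rbd S (frag_of b))" "keys c \<subseteq> S"
  shows "rbd S' (map_frag \<phi> c) = map_frag \<phi> (rbd S c)"
  using assms(2) by (induction c rule: frag_induction) (auto simp: rbd_diff map_frag_diff assms(1))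

text \<open>A bijection of bases that commutes with the restricted boundaries is an isomorphism of
  complexes. The degree may change, which is how appended suffixes shift the homology.\<close>

lemma hgen_bij:
  assumes bij: "\<And>b. b \<in> S \<Longrightarrow> \<phi> b \<in> S' \<and> \<psi> (\<phi> b) = b" "\<And>b. b \<in> S' \<Longrightarrow> \<psi> b \<in> S \<and> \<phi> (\<psi> b) = b"
    and bd: "\<And>b. b \<in> S \<Longrightarrow> rbd S' (frag_of (\<phi> b)) = map_frag \<phi> (rbd S (frag_of b))"
    and dg: "\<And>b. b \<in> S \<Longrightarrow> deg b = n \<Longrightarrow> deg (\<phi> b) = n'"
    and z: "hgen S n z"
  shows "hgen S' n' (map_frag \<phi> z) \<and> (map_frag \<phi> z = 0 \<longleftrightarrow> z = 0)"
proof -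
  have inv1: "map_frag \<psi> (map_frag \<phi> c) = c" if "keys c \<subseteq> S" for c
    using that bij by (intro map_frag_inverse) auto
  have inv2: "map_frag \<phi> (map_frag \<psi> c) = c" if "keys c \<subseteq> S'" for c
    using that bij by (intro map_frag_inverse) auto
  have k1: "keys (map_frag \<phi> c) \<subseteq> S'" if "keys c \<subseteq> S" for c
    using keys_map_frag[of \<phi> c] that bij by auto
  have k2: "keys (map_frag \<psi> c) \<subseteq> S" if "keys c \<subseteq> S'" for c
    using keys_map_frag[of \<psi> c] that bij by auto
  have r1: "rbd S' (map_frag \<phi> c) = map_frag \<phi> (rbd S c)" if "keys c \<subseteq> S" for c
    using bd that by (rule rbd_map_frag)
  have r2: "rbd S (map_frag \<psi> c) = map_frag \<psi> (rbd S' c)" if "keys c \<subseteq> S'" for c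
    using r1[OF k2[OF that]] inv2[OF that] inv1[OF keys_rbd] by metis
  have kz: "keys z \<subseteq> S" "keys z \<subseteq> {b. deg b = n}" and bz: "rbd S z = 0"
    using z by (auto simp: hgen_def)
  have z0: "map_frag \<phi> z = 0 \<longleftrightarrow> z = 0" using inv1[OF kz(1)] by (metis map_frag_0)
  have "hgen S' n' (map_frag \<phi> z)"
    unfolding hgen_def
  proof (intro conjI allI impI)
    show "keys (map_frag \<phi> z) \<subseteq> S' \<inter> {b. deg b = n'}"
      using keys_map_frag[of \<phi> z] kz bij dg by fastforce
    show "rbd S' (map_frag \<phi> z) = 0" using r1[OF kz(1)] bz by simp
    show "\<exists>m d. keys d \<subseteq> S' \<and> c = frag_cmul m (map_frag \<phi> z) + rbd S' d"
      if c: "keys c \<subseteq> S'" "rbd S' c = 0" for c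
    proof -
      have "rbd S (map_frag \<psi> c) = 0" using r2 c by simp
      then obtain m d where d: "keys d \<subseteq> S" "map_frag \<psi> c = frag_cmul m z + rbd S d"
        using hgen_cycleE[OF z k2[OF c(1)]] by metis
      have "c = map_frag \<phi> (map_frag \<psi> c)" using inv2[OF c(1)] by simp
      also have "\<dots> = frag_cmul m (map_frag \<phi> z) + rbd S' (map_frag \<phi> d)"
        using r1[OF d(1)] by (simp add: d(2) map_frag_add map_frag_cmul)
      finally show ?thesis using k1[OF d(1)] by blast
    qed
    show "frag_cmul m (map_frag \<phi> z) = 0"
      if d: "keys d \<subseteq> S'" "rbd S' d = frag_cmul m (map_frag \<phi> z)" for m d
    proof -
      have "rbd S (map_frag \<psi> d) = frag_cmul m z"
        using r2[OF d(1)] d(2) inv1[OF kz(1)] by (simp add: map_frag_cmul)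
      then have "frag_cmul m z = 0" using hgen_unique[OF z k2[OF d(1)]] by blast
      then show ?thesis using z0 by simp
    qed
  qed
  with z0 show ?thesis by blast
qed

end

section \<open>Complexes of lists\<close>

text \<open>The magnitude boundary with the metric condition replaced by an abstract relation:
  \<open>g a b c\<close> means that \<open>b\<close> may be removed between \<open>a\<close> and
  \<open>c\<close>. Both end entries always stay.\<close>

definition list_bd :: "('v \<Rightarrow> 'v \<Rightarrow> 'v \<Rightarrow> bool) \<Rightarrow> 'v list \<Rightarrow> 'v list \<Rightarrow>\<^sub>0 int" where
  "list_bd g l = (\<Sum>i\<in>{1..<length l - 1}. frag_cmul ((-1) ^ i)
     (if g (l ! (i - 1)) (l ! i) (l ! (i + 1)) then frag_of (take i l @ drop (Suc i) l) else 0))"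

lemma list_bd_short: "length l \<le> 2 \<Longrightarrow> list_bd g l = 0"
  by (simp add: list_bd_def)

lemma map_frag_sum: "map_frag \<phi> (\<Sum>i\<in>I. f i) = (\<Sum>i\<in>I. map_frag \<phi> (f i))"
  by (induction I rule: infinite_finite_induct) (simp_all add: map_frag_add)

text \<open>The first term removes \<open>b\<close>; the remaining deletions are those of the tail
  with every index raised by one, hence the sign.\<close>

lemma list_bd_Cons:
  "list_bd g (a # b # c # r) =
     - (if g a b c then frag_of (a # c # r) else 0) - map_frag ((#) a) (list_bd g (b # c # r))"
proof -
  define l where "l = b # c # r"
  define t where "t i = frag_cmul ((-1) ^ i) (if g ((a # l) ! (i - 1)) ((a # l) ! i) ((a # l) ! (i + 1))
      then frag_of (take i (a # l) @ drop (Suc i) (a # l)) else 0)" for i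
  have "list_bd g (a # l) = (\<Sum>i\<in>{1..<length l}. t i)"
    by (simp add: list_bd_def t_def)
  also have "\<dots> = t 1 + (\<Sum>i\<in>{Suc 1..<length l}. t i)"
    by (rule sum.atLeast_Suc_lessThan) (simp add: l_def)
  also have "(\<Sum>i\<in>{Suc 1..<length l}. t i) = (\<Sum>i\<in>{1..<length l - 1}. t (Suc i))"
    by (rule sum.reindex_bij_witness[of _ Suc "\<lambda>i. i - 1"]) (auto simp: l_def)
  also have "\<dots> = - map_frag ((#) a) (list_bd g l)"
    unfolding list_bd_def map_frag_sum sum_negf[symmetric]
    by (rule sum.cong) (auto simp: t_def map_frag_cmul)
  also have "t 1 = - (if g a b c then frag_of (a # c # r) else 0)"
    by (simp add: t_def l_def)
  finally show ?thesis by (simp add: l_def)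
qed

lemma list_bd_index:
  "list_bd g l = (\<Sum>i\<in>{i. Suc i < length l \<and> 0 < i}. frag_cmul ((-1) ^ i)
     (if g (l ! (i - 1)) (l ! i) (l ! Suc i) then frag_of (take i l @ drop (Suc i) l) else 0))"
proof -
  have "{1..<length l - 1} = {i. Suc i < length l \<and> 0 < i}" by auto
  then show ?thesis by (simp add: list_bd_def)
qed

lemma keys_list_bdE:
  assumes "l' \<in> keys (list_bd g l)"
  obtains u a b c v where "l = u @ a # b # c # v" "l' = u @ a # c # v" "g a b c"
proof -
  have "l' \<in> (\<Union>i\<in>{1..<length l - 1}. keys (frag_cmul ((-1) ^ i)
     (if g (l ! (i - 1)) (l ! i) (l ! (i + 1)) then frag_of (take i l @ drop (Suc i) l) else 0)))"
    by (rule subsetD[OF keys_sum assms[unfolded list_bd_def]])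
  then obtain i where "i \<in> {1..<length l - 1}" "g (l ! (i - 1)) (l ! i) (l ! Suc i)"
      "l' = take i l @ drop (Suc i) l"
    by (auto split: if_splits)
  then have i: "0 < i" "Suc i < length l" "g (l ! (i - 1)) (l ! i) (l ! Suc i)"
      "l' = take i l @ drop (Suc i) l"
    by auto
  then obtain j where j: "i = Suc j" by (cases i) auto
  have d: "drop j l = l ! j # l ! i # l ! Suc i # drop (Suc (Suc i)) l"
    using i by (metis Cons_nth_drop_Suc Suc_lessD j)
  have "l = take j l @ drop j l" by simp
  then have l: "l = take j l @ l ! j # l ! i # l ! Suc i # drop (Suc (Suc i)) l" using d by simp
  have "take i l = take j l @ [l ! j]" using i j by (simp add: take_Suc_conv_app_nth)
  moreover have "drop (Suc i) l = l ! Suc i # drop (Suc (Suc i)) l"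
    using i by (simp add: Cons_nth_drop_Suc)
  ultimately have "l' = take j l @ l ! j # l ! Suc i # drop (Suc (Suc i)) l"
    using i by simp
  with l show ?thesis using that i j by simp
qed

lemma deletion_neq:
  assumes "distinct_adj l" "i < j" "j < length l"
  shows "take i l @ drop (Suc i) l \<noteq> take j l @ drop (Suc j) l"
proof
  assume eq: "take i l @ drop (Suc i) l = take j l @ drop (Suc j) l"
  have "(take i l @ drop (Suc i) l) ! i = l ! Suc i" "(take j l @ drop (Suc j) l) ! i = l ! i"
    using assms by (auto simp: nth_append)
  then have "l ! Suc i = l ! i" using eq by simp
  then show False using assms distinct_adj_nth[of l i] by auto
qed

text \<open>In a list without equal neighbours, deletions at different positions give different
  lists, so no other term of the boundary can cancel this one.\<close>

lemma lookup_list_bd: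
  assumes "distinct_adj (u @ a # b # c # v)" "g a b c"
  shows "\<bar>Poly_Mapping.lookup (list_bd g (u @ a # b # c # v)) (u @ a # c # v)\<bar> = 1"
proof -
  define l where "l = u @ a # b # c # v"
  define k where "k = Suc (length u)"
  have k: "0 < k" "Suc k < length l" "l ! (k - 1) = a" "l ! k = b" "l ! Suc k = c"
      "take k l @ drop (Suc k) l = u @ a # c # v"
    by (auto simp: l_def k_def nth_append)
  have "Poly_Mapping.lookup (list_bd g l) (u @ a # c # v) =
      (\<Sum>i\<in>{i. Suc i < length l \<and> 0 < i}. if i = k then (-1) ^ k else 0)"
    unfolding list_bd_index lookup_sum
  proof (rule sum.cong)
    fix i assume i: "i \<in> {i. Suc i < length l \<and> 0 < i}"
    show "Poly_Mapping.lookup (frag_cmul ((-1) ^ i)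
        (if g (l ! (i - 1)) (l ! i) (l ! Suc i) then frag_of (take i l @ drop (Suc i) l) else 0))
        (u @ a # c # v) = (if i = k then (-1) ^ k else 0)"
    proof (cases "i = k")
      case True
      then show ?thesis using k assms by simp
    next
      case False
      then have "take i l @ drop (Suc i) l \<noteq> take k l @ drop (Suc k) l"
        using deletion_neq[of l i k] deletion_neq[of l k i] i k assms(1)
        by (cases "i < k") (auto simp: l_def)
      then show ?thesis using False k by simp
    qed
  qed simp
  also have "\<dots> = (-1) ^ k"
  proof -
    have "finite {i. Suc i < length l \<and> 0 < i}" by (rule finite_subset[of _ "{..<length l}"]) auto
    then show ?thesis using k by (simp add: sum.delta)
  qed
  finally show ?thesis by (simp add: l_def power_abs)
qed

text \<open>Of four consecutive entries the inner two can be removed in one order if and only if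
  they can be removed in the other. For a metric both sides say that the three consecutive distances
  add up to the distance from \<open>a\<close> to \<open>d\<close>.\<close>

locale betweenness =
  fixes g :: "'v \<Rightarrow> 'v \<Rightarrow> 'v \<Rightarrow> bool"
  assumes four_points: "g a b c \<and> g a c d \<longleftrightarrow> g b c d \<and> g a b d"
begin

text \<open>The boundary term of \<open>a # l\<close> that removes the head of \<open>l\<close>,
  without its sign; it is split off so that the square of the boundary can be computed by recursion
  on the list.\<close>

definition absorb :: "'v \<Rightarrow> 'v list \<Rightarrow> 'v list \<Rightarrow>\<^sub>0 int" where
  "absorb a l = (case l of b # c # r \<Rightarrow> if g a b c then frag_of (a # c # r) else 0 | _ \<Rightarrow> 0)"

lemma list_bd_Cons_absorb: "list_bd g (a # l) = - absorb a l - map_frag ((#) a) (list_bd g l)"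
proof -
  consider "l = []" | x where "l = [x]" | b c r where "l = b # c # r"
    by (metis list.exhaust)
  then show ?thesis
    by cases (simp_all add: absorb_def list_bd_short list_bd_Cons)
qed

lemma bd_map_Cons:
  "frag_extend (list_bd g) (map_frag ((#) a) y) =
     - frag_extend (absorb a) y - map_frag ((#) a) (frag_extend (list_bd g) y)"
proof -
  have "keys y \<subseteq> UNIV" by simp
  then show ?thesis
    by (induction y rule: frag_induction)
      (simp_all add: list_bd_Cons_absorb map_frag_diff frag_extend_diff)
qed

lemma absorb_map_Cons:
  assumes "\<And>l. l \<in> keys y \<Longrightarrow> l \<noteq> [] \<and> hd l = c"
  shows "frag_extend (absorb a) (map_frag ((#) b) y) = (if g a b c then map_frag ((#) a) y else 0)"
proof -
  have "keys y \<subseteq> {l. l \<noteq> [] \<and> hd l = c}" using assms by auto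
  then show ?thesis
  proof (induction y rule: frag_induction)
    case (one x)
    then show ?case by (cases x) (auto simp: absorb_def)
  qed (simp_all add: frag_extend_diff map_frag_diff)
qed

lemma keys_list_bd_hd: "l' \<in> keys (list_bd g l) \<Longrightarrow> l' \<noteq> [] \<and> hd l' = hd l"
  by (elim keys_list_bdE) (auto simp: hd_append)

text \<open>The only nontrivial comparison is the removal of both of the first two entries of
  \<open>l\<close>, in either order, and this is \<open>four_points\<close>. All other deletions
  take place behind the entries that \<open>absorb\<close> inspects.\<close>

lemma bd_absorb: "frag_extend (list_bd g) (absorb a l) = frag_extend (absorb a) (list_bd g l)"
proof -
  consider "length l \<le> 2" | b c d r where "l = b # c # d # r"
    by (cases l; cases "tl l"; cases "tl (tl l)") auto
  then show ?thesis
  proof cases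
    case 1
    then have "frag_extend (list_bd g) (absorb a l) = 0"
      by (auto simp: absorb_def list_bd_short split: list.splits)
    then show ?thesis using 1 by (simp add: list_bd_short)
  next
    case 2
    have *: "frag_extend (absorb a) (map_frag ((#) b) (list_bd g (c # d # r))) =
        (if g a b c then map_frag ((#) a) (list_bd g (c # d # r)) else 0)"
      using keys_list_bd_hd[of _ "c # d # r"] by (intro absorb_map_Cons) auto
    have "frag_extend (absorb a) (list_bd g l) =
        - (if g b c d \<and> g a b d then frag_of (a # d # r) else 0)
        - (if g a b c then map_frag ((#) a) (list_bd g (c # d # r)) else 0)"
      unfolding 2 list_bd_Cons frag_extend_diff frag_extend_minus *
      by (simp add: absorb_def)
    also have "\<dots> = frag_extend (list_bd g) (absorb a l)"
      unfolding 2 using four_points[of a b c d] by (auto simp: absorb_def list_bd_Cons)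
    finally show ?thesis by simp
  qed
qed

lemma bd_list_bd: "frag_extend (list_bd g) (list_bd g l) = 0"
proof (induction l)
  case Nil
  then show ?case by (simp add: list_bd_short)
next
  case (Cons a l)
  then show ?case
    by (simp add: list_bd_Cons_absorb frag_extend_diff frag_extend_minus bd_absorb bd_map_Cons)
qed

sublocale based_complex "list_bd g" length
proof
  show "frag_extend (list_bd g) (list_bd g b) = 0" for b by (rule bd_list_bd)
  show "length b = Suc (length b')" if "b' \<in> keys (list_bd g b)" for b b'
    using that by (elim keys_list_bdE) simp
qed

text \<open>All lists in \<open>S\<close> end in the same entry \<open>h\<close>. If deleting the
  last entry of \<open>l\<close>, or an entry of \<open>p\<close>, again gave a list from
  \<open>S\<close> followed by \<open>p\<close>, then \<open>h\<close> would occur twice in a row,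
  or \<open>p\<close> would begin with \<open>h\<close>; neighbours being distinct excludes
  both.\<close>

lemma append_deletion:
  assumes da: "distinct_adj (l @ p)" and l: "l \<in> S" and i: "0 < i" "Suc i < length (l @ p)"
    and S: "\<And>l. l \<in> S \<Longrightarrow> l \<noteq> [] \<and> last l = h"
  shows "take i (l @ p) @ drop (Suc i) (l @ p) \<in> (\<lambda>l. l @ p) ` S \<longleftrightarrow>
    Suc i < length l \<and> take i l @ drop (Suc i) l \<in> S"
proof (cases "Suc i < length l")
  case True
  then have "take i (l @ p) @ drop (Suc i) (l @ p) = (take i l @ drop (Suc i) l) @ p" by simp
  then show ?thesis using True by auto
next
  case False
  have "take i (l @ p) @ drop (Suc i) (l @ p) \<noteq> l' @ p" if "l' \<in> S" for l'
  proof
    assume eq: "take i (l @ p) @ drop (Suc i) (l @ p) = l' @ p"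
    have ll: "l \<noteq> []" "last l = h" "l' \<noteq> []" "last l' = h" using S l that by auto
    have len: "length l' = length l - 1"
      using arg_cong[OF eq, of length] i by simp
    show False
    proof (cases "Suc i = length l")
      case True
      then have "take i l = l'" using eq len by simp
      then have "l = l' @ [h]" using True ll by (metis append_butlast_last_id butlast_conv_take diff_Suc_1)
      then show False using da ll by (auto simp: distinct_adj_append_iff)
    next
      case f: False
      then have "length l \<le> i" using False by auto
      moreover have p: "p \<noteq> []" using i f False by auto
      ultimately have "(l' @ p) ! (length l - 1) = l ! (length l - 1)"
        using ll i by (simp add: eq[symmetric] nth_append)
      moreover have "(l' @ p) ! (length l - 1) = hd p"
        using len p by (simp add: nth_append hd_conv_nth)
      ultimately have "hd p = last l" using ll by (simp add: last_conv_nth)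
      then show False using da p ll by (auto simp: distinct_adj_append_iff)
    qed
  qed
  then show ?thesis using False by auto
qed

lemma rbd_append:
  assumes da: "distinct_adj (l @ p)" and l: "l \<in> S"
    and S: "\<And>l. l \<in> S \<Longrightarrow> l \<noteq> [] \<and> last l = h"
  shows "rbd ((\<lambda>l. l @ p) ` S) (frag_of (l @ p)) = map_frag (\<lambda>l. l @ p) (rbd S (frag_of l))"
proof -
  define t where "t l i = frag_cmul ((-1) ^ i)
    (if g (l ! (i - 1)) (l ! i) (l ! Suc i) then frag_of (take i l @ drop (Suc i) l) else 0)" for l :: "'v list" and i
  let ?I = "\<lambda>l :: 'v list. {i. Suc i < length l \<and> 0 < i}"
  have rf: "restrict_frag T (frag_cmul k (if Q then frag_of x else 0)) =
      (if Q \<and> x \<in> T then frag_cmul k (frag_of x) else 0)" for T k Q and x :: "'v list"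
    by (auto simp: restrict_frag_cmul restrict_frag_id restrict_frag_eq_0)
  have "rbd ((\<lambda>l. l @ p) ` S) (frag_of (l @ p)) = (\<Sum>i\<in>?I (l @ p). restrict_frag ((\<lambda>l. l @ p) ` S) (t (l @ p) i))"
    by (simp add: rbd_def list_bd_index t_def restrict_frag_sum)
  also have "\<dots> = (\<Sum>i\<in>?I l. restrict_frag ((\<lambda>l. l @ p) ` S) (t (l @ p) i))"
  proof (rule sum.mono_neutral_right)
    show "finite (?I (l @ p))" by (rule finite_subset[of _ "{..<length (l @ p)}"]) auto
    show "\<forall>i\<in>?I (l @ p) - ?I l. restrict_frag ((\<lambda>l. l @ p) ` S) (t (l @ p) i) = 0"
    proof
      fix i assume "i \<in> ?I (l @ p) - ?I l"
      then have "take i (l @ p) @ drop (Suc i) (l @ p) \<notin> (\<lambda>l. l @ p) ` S"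
        using append_deletion[OF da l _ _ S, of i] by auto
      then show "restrict_frag ((\<lambda>l. l @ p) ` S) (t (l @ p) i) = 0"
        unfolding t_def rf by simp
    qed
  qed auto
  also have "\<dots> = (\<Sum>i\<in>?I l. map_frag (\<lambda>l. l @ p) (restrict_frag S (t l i)))"
  proof (rule sum.cong)
    fix i assume i: "i \<in> ?I l"
    then have "take i (l @ p) @ drop (Suc i) (l @ p) \<in> (\<lambda>l. l @ p) ` S \<longleftrightarrow> take i l @ drop (Suc i) l \<in> S"
      using append_deletion[OF da l _ _ S, of i] by auto
    then show "restrict_frag ((\<lambda>l. l @ p) ` S) (t (l @ p) i) = map_frag (\<lambda>l. l @ p) (restrict_frag S (t l i))"
      unfolding t_def rf using i less_imp_diff_less[of i "length l" 1]
      by (simp add: nth_append map_frag_cmul)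
  qed simp
  also have "\<dots> = map_frag (\<lambda>l. l @ p) (rbd S (frag_of l))"
    by (simp add: rbd_def list_bd_index t_def restrict_frag_sum map_frag_sum)
  finally show ?thesis .
qed

text \<open>The truth value \<open>b\<close> records whether the generator vanishes, so that one
  equivalence transports both the infinite cyclic and the acyclic case.\<close>

lemma hgen_append_iff:
  assumes S: "\<And>l. l \<in> S \<Longrightarrow> l \<noteq> [] \<and> last l = h \<and> distinct_adj (l @ p)"
  shows "(\<exists>z. hgen ((\<lambda>l. l @ p) ` S) (n + length p) z \<and> (z = 0 \<longleftrightarrow> b)) \<longleftrightarrow> (\<exists>z. hgen S n z \<and> (z = 0 \<longleftrightarrow> b))"
proof -
  have rb: "rbd ((\<lambda>l. l @ p) ` S) (frag_of (l @ p)) = map_frag (\<lambda>l. l @ p) (rbd S (frag_of l))"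
    if "l \<in> S" for l
    using S that by (intro rbd_append) auto
  have 1: "hgen ((\<lambda>l. l @ p) ` S) (n + length p) (map_frag (\<lambda>l. l @ p) z) \<and>
      (map_frag (\<lambda>l. l @ p) z = 0 \<longleftrightarrow> z = 0)" if "hgen S n z" for z
  proof (rule hgen_bij[where \<psi> = "\<lambda>l. take (length l - length p) l", OF _ _ _ _ that])
    show "rbd ((\<lambda>l. l @ p) ` S) (frag_of (l @ p)) = map_frag (\<lambda>l. l @ p) (rbd S (frag_of l))"
      if "l \<in> S" for l using that by (rule rb)
  qed auto
  have 2: "hgen S n (map_frag (\<lambda>l. take (length l - length p) l) z) \<and>
      (map_frag (\<lambda>l. take (length l - length p) l) z = 0 \<longleftrightarrow> z = 0)"
    if "hgen ((\<lambda>l. l @ p) ` S) (n + length p) z" for z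
  proof (rule hgen_bij[where \<psi> = "\<lambda>l. l @ p", OF _ _ _ _ that])
    fix b assume "b \<in> (\<lambda>l. l @ p) ` S"
    then obtain l where l: "l \<in> S" "b = l @ p" by auto
    then show "rbd S (frag_of (take (length b - length p) b)) =
        map_frag (\<lambda>l. take (length l - length p) l) (rbd ((\<lambda>l. l @ p) ` S) (frag_of b))"
      by (simp add: rb map_frag_inverse)
  qed auto
  show ?thesis
  proof
    assume "\<exists>z. hgen ((\<lambda>l. l @ p) ` S) (n + length p) z \<and> (z = 0 \<longleftrightarrow> b)"
    then obtain z where z: "hgen ((\<lambda>l. l @ p) ` S) (n + length p) z" "z = 0 \<longleftrightarrow> b" by auto
    show "\<exists>z. hgen S n z \<and> (z = 0 \<longleftrightarrow> b)" using 2[OF z(1)] z(2) by auto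
  next
    assume "\<exists>z. hgen S n z \<and> (z = 0 \<longleftrightarrow> b)"
    then obtain z where z: "hgen S n z" "z = 0 \<longleftrightarrow> b" by auto
    show "\<exists>z. hgen ((\<lambda>l. l @ p) ` S) (n + length p) z \<and> (z = 0 \<longleftrightarrow> b)"
      using 1[OF z(1)] z(2) by auto
  qed
qed

end

lemma append_eq_append_notin:
  assumes "u @ b # v = \<rho> @ \<tau>" "b \<notin> set \<rho>"
  obtains \<tau>1 where "u = \<rho> @ \<tau>1" "\<tau> = \<tau>1 @ b # v"
proof -
  from assms(1) obtain us where "u = \<rho> @ us \<and> us @ b # v = \<tau> \<or> u @ us = \<rho> \<and> b # v = us @ \<tau>"
    by (auto simp: append_eq_append_conv2)
  then show ?thesis
  proof
    assume "u = \<rho> @ us \<and> us @ b # v = \<tau>"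
    then show ?thesis using that by auto
  next
    assume *: "u @ us = \<rho> \<and> b # v = us @ \<tau>"
    then have "us = []" using assms(2) by (cases us) auto
    then show ?thesis using * that[of "[]"] by auto
  qed
qed

context betweenness
begin

text \<open>Supplies the monotonicity hypothesis of \<open>acyclicI_fibres\<close> for every key of
  the form \<open>filter P\<close>, with the length as rank.\<close>

lemma filter_face:
  assumes "l' \<in> keys (list_bd g l)"
  shows "filter P l' = filter P l \<or> length (filter P l') < length (filter P l)"
  using assms by (elim keys_list_bdE) (auto split: if_splits)

end

section \<open>Order complexes of chains behind a fixed prefix\<close>

locale chain_betweenness = betweenness g
  for g :: "'v \<Rightarrow> 'v \<Rightarrow> 'v \<Rightarrow> bool" +
  fixes N :: "'v set" and lt :: "'v \<Rightarrow> 'v \<Rightarrow> bool"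
  assumes g_N: "b \<in> N \<Longrightarrow> c \<in> N \<Longrightarrow> g a b c"
    and lt_irrefl: "\<not> lt x x"
    and lt_trans: "lt x y \<Longrightarrow> lt y z \<Longrightarrow> lt x z"
begin

definition desc :: "'v list \<Rightarrow> bool" where
  "desc \<sigma> \<longleftrightarrow> sorted_wrt (\<lambda>y z. lt z y) \<sigma>"

lemma desc_simps [simp]: "desc []" "desc (y # \<sigma>) \<longleftrightarrow> (\<forall>z\<in>set \<sigma>. lt z y) \<and> desc \<sigma>"
  "desc (\<sigma> @ \<tau>) \<longleftrightarrow> desc \<sigma> \<and> desc \<tau> \<and> (\<forall>y\<in>set \<sigma>. \<forall>z\<in>set \<tau>. lt z y)"
  by (auto simp: desc_def sorted_wrt_append)

lemma desc_distinct_adj: "desc \<sigma> \<Longrightarrow> distinct_adj \<sigma>"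
proof (induction \<sigma>)
  case (Cons y \<sigma>)
  then show ?case using lt_irrefl by (cases \<sigma>) auto
qed simp

text \<open>Up to a shift this is the augmented chain complex of the order complex of \<Lambda>,
  since the empty chain is included. Thus \<open>acyclic\<close> means vanishing reduced homology,
  and for empty \<Lambda> there is exactly one list.\<close>

definition ch :: "'v \<Rightarrow> 'v set \<Rightarrow> 'v list \<Rightarrow> 'v list set" where
  "ch X \<Lambda> \<rho> = {\<rho> @ \<sigma> @ [X] | \<sigma>. desc \<sigma> \<and> set \<sigma> \<subseteq> \<Lambda>}"

lemma chE:
  assumes "l \<in> ch X \<Lambda> \<rho>"
  obtains \<sigma> where "l = \<rho> @ \<sigma> @ [X]" "desc \<sigma>" "set \<sigma> \<subseteq> \<Lambda>"
  using assms by (auto simp: ch_def)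

lemma chI: "desc \<sigma> \<Longrightarrow> set \<sigma> \<subseteq> \<Lambda> \<Longrightarrow> \<rho> @ \<sigma> @ [X] \<in> ch X \<Lambda> \<rho>"
  by (auto simp: ch_def)

text \<open>The prefix avoids the chain entries, so that filtering recovers it from the list, and it
  has no equal neighbours, so that boundary coefficients are units.\<close>

definition ch_ok :: "'v \<Rightarrow> 'v set \<Rightarrow> 'v list \<Rightarrow> bool" where
  "ch_ok X \<Lambda> \<rho> \<longleftrightarrow> X \<in> N \<and> \<Lambda> \<subseteq> N \<and> X \<notin> \<Lambda> \<and> set \<rho> \<inter> insert X \<Lambda> = {} \<and> \<rho> \<noteq> [] \<and> distinct_adj \<rho>"

lemma ch_ok_subset: "ch_ok X \<Lambda> \<rho> \<Longrightarrow> \<Lambda>' \<subseteq> \<Lambda> \<Longrightarrow> ch_ok X \<Lambda>' \<rho>"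
  by (auto simp: ch_ok_def)

lemma filter_ch:
  assumes "ch_ok X \<Lambda> \<rho>" "l \<in> ch X \<Lambda>' \<rho>" "\<Lambda>' \<subseteq> \<Lambda>"
  shows "filter (\<lambda>y. y \<notin> insert X \<Lambda>) l = \<rho>"
proof -
  obtain \<sigma> where \<sigma>: "l = \<rho> @ \<sigma> @ [X]" "set \<sigma> \<subseteq> \<Lambda>'" using assms(2) by (rule chE)
  have "filter (\<lambda>y. y \<notin> insert X \<Lambda>) \<rho> = \<rho>"
    using assms(1) by (intro filter_True) (auto simp: ch_ok_def)
  moreover have "filter (\<lambda>y. y \<notin> insert X \<Lambda>) \<sigma> = []"
    using \<sigma> assms(3) by (intro filter_False) auto
  ultimately show ?thesis using \<sigma> by simp
qed

text \<open>An unchanged prefix means that the removed entry belongs to the chain part. It is not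
  the final \<open>X\<close>, because a removed entry has a successor.\<close>

lemma ch_face:
  assumes ok: "ch_ok X \<Lambda> \<rho>" and \<sigma>: "set \<sigma> \<subseteq> \<Lambda>"
    and l': "l' \<in> keys (list_bd g (\<rho> @ \<sigma> @ [X]))" "filter (\<lambda>y. y \<notin> insert X \<Lambda>) l' = \<rho>"
  obtains \<sigma>1 b \<sigma>2 where "\<sigma> = \<sigma>1 @ b # \<sigma>2" "l' = \<rho> @ \<sigma>1 @ \<sigma>2 @ [X]"
proof -
  let ?P = "\<lambda>y. y \<notin> insert X \<Lambda>"
  obtain u a b c v where uv: "\<rho> @ \<sigma> @ [X] = u @ a # b # c # v" "l' = u @ a # c # v" "g a b c"
    using l'(1) by (rule keys_list_bdE)
  have "filter ?P (\<rho> @ \<sigma> @ [X]) = \<rho>"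
  proof -
    have "filter ?P \<rho> = \<rho>" using ok by (intro filter_True) (auto simp: ch_ok_def)
    moreover have "filter ?P \<sigma> = []" using \<sigma> by (intro filter_False) auto
    ultimately show ?thesis by simp
  qed
  moreover have "length (filter ?P (\<rho> @ \<sigma> @ [X])) = length (filter ?P l') + (if ?P b then 1 else 0)"
    unfolding uv by simp
  ultimately have "b \<in> insert X \<Lambda>" using l'(2) by (simp split: if_splits)
  then have "b \<notin> set \<rho>" using ok by (auto simp: ch_ok_def)
  moreover have "(u @ [a]) @ b # (c # v) = \<rho> @ (\<sigma> @ [X])" using uv by simp
  ultimately obtain \<tau> where \<tau>: "u @ [a] = \<rho> @ \<tau>" "\<sigma> @ [X] = \<tau> @ b # c # v"
    using append_eq_append_notin by metis
  have cv: "c # v = butlast (c # v) @ [last (c # v)]" by simp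
  have "last (c # v) = X" using arg_cong[OF \<tau>(2), of last] by (simp split: if_splits)
  with cv have cv': "c # v = butlast (c # v) @ [X]" by metis
  then have "\<sigma> @ [X] = (\<tau> @ b # butlast (c # v)) @ [X]" using \<tau>(2) by simp
  then have "\<sigma> = \<tau> @ b # butlast (c # v)" by simp
  moreover have "l' = \<rho> @ \<tau> @ butlast (c # v) @ [X]"
  proof -
    have "l' = (u @ [a]) @ c # v" using uv by simp
    also have "\<dots> = (\<rho> @ \<tau>) @ butlast (c # v) @ [X]" using \<tau>(1) cv' by metis
    finally show ?thesis by simp
  qed
  ultimately show ?thesis using that by blast
qed

lemma convex_ch:
  assumes ok: "ch_ok X \<Lambda> \<rho>"
  shows "convex (ch X \<Lambda> \<rho>)"
  unfolding convex_def
proof (intro ballI allI impI)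
  fix a c b
  assume a: "a \<in> ch X \<Lambda> \<rho>" and c: "c \<in> ch X \<Lambda> \<rho>" and ab: "b \<in> keys (list_bd g a)" and bc: "c \<in> keys (list_bd g b)"
  let ?P = "\<lambda>y. y \<notin> insert X \<Lambda>"
  have "filter ?P a = \<rho>" "filter ?P c = \<rho>" using filter_ch[OF ok] a c by auto
  then have fb: "filter ?P b = \<rho>"
    using filter_face[OF ab, of ?P] filter_face[OF bc, of ?P] by auto
  obtain \<sigma> where \<sigma>: "a = \<rho> @ \<sigma> @ [X]" "desc \<sigma>" "set \<sigma> \<subseteq> \<Lambda>" using a by (rule chE)
  obtain \<sigma>1 x \<sigma>2 where "\<sigma> = \<sigma>1 @ x # \<sigma>2" "b = \<rho> @ (\<sigma>1 @ \<sigma>2) @ [X]"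
    using ch_face[OF ok \<sigma>(3) ab[unfolded \<sigma>(1)] fb] by auto
  then show "b \<in> ch X \<Lambda> \<rho>" using \<sigma> chI[of "\<sigma>1 @ \<sigma>2" \<Lambda> \<rho> X] by auto
qed

lemma subcomplex_ch:
  assumes ok: "ch_ok X \<Lambda> \<rho>" and sub: "\<Lambda>1 \<subseteq> \<Lambda>"
  shows "subcomplex (ch X \<Lambda>1 \<rho>) (ch X \<Lambda> \<rho>)"
  unfolding subcomplex_def
proof (intro conjI ballI subsetI)
  show "l \<in> ch X \<Lambda> \<rho>" if "l \<in> ch X \<Lambda>1 \<rho>" for l
    using that sub by (auto simp: ch_def)
  fix a b assume a: "a \<in> ch X \<Lambda>1 \<rho>" and b: "b \<in> keys (list_bd g a) \<inter> ch X \<Lambda> \<rho>"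
  obtain \<sigma> where \<sigma>: "a = \<rho> @ \<sigma> @ [X]" "desc \<sigma>" "set \<sigma> \<subseteq> \<Lambda>1" using a by (rule chE)
  have fb: "filter (\<lambda>y. y \<notin> insert X \<Lambda>) b = \<rho>" using filter_ch[OF ok] b by auto
  have "set \<sigma> \<subseteq> \<Lambda>" using \<sigma> sub by auto
  moreover have "b \<in> keys (list_bd g (\<rho> @ \<sigma> @ [X]))" using b \<sigma> by auto
  ultimately obtain \<sigma>1 x \<sigma>2 where "\<sigma> = \<sigma>1 @ x # \<sigma>2" "b = \<rho> @ (\<sigma>1 @ \<sigma>2) @ [X]"
    using ch_face[OF ok _ _ fb] by (metis append.assoc)
  then show "b \<in> ch X \<Lambda>1 \<rho>" using \<sigma> chI[of "\<sigma>1 @ \<sigma>2" \<Lambda>1 \<rho> X] by auto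
qed

lemma ch_coeff:
  assumes ok: "ch_ok X \<Lambda> \<rho>" and M: "M \<in> \<Lambda>" "desc (M # \<sigma>)" "set \<sigma> \<subseteq> \<Lambda>"
  shows "\<bar>Poly_Mapping.lookup (list_bd g (\<rho> @ M # \<sigma> @ [X])) (\<rho> @ \<sigma> @ [X])\<bar> = 1"
proof -
  have \<rho>: "\<rho> = butlast \<rho> @ [last \<rho>]" using ok by (auto simp: ch_ok_def)
  obtain c v where cv: "\<sigma> @ [X] = c # v" by (cases "\<sigma> @ [X]") auto
  have "X \<notin> set \<sigma>" using M ok by (auto simp: ch_ok_def)
  then have "distinct_adj (\<sigma> @ [X])"
    using M desc_distinct_adj[of \<sigma>] last_in_set[of \<sigma>] by (auto simp: distinct_adj_append_iff)
  moreover have "M \<noteq> c" using cv M lt_irrefl ok by (cases \<sigma>) (auto simp: ch_ok_def)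
  moreover have "last \<rho> \<noteq> M" using ok M(1) last_in_set[of \<rho>] unfolding ch_ok_def by blast
  ultimately have "distinct_adj (\<rho> @ M # c # v)"
    using ok cv by (auto simp: ch_ok_def distinct_adj_append_iff)
  then have "distinct_adj (butlast \<rho> @ last \<rho> # M # c # v)" by (subst (asm) \<rho>) simp
  moreover have "c \<in> N" using cv M ok by (cases \<sigma>) (auto simp: ch_ok_def)
  then have "g (last \<rho>) M c" using ok M by (intro g_N) (auto simp: ch_ok_def)
  ultimately have "\<bar>Poly_Mapping.lookup (list_bd g (butlast \<rho> @ last \<rho> # M # c # v))
      (butlast \<rho> @ last \<rho> # c # v)\<bar> = 1"
    by (rule lookup_list_bd)
  then show ?thesis unfolding cv using \<rho> by (metis append.assoc append_Cons append_Nil)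
qed

text \<open>A greatest element is the apex of a cone: inserting or deleting \<open>M\<close> at the
  top of a chain matches all chains, the empty one included, in pairs.\<close>

lemma acyclic_cone:
  assumes ok: "ch_ok X \<Lambda> \<rho>" and M: "M \<in> \<Lambda>" "\<And>y. y \<in> \<Lambda> \<Longrightarrow> y = M \<or> lt y M"
  shows "acyclic (ch X \<Lambda> \<rho>)"
proof (rule acyclicI_fibres[where key = "filter (\<lambda>y. y \<noteq> M)" and rk = length])
  show "convex (ch X \<Lambda> \<rho>)" using ok by (rule convex_ch)
  show "filter (\<lambda>y. y \<noteq> M) b = filter (\<lambda>y. y \<noteq> M) a \<or>
      length (filter (\<lambda>y. y \<noteq> M) b) < length (filter (\<lambda>y. y \<noteq> M) a)"
    if "b \<in> keys (list_bd g a)" for a b using that by (rule filter_face)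
  show "acyclic {a \<in> ch X \<Lambda> \<rho>. filter (\<lambda>y. y \<noteq> M) a = k}" for k
  proof (cases "\<exists>\<sigma>. desc \<sigma> \<and> set \<sigma> \<subseteq> \<Lambda> - {M} \<and> k = \<rho> @ \<sigma> @ [X]")
    case True
    then obtain \<sigma> where \<sigma>: "desc \<sigma>" "set \<sigma> \<subseteq> \<Lambda> - {M}" "k = \<rho> @ \<sigma> @ [X]" by auto
    have M': "M \<notin> set \<rho>" "M \<noteq> X" using M ok by (auto simp: ch_ok_def)
    have dM: "desc (M # \<sigma>)" using \<sigma> M by auto
    have "{a \<in> ch X \<Lambda> \<rho>. filter (\<lambda>y. y \<noteq> M) a = k} = {\<rho> @ \<sigma> @ [X], \<rho> @ M # \<sigma> @ [X]}"
    proof (intro equalityI subsetI)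
      fix a assume "a \<in> {a \<in> ch X \<Lambda> \<rho>. filter (\<lambda>y. y \<noteq> M) a = k}"
      then have a: "a \<in> ch X \<Lambda> \<rho>" and ak: "filter (\<lambda>y. y \<noteq> M) a = k" by auto
      obtain \<sigma>' where \<sigma>': "a = \<rho> @ \<sigma>' @ [X]" "desc \<sigma>'" "set \<sigma>' \<subseteq> \<Lambda>" using a by (rule chE)
      have f: "filter (\<lambda>y. y \<noteq> M) \<rho> = \<rho>" using M' by (auto simp: filter_id_conv)
      have \<sigma>eq: "filter (\<lambda>y. y \<noteq> M) \<sigma>' = \<sigma>" using ak \<sigma>' \<sigma> M' f by simp
      show "a \<in> {\<rho> @ \<sigma> @ [X], \<rho> @ M # \<sigma> @ [X]}"
      proof (cases "M \<in> set \<sigma>'")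
        case False
        then have "filter (\<lambda>y. y \<noteq> M) \<sigma>' = \<sigma>'" by (auto simp: filter_id_conv)
        then show ?thesis using \<sigma>eq \<sigma>' by simp
      next
        case True
        then obtain p q where pq: "\<sigma>' = p @ M # q" by (meson split_list)
        have "y \<notin> set p" for y
        proof
          assume "y \<in> set p"
          then have "lt M y" "y \<in> \<Lambda>" using \<sigma>' pq by auto
          then show False using M(2)[of y] lt_trans lt_irrefl by blast
        qed
        then have p: "p = []" by (cases p) auto
        have "M \<notin> set q" using \<sigma>' pq lt_irrefl by auto
        then have "filter (\<lambda>y. y \<noteq> M) q = q" by (auto simp: filter_id_conv)
        then show ?thesis using \<sigma>eq \<sigma>' pq p by simp
      qed
    next
      fix a assume a: "a \<in> {\<rho> @ \<sigma> @ [X], \<rho> @ M # \<sigma> @ [X]}"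
      have f: "filter (\<lambda>y. y \<noteq> M) \<rho> = \<rho>" "filter (\<lambda>y. y \<noteq> M) \<sigma> = \<sigma>"
        using M' \<sigma> by (auto simp: filter_id_conv)
      have "\<rho> @ \<sigma> @ [X] \<in> ch X \<Lambda> \<rho>" using \<sigma> by (intro chI) auto
      moreover have "\<rho> @ (M # \<sigma>) @ [X] \<in> ch X \<Lambda> \<rho>" using \<sigma> dM M by (intro chI) auto
      ultimately show "a \<in> {a \<in> ch X \<Lambda> \<rho>. filter (\<lambda>y. y \<noteq> M) a = k}"
        using a f M' \<sigma> by auto
    qed
    moreover have "acyclic {\<rho> @ \<sigma> @ [X], \<rho> @ M # \<sigma> @ [X]}"
      using ch_coeff[OF ok M(1) dM] \<sigma> by (intro acyclic_pair) auto
    ultimately show ?thesis by simp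
  next
    case False
    have "{a \<in> ch X \<Lambda> \<rho>. filter (\<lambda>y. y \<noteq> M) a = k} = {}"
    proof (rule ccontr)
      assume "\<not> ?thesis"
      then obtain a where a: "a \<in> ch X \<Lambda> \<rho>" and ak: "filter (\<lambda>y. y \<noteq> M) a = k" by auto
      obtain \<sigma>' where \<sigma>': "a = \<rho> @ \<sigma>' @ [X]" "desc \<sigma>'" "set \<sigma>' \<subseteq> \<Lambda>" using a by (rule chE)
      have M': "M \<notin> set \<rho>" "M \<noteq> X" using M ok by (auto simp: ch_ok_def)
      then have "filter (\<lambda>y. y \<noteq> M) \<rho> = \<rho>" by (auto simp: filter_id_conv)
      then have "k = \<rho> @ filter (\<lambda>y. y \<noteq> M) \<sigma>' @ [X]" using ak \<sigma>' M' by simp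
      moreover have "desc (filter (\<lambda>y. y \<noteq> M) \<sigma>')" using \<sigma>'(2) by (simp add: desc_def sorted_wrt_filter)
      moreover have "set (filter (\<lambda>y. y \<noteq> M) \<sigma>') \<subseteq> \<Lambda> - {M}" using \<sigma>' by auto
      ultimately show False using False by blast
    qed
    then show ?thesis by (simp only: acyclic_empty)
  qed
qed

lemma ch_mem_iff: "\<rho> @ \<sigma> @ [X] \<in> ch X \<Lambda> \<rho> \<longleftrightarrow> desc \<sigma> \<and> set \<sigma> \<subseteq> \<Lambda>"
  by (auto simp: ch_def)

text \<open>A Mayer-Vietoris argument. The two closure conditions force every chain in the union to
  lie in one of the two parts; by excision the quotient by the first part is then the quotient of
  the second part by the intersection.\<close>

lemma acyclic_ch_Un:
  assumes ok: "ch_ok X (\<Lambda>1 \<union> \<Lambda>2) \<rho>"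
    and down1: "\<And>y z. y \<in> \<Lambda>1 \<Longrightarrow> z \<in> \<Lambda>2 \<Longrightarrow> lt z y \<Longrightarrow> z \<in> \<Lambda>1"
    and down2: "\<And>y z. y \<in> \<Lambda>2 \<Longrightarrow> z \<in> \<Lambda>1 \<Longrightarrow> lt z y \<Longrightarrow> z \<in> \<Lambda>2"
    and ac: "acyclic (ch X \<Lambda>1 \<rho>)" "acyclic (ch X \<Lambda>2 \<rho>)" "acyclic (ch X (\<Lambda>1 \<inter> \<Lambda>2) \<rho>)"
  shows "acyclic (ch X (\<Lambda>1 \<union> \<Lambda>2) \<rho>)"
proof (rule acyclic_extend[OF convex_ch[OF ok] subcomplex_ch[OF ok] _ ac(1)])
  show "\<Lambda>1 \<subseteq> \<Lambda>1 \<union> \<Lambda>2" by simp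
  have desc_comparable: "y = z \<or> lt y z \<or> lt z y" if "desc \<sigma>" "y \<in> set \<sigma>" "z \<in> set \<sigma>" for \<sigma> y z
    using that by (induction \<sigma>) auto
  have "ch X (\<Lambda>1 \<union> \<Lambda>2) \<rho> - ch X \<Lambda>1 \<rho> = ch X \<Lambda>2 \<rho> - ch X (\<Lambda>1 \<inter> \<Lambda>2) \<rho>"
  proof (intro equalityI subsetI)
    fix l assume l: "l \<in> ch X (\<Lambda>1 \<union> \<Lambda>2) \<rho> - ch X \<Lambda>1 \<rho>"
    then obtain \<sigma> where \<sigma>: "l = \<rho> @ \<sigma> @ [X]" "desc \<sigma>" "set \<sigma> \<subseteq> \<Lambda>1 \<union> \<Lambda>2" by (auto elim: chE)
    then have "\<not> set \<sigma> \<subseteq> \<Lambda>1" using l by (simp add: ch_mem_iff)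
    then obtain y where y: "y \<in> set \<sigma>" "y \<notin> \<Lambda>1" "y \<in> \<Lambda>2" using \<sigma> by auto
    have "set \<sigma> \<subseteq> \<Lambda>2"
      using y \<sigma> desc_comparable[OF \<sigma>(2) y(1)] down1[of _ y] down2[of y] by blast
    then show "l \<in> ch X \<Lambda>2 \<rho> - ch X (\<Lambda>1 \<inter> \<Lambda>2) \<rho>" using \<sigma> y by (auto simp: ch_mem_iff)
  next
    fix l assume l: "l \<in> ch X \<Lambda>2 \<rho> - ch X (\<Lambda>1 \<inter> \<Lambda>2) \<rho>"
    then obtain \<sigma> where "l = \<rho> @ \<sigma> @ [X]" "desc \<sigma>" "set \<sigma> \<subseteq> \<Lambda>2" by (auto elim: chE)
    then show "l \<in> ch X (\<Lambda>1 \<union> \<Lambda>2) \<rho> - ch X \<Lambda>1 \<rho>" using l by (auto simp: ch_mem_iff)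
  qed
  moreover have "acyclic (ch X \<Lambda>2 \<rho> - ch X (\<Lambda>1 \<inter> \<Lambda>2) \<rho>)"
    using ch_ok_subset[OF ok, of \<Lambda>2] ac
    by (intro acyclic_quotient convex_ch subcomplex_ch) auto
  ultimately show "acyclic (ch X (\<Lambda>1 \<union> \<Lambda>2) \<rho> - ch X \<Lambda>1 \<rho>)" by simp
qed

definition chs :: "'v \<Rightarrow> ('v list \<Rightarrow> 'v set) \<Rightarrow> 'v list set \<Rightarrow> 'v list set" where
  "chs X \<Lambda> R = (\<Union>\<rho>\<in>R. ch X (\<Lambda> \<rho>) \<rho>)"

text \<open>Filtering out the common bound \<Gamma> recovers the prefix, and a face that changes the
  prefix shortens it. So the fibres of this key are the complexes over single prefixes.\<close>

lemma acyclic_chs: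
  assumes ok: "\<And>\<rho>. \<rho> \<in> R \<Longrightarrow> ch_ok X \<Gamma> \<rho>" and sub: "\<And>\<rho>. \<rho> \<in> R \<Longrightarrow> \<Lambda> \<rho> \<subseteq> \<Gamma>"
    and conv: "convex (chs X \<Lambda> R)"
    and ac: "\<And>\<rho>. \<rho> \<in> R \<Longrightarrow> acyclic (ch X (\<Lambda> \<rho>) \<rho>)"
  shows "acyclic (chs X \<Lambda> R)"
proof (rule acyclicI_fibres[where key = "filter (\<lambda>y. y \<notin> insert X \<Gamma>)" and rk = length, OF conv])
  show "filter (\<lambda>y. y \<notin> insert X \<Gamma>) b = filter (\<lambda>y. y \<notin> insert X \<Gamma>) a \<or>
      length (filter (\<lambda>y. y \<notin> insert X \<Gamma>) b) < length (filter (\<lambda>y. y \<notin> insert X \<Gamma>) a)"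
    if "b \<in> keys (list_bd g a)" for a b using that by (rule filter_face)
  fix k
  have f: "filter (\<lambda>y. y \<notin> insert X \<Gamma>) a = \<rho>" if "\<rho> \<in> R" "a \<in> ch X (\<Lambda> \<rho>) \<rho>" for \<rho> a
    by (rule filter_ch[OF ok[OF that(1)] that(2) sub[OF that(1)]])
  have "{a \<in> chs X \<Lambda> R. filter (\<lambda>y. y \<notin> insert X \<Gamma>) a = k} = (if k \<in> R then ch X (\<Lambda> k) k else {})"
    using f by (auto simp: chs_def simp del: insert_iff)
  then show "acyclic {a \<in> chs X \<Lambda> R. filter (\<lambda>y. y \<notin> insert X \<Gamma>) a = k}"
    using ac by auto
qed

lemma subcomplex_chs:
  assumes ok: "\<And>\<rho>. \<rho> \<in> R \<Longrightarrow> ch_ok X \<Lambda> \<rho>" and sub: "\<Lambda>1 \<subseteq> \<Lambda>"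
  shows "subcomplex (chs X (\<lambda>_. \<Lambda>1) R) (chs X (\<lambda>_. \<Lambda>) R)"
  unfolding subcomplex_def
proof (intro conjI ballI subsetI)
  show "l \<in> chs X (\<lambda>_. \<Lambda>) R" if l: "l \<in> chs X (\<lambda>_. \<Lambda>1) R" for l
  proof -
    obtain \<rho> \<sigma> where "\<rho> \<in> R" "l = \<rho> @ \<sigma> @ [X]" "desc \<sigma>" "set \<sigma> \<subseteq> \<Lambda>1"
      using l by (auto simp: chs_def elim!: chE)
    then have "l \<in> ch X \<Lambda> \<rho>" using sub by (auto simp: ch_mem_iff)
    then show ?thesis using \<open>\<rho> \<in> R\<close> by (auto simp: chs_def)
  qed
  fix a b assume a: "a \<in> chs X (\<lambda>_. \<Lambda>1) R" and b: "b \<in> keys (list_bd g a) \<inter> chs X (\<lambda>_. \<Lambda>) R"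
  obtain \<rho> \<sigma> where \<sigma>: "\<rho> \<in> R" "a = \<rho> @ \<sigma> @ [X]" "desc \<sigma>" "set \<sigma> \<subseteq> \<Lambda>1"
    using a by (auto simp: chs_def elim!: chE)
  obtain \<rho>' \<sigma>' where \<sigma>': "\<rho>' \<in> R" "b = \<rho>' @ \<sigma>' @ [X]" "desc \<sigma>'" "set \<sigma>' \<subseteq> \<Lambda>"
    using b by (auto simp: chs_def elim!: chE)
  have "set b \<subseteq> set a" using b by (auto elim!: keys_list_bdE)
  then have "set \<sigma>' \<subseteq> set \<rho> \<union> set \<sigma> \<union> {X}" using \<sigma> \<sigma>' by auto
  moreover have "set \<rho> \<inter> \<Lambda> = {}" "X \<notin> \<Lambda>" using ok[OF \<sigma>(1)] by (auto simp: ch_ok_def)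
  ultimately have "set \<sigma>' \<subseteq> \<Lambda>1" using \<sigma>(4) \<sigma>'(4) by blast
  then show "b \<in> chs X (\<lambda>_. \<Lambda>1) R" using \<sigma>' by (auto simp: chs_def ch_mem_iff intro!: bexI[of _ \<rho>'])
qed

text \<open>As \<open>M\<close> is not below any element of \<Lambda>1, it can only head a chain. A
  chain that contains it is a chain below \<open>M\<close> behind the prefix extended by
  \<open>M\<close>, that is, a chain of the link of \<open>M\<close>.\<close>

lemma chs_quotient:
  assumes ok: "\<And>\<rho>. \<rho> \<in> R \<Longrightarrow> ch_ok X (insert M \<Lambda>1) \<rho>" and M: "M \<notin> \<Lambda>1" "\<And>y. y \<in> \<Lambda>1 \<Longrightarrow> \<not> lt M y"
  shows "chs X (\<lambda>_. insert M \<Lambda>1) R - chs X (\<lambda>_. \<Lambda>1) R =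
    chs X (\<lambda>_. {y \<in> \<Lambda>1. lt y M}) ((\<lambda>\<rho>. \<rho> @ [M]) ` R)"
proof (intro equalityI subsetI)
  fix l assume l: "l \<in> chs X (\<lambda>_. insert M \<Lambda>1) R - chs X (\<lambda>_. \<Lambda>1) R"
  then obtain \<rho> \<sigma> where \<sigma>: "\<rho> \<in> R" "l = \<rho> @ \<sigma> @ [X]" "desc \<sigma>" "set \<sigma> \<subseteq> insert M \<Lambda>1"
    by (auto simp: chs_def elim!: chE)
  then have "\<not> set \<sigma> \<subseteq> \<Lambda>1" using l by (auto simp: chs_def ch_mem_iff)
  then have "M \<in> set \<sigma>" using \<sigma> by auto
  then obtain p q where pq: "\<sigma> = p @ M # q" by (meson split_list)
  have "y \<notin> set p" for y
  proof
    assume y: "y \<in> set p"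
    then have "lt M y" using \<sigma> pq by auto
    moreover from this have "y \<noteq> M" using lt_irrefl by auto
    then have "y \<in> \<Lambda>1" using \<sigma> pq y by auto
    ultimately show False using M by blast
  qed
  then have p: "p = []" by (cases p) auto
  have "set q \<subseteq> {y \<in> \<Lambda>1. lt y M}" using \<sigma> pq lt_irrefl by auto
  then have "(\<rho> @ [M]) @ q @ [X] \<in> ch X {y \<in> \<Lambda>1. lt y M} (\<rho> @ [M])"
    using \<sigma> pq by (intro chI) auto
  then show "l \<in> chs X (\<lambda>_. {y \<in> \<Lambda>1. lt y M}) ((\<lambda>\<rho>. \<rho> @ [M]) ` R)"
    using \<sigma> pq p by (auto simp: chs_def intro!: bexI[of _ \<rho>])
next
  fix l assume "l \<in> chs X (\<lambda>_. {y \<in> \<Lambda>1. lt y M}) ((\<lambda>\<rho>. \<rho> @ [M]) ` R)"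
  then obtain \<rho> \<sigma> where \<sigma>: "\<rho> \<in> R" "l = (\<rho> @ [M]) @ \<sigma> @ [X]" "desc \<sigma>" "set \<sigma> \<subseteq> {y \<in> \<Lambda>1. lt y M}"
    by (auto simp: chs_def elim!: chE)
  then have "\<rho> @ (M # \<sigma>) @ [X] \<in> ch X (insert M \<Lambda>1) \<rho>" by (intro chI) auto
  then have 1: "l \<in> chs X (\<lambda>_. insert M \<Lambda>1) R" using \<sigma> by (auto simp: chs_def)
  have "l \<notin> chs X (\<lambda>_. \<Lambda>1) R"
  proof
    assume "l \<in> chs X (\<lambda>_. \<Lambda>1) R"
    then obtain \<rho>' \<sigma>' where \<sigma>': "\<rho>' \<in> R" "l = \<rho>' @ \<sigma>' @ [X]" "set \<sigma>' \<subseteq> \<Lambda>1"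
      by (auto simp: chs_def elim!: chE)
    have "M \<in> set l" using \<sigma> by simp
    then have "M = X \<or> M \<in> set \<rho>' \<or> M \<in> set \<sigma>'" using \<sigma>' by auto
    then show False using ok[OF \<sigma>'(1)] \<sigma>' M by (auto simp: ch_ok_def)
  qed
  with 1 show "l \<in> chs X (\<lambda>_. insert M \<Lambda>1) R - chs X (\<lambda>_. \<Lambda>1) R" by simp
qed

end

section \<open>Covectors\<close>

lemma covector_le_refl [simp]: "covector_le X X"
  by (auto simp: covector_le_def)

lemma covector_le_trans: "covector_le X Y \<Longrightarrow> covector_le Y Z \<Longrightarrow> covector_le X Z"
  unfolding covector_le_def by (metis empty_iff insert_iff)

lemma covector_le_antisym: "covector_le X Y \<Longrightarrow> covector_le Y X \<Longrightarrow> X = Y"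
  unfolding covector_le_def by (rule ext) (metis empty_iff insert_iff)

definition covector_less :: "('e \<Rightarrow> int) \<Rightarrow> ('e \<Rightarrow> int) \<Rightarrow> bool" where
  "covector_less X Y \<longleftrightarrow> covector_le X Y \<and> X \<noteq> Y"

lemma covector_leD: "covector_le X Y \<Longrightarrow> X e \<noteq> 0 \<Longrightarrow> X e = Y e"
  unfolding covector_le_def by auto

lemma covector_leD0: "covector_le X Y \<Longrightarrow> Y e = 0 \<Longrightarrow> X e = 0"
  unfolding covector_le_def by (metis empty_iff insert_iff)

lemma covector_leI: "(\<And>e. X e \<noteq> 0 \<Longrightarrow> X e = Y e) \<Longrightarrow> covector_le X Y"
  unfolding covector_le_def by auto

lemma covector_lessE:
  assumes "covector_less X Y"
  obtains e where "X e = 0" "Y e \<noteq> 0"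
proof -
  obtain e where "X e \<noteq> Y e" using assms by (auto simp: covector_less_def fun_eq_iff)
  then show ?thesis using assms that[of e] covector_leD[of X Y e] unfolding covector_less_def by metis
qed

lemma covector_lessI: "covector_le X Y \<Longrightarrow> X e = 0 \<Longrightarrow> Y e \<noteq> 0 \<Longrightarrow> covector_less X Y"
  by (auto simp: covector_less_def)

lemma covector_less_trans: "covector_less X Y \<Longrightarrow> covector_less Y Z \<Longrightarrow> covector_less X Z"
  unfolding covector_less_def using covector_le_trans covector_le_antisym by blast

lemma covector_less_irrefl [simp]: "\<not> covector_less X X"
  by (simp add: covector_less_def)

lemma covector_less_imp_le: "covector_less X Y \<Longrightarrow> covector_le X Y"
  by (simp add: covector_less_def)

lemma covector_less_le_trans: "covector_less X Y \<Longrightarrow> covector_le Y Z \<Longrightarrow> covector_less X Z"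
  unfolding covector_less_def using covector_le_trans covector_le_antisym by blast

text \<open>For \<open>X \<le> Y\<close> this is the antipode of \<open>Y\<close> seen from the face
  \<open>X\<close>: the same signs on the support of \<open>X\<close>, opposite signs
  elsewhere.\<close>

definition opp :: "('e \<Rightarrow> int) \<Rightarrow> ('e \<Rightarrow> int) \<Rightarrow> 'e \<Rightarrow> int" where
  "opp X Y = sv_comp X (\<lambda>e. - Y e)"

lemma opp_apply: "opp X Y e = (if X e \<noteq> 0 then X e else - Y e)"
  by (simp add: opp_def sv_comp_def)

lemma sep_iff: "e \<in> sep X Y \<longleftrightarrow> X e = - Y e \<and> X e \<noteq> 0"
  by (simp add: sep_def)

section \<open>Elimination and covers of covectors\<close>

locale finite_oriented_matroid = oriented_matroid E L for E :: "'e set" and L +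
  assumes finite_ground: "finite E"
begin

lemma sign_cases: "X \<in> L \<Longrightarrow> X e = 0 \<or> X e = 1 \<or> X e = -1"
  using covectors_sign unfolding sign_vectors_def by blast

lemma outside_ground: "X \<in> L \<Longrightarrow> e \<notin> E \<Longrightarrow> X e = 0"
  using covectors_sign unfolding sign_vectors_def by blast

lemma in_ground: "X \<in> L \<Longrightarrow> X e \<noteq> 0 \<Longrightarrow> e \<in> E"
  using outside_ground by blast

lemma sep_or_eq: "X \<in> L \<Longrightarrow> Y \<in> L \<Longrightarrow> X e \<noteq> 0 \<Longrightarrow> Y e \<noteq> 0 \<Longrightarrow> e \<in> sep X Y \<or> X e = Y e"
  using sign_cases[of X e] sign_cases[of Y e] by (auto simp: sep_iff)

lemma finite_sep: "X \<in> L \<Longrightarrow> finite (sep X Y)"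
  by (rule finite_subset[OF _ finite_ground]) (auto simp: sep_iff intro: in_ground)

lemma opp_closed: "X \<in> L \<Longrightarrow> Y \<in> L \<Longrightarrow> opp X Y \<in> L"
  unfolding opp_def by (intro comp_closed neg_closed)

lemma elimination:
  assumes "X \<in> L" "Y \<in> L" "e \<in> sep X Y"
  obtains Z where "Z \<in> L" "Z e = 0" "\<And>f. f \<notin> sep X Y \<Longrightarrow> Z f = (if X f \<noteq> 0 then X f else Y f)"
proof -
  obtain Z where Z: "Z \<in> L" "Z e = 0" "\<forall>f\<in>E. f \<notin> sep X Y \<longrightarrow> Z f = sv_comp X Y f"
    using strong_elimination[OF assms] by blast
  have "Z f = (if X f \<noteq> 0 then X f else Y f)" if "f \<notin> sep X Y" for f
    using Z that outside_ground[OF Z(1), of f] outside_ground[OF assms(1), of f] outside_ground[OF assms(2), of f]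
    by (cases "f \<in> E") (auto simp: sv_comp_def)
  then show ?thesis using Z that by blast
qed

text \<open>Eliminating a coordinate that separates \<open>Z\<close> from \<open>T\<close> shrinks
  their separation, and coordinates where \<open>Z\<close> agrees with \<open>T\<close> survive.
  When nothing separates any more, the covector lies below \<open>T\<close>, and the zero created by
  an elimination keeps it different from \<open>T\<close>.\<close>

lemma covector_below:
  assumes "T \<in> L" "Z \<in> L" "\<And>e. T e = 0 \<Longrightarrow> Z e = 0" "Z \<noteq> T"
  obtains W where "W \<in> L" "covector_less W T" "\<And>f. Z f = T f \<Longrightarrow> W f = T f"
proof -
  have "\<exists>W\<in>L. covector_less W T \<and> (\<forall>f. Z f = T f \<longrightarrow> W f = T f)"
    using assms(2-4)
  proof (induction "card (sep T Z)" arbitrary: Z rule: less_induct)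
    case less
    show ?case
    proof (cases "sep T Z = {}")
      case True
      have "covector_le Z T"
        using sep_or_eq[OF assms(1) less.prems(1)] True less.prems(2) by (intro covector_leI) fastforce
      then show ?thesis using less.prems by (auto simp: covector_less_def)
    next
      case False
      then obtain e where e: "e \<in> sep T Z" by auto
      obtain Z' where Z': "Z' \<in> L" "Z' e = 0" "\<And>f. f \<notin> sep T Z \<Longrightarrow> Z' f = (if T f \<noteq> 0 then T f else Z f)"
        using elimination[OF assms(1) less.prems(1) e] by metis
      have sub: "sep T Z' \<subseteq> sep T Z - {e}"
      proof
        fix f assume f: "f \<in> sep T Z'"
        have "f \<noteq> e" using f Z'(2) by (auto simp: sep_iff)
        moreover have "f \<in> sep T Z"
        proof (rule ccontr)
          assume "f \<notin> sep T Z"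
          then show False using Z'(3)[of f] f by (auto simp: sep_iff split: if_splits)
        qed
        ultimately show "f \<in> sep T Z - {e}" by simp
      qed
      have "card (sep T Z') < card (sep T Z)"
        using sub e finite_sep[OF assms(1), of Z] by (intro psubset_card_mono) auto
      moreover have "Z' f = 0" if "T f = 0" for f
        using Z'(3)[of f] that less.prems(2)[of f] by (auto simp: sep_iff)
      moreover have "Z' \<noteq> T" using Z'(2) e by (auto simp: sep_iff)
      ultimately obtain W where W: "W \<in> L" "covector_less W T" "\<forall>f. Z' f = T f \<longrightarrow> W f = T f"
        using less.hyps[of Z'] Z'(1) by blast
      have "Z' f = T f" if "Z f = T f" for f
      proof -
        have "f \<notin> sep T Z" using that by (auto simp: sep_iff)
        then show ?thesis using Z'(3)[of f] that by auto
      qed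
      then show ?thesis using W by blast
    qed
  qed
  then show ?thesis using that by blast
qed

definition covered :: "('e \<Rightarrow> int) \<Rightarrow> ('e \<Rightarrow> int) \<Rightarrow> bool" where
  "covered W T \<longleftrightarrow> W \<in> L \<and> T \<in> L \<and> covector_less W T \<and>
     (\<forall>V\<in>L. covector_less W V \<longrightarrow> \<not> covector_less V T)"

text \<open>The coordinates lost between \<open>T\<close> and its facet \<open>W\<close> form one
  parallel class once the zero set of \<open>T\<close> is contracted. If some \<open>Y\<close>
  vanished at \<open>e\<close> but not at \<open>f\<close>, then composing \<open>W\<close> with
  \<open>Y\<close> or its negative and applying \<open>covector_below\<close> would give a covector
  strictly between \<open>W\<close> and \<open>T\<close>.\<close>

lemma parallel:
  assumes cov: "covered W T" and Y: "Y \<in> L" "\<And>e. T e = 0 \<Longrightarrow> Y e = 0"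
    and e: "W e = 0" "T e \<noteq> 0" "Y e = 0" and f: "W f = 0" "T f \<noteq> 0"
  shows "Y f = 0"
proof (rule ccontr)
  assume Yf: "Y f \<noteq> 0"
  have L: "W \<in> L" "T \<in> L" and less: "covector_less W T" using cov by (auto simp: covered_def)
  obtain Y' where Y': "Y' \<in> L" "\<And>e. T e = 0 \<Longrightarrow> Y' e = 0" "Y' e = 0" "Y' f = T f"
  proof (cases "Y f = T f")
    case True
    then show ?thesis using that[of Y] Y e by auto
  next
    case False
    then have "- Y f = T f" using sep_or_eq[OF Y(1) L(2) Yf f(2)] by (auto simp: sep_iff)
    then show ?thesis using that[of "\<lambda>e. - Y e"] Y e neg_closed[OF Y(1)] by auto
  qed
  define Z where "Z = sv_comp W Y'"
  have "Z \<in> L" using L Y' by (simp add: Z_def comp_closed)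
  moreover have "Z x = 0" if "T x = 0" for x
    using that Y'(2)[of x] covector_leD0[OF covector_less_imp_le[OF less] that] by (simp add: Z_def sv_comp_def)
  moreover have "Z \<noteq> T" using e Y' by (auto simp: Z_def sv_comp_def fun_eq_iff)
  ultimately obtain V where V: "V \<in> L" "covector_less V T" "\<And>f. Z f = T f \<Longrightarrow> V f = T f"
    using covector_below[OF L(2)] by metis
  have "V x = W x" if "W x \<noteq> 0" for x
    using that covector_leD[OF covector_less_imp_le[OF less] that] V(3)[of x] by (simp add: Z_def sv_comp_def)
  then have "covector_le W V" by (intro covector_leI) auto
  moreover have "V f \<noteq> 0" using V(3)[of f] f Y' by (simp add: Z_def sv_comp_def)
  ultimately have "covector_less W V" using f by (intro covector_lessI)
  then show False using V cov by (auto simp: covered_def)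
qed

text \<open>This is the wall of \<open>T\<close> to be crossed on the way to \<open>Y\<close>: every
  coordinate lost in \<open>W\<close> is one in which \<open>T\<close> and \<open>Y\<close> differ.
  Among the covectors below \<open>T\<close> with this property one of largest support is a facet,
  because the property passes to everything between it and \<open>T\<close>.\<close>

lemma neighbour:
  assumes L: "T \<in> L" "Y \<in> L" and zero: "\<And>e. T e = 0 \<longleftrightarrow> Y e = 0" and neq: "T \<noteq> Y"
  obtains W where "covered W T" "\<And>f. Y f = T f \<Longrightarrow> W f = T f"
proof -
  define P where "P W \<longleftrightarrow> W \<in> L \<and> covector_less W T \<and> (\<forall>f. Y f = T f \<longrightarrow> W f = T f)" for W
  define s where "s W = card {e \<in> E. W e \<noteq> 0}" for W :: "'e \<Rightarrow> int"
  have "\<exists>W. P W"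
    using covector_below[OF L] zero neq unfolding P_def by metis
  then obtain W0 where W0: "P W0" by blast
  have "s W < Suc (card E)" for W
    unfolding s_def using finite_ground by (intro le_imp_less_Suc card_mono) auto
  then obtain W where W: "P W" "\<And>V. P V \<Longrightarrow> s V \<le> s W"
    using ex_has_greatest_nat[of P W0 s "Suc (card E)", OF W0] by auto
  have "\<not> (covector_less W V \<and> covector_less V T)" if "V \<in> L" for V
  proof
    assume V: "covector_less W V \<and> covector_less V T"
    have "V f = T f" if "Y f = T f" for f
    proof (cases "T f = 0")
      case True
      then show ?thesis using V covector_leD0[of V T f] by (auto simp: covector_less_def)
    next
      case False
      then have "W f \<noteq> 0" using that W by (auto simp: P_def)
      then have "V f \<noteq> 0" using V covector_leD[of W V f] by (auto simp: covector_less_def)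
      then show ?thesis using V covector_leD[of V T f] by (auto simp: covector_less_def)
    qed
    then have "s V \<le> s W" using W(2)[of V] V that by (auto simp: P_def)
    moreover have "s W < s V"
    proof -
      obtain e where e: "W e = 0" "V e \<noteq> 0" using V covector_lessE by metis
      have "{e \<in> E. W e \<noteq> 0} \<subset> {e \<in> E. V e \<noteq> 0}"
      proof
        show "{e \<in> E. W e \<noteq> 0} \<subseteq> {e \<in> E. V e \<noteq> 0}"
          using V covector_leD[of W V] by (fastforce simp: covector_less_def)
        show "{e \<in> E. W e \<noteq> 0} \<noteq> {e \<in> E. V e \<noteq> 0}"
          using e in_ground[OF \<open>V \<in> L\<close> e(2)] by auto
      qed
      then show ?thesis unfolding s_def using finite_ground by (intro psubset_card_mono) auto
    qed
    ultimately show False by simp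
  qed
  then have "covered W T" using W L by (auto simp: covered_def P_def)
  then show ?thesis using that W by (auto simp: P_def)
qed

section \<open>The underlying matroid: closure, exchange and rank\<close>

abbreviation "cl \<equiv> matroid_closure E L"
abbreviation "indep \<equiv> matroid_indep E L"
abbreviation "rank \<equiv> matroid_rank E L"

lemma closure_iff:
  assumes "A \<subseteq> E"
  shows "e \<in> cl A \<longleftrightarrow> e \<in> E \<and> (\<forall>Y\<in>L. (\<forall>a\<in>A. Y a = 0) \<longrightarrow> Y e = 0)"
proof -
  have 1: "e \<in> cl A \<longleftrightarrow> (\<forall>Y\<in>L. A \<subseteq> zero_set E Y \<longrightarrow> e \<in> zero_set E Y)"
    unfolding matroid_closure_def flats_def by auto
  have 2: "A \<subseteq> zero_set E Y \<longleftrightarrow> (\<forall>a\<in>A. Y a = 0)" for Y :: "'e \<Rightarrow> int"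
    using assms by (auto simp: zero_set_def)
  have 3: "e \<in> E" if "e \<in> cl A"
    using that[unfolded 1 2, rule_format, OF zero_covector] by (simp add: zero_set_def)
  show ?thesis using 3 unfolding 1 2 by (auto simp: zero_set_def)
qed

text \<open>Otherwise some \<open>Y1\<close> vanishes on \<open>A\<close> and \<open>e\<close> but
  not at \<open>f\<close>, and some \<open>Y2\<close> vanishes on \<open>A\<close> but not at
  \<open>e\<close>. Eliminating \<open>f\<close> between \<open>Y2\<close> and \<open>Y1\<close> or
  its negative gives a covector that vanishes on \<open>A\<close> and at \<open>f\<close> but not at
  \<open>e\<close>.\<close>

lemma closure_exchange:
  assumes A: "A \<subseteq> E" "f \<in> E" and e: "e \<in> cl (insert f A)" "e \<notin> cl A"
  shows "f \<in> cl (insert e A)"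
proof (rule ccontr)
  assume nf: "f \<notin> cl (insert e A)"
  have eE: "e \<in> E" using e A by (simp add: closure_iff)
  obtain Y1 where Y1: "Y1 \<in> L" "\<forall>a\<in>A. Y1 a = 0" "Y1 e = 0" "Y1 f \<noteq> 0"
    using nf A eE by (auto simp: closure_iff)
  obtain Y2 where Y2: "Y2 \<in> L" "\<forall>a\<in>A. Y2 a = 0" "Y2 e \<noteq> 0"
    using e(2) A eE by (auto simp: closure_iff)
  have star: "Y e = 0" if "Y \<in> L" "\<forall>a\<in>A. Y a = 0" "Y f = 0" for Y
    using e(1) A that by (auto simp: closure_iff)
  then have Y2f: "Y2 f \<noteq> 0" using Y2 by auto
  obtain Y3 where Y3: "Y3 \<in> L" "\<forall>a\<in>A. Y3 a = 0" "Y3 e = 0" "f \<in> sep Y2 Y3"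
  proof (cases "f \<in> sep Y2 Y1")
    case True
    then show ?thesis using that Y1 by blast
  next
    case False
    then have "Y2 f = Y1 f" using sep_or_eq[OF Y2(1) Y1(1) Y2f Y1(4)] by auto
    then show ?thesis using that[of "\<lambda>e. - Y1 e"] Y1 neg_closed[OF Y1(1)] by (auto simp: sep_iff)
  qed
  obtain Z where Z: "Z \<in> L" "Z f = 0" "\<And>x. x \<notin> sep Y2 Y3 \<Longrightarrow> Z x = (if Y2 x \<noteq> 0 then Y2 x else Y3 x)"
    using elimination[OF Y2(1) Y3(1,4)] by metis
  have "\<forall>a\<in>A. Z a = 0" using Z(3) Y2 Y3 by (auto simp: sep_iff)
  then have "Z e = 0" using star Z by auto
  then show False using Z(3)[of e] Y2 Y3 by (auto simp: sep_iff)
qed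

lemma closure_closure: "A \<subseteq> E \<Longrightarrow> B \<subseteq> cl A \<Longrightarrow> cl B \<subseteq> cl A"
proof
  fix e assume A: "A \<subseteq> E" "B \<subseteq> cl A" "e \<in> cl B"
  have "B \<subseteq> E" using A closure_iff[OF A(1)] by auto
  have "Y e = 0" if Y: "Y \<in> L" "\<forall>a\<in>A. Y a = 0" for Y
  proof -
    have "Y b = 0" if "b \<in> B" for b
    proof -
      have "b \<in> cl A" using A that by auto
      then show ?thesis using Y by (simp add: closure_iff[OF A(1)])
    qed
    then show ?thesis using A(3) Y by (simp add: closure_iff[OF \<open>B \<subseteq> E\<close>])
  qed
  then show "e \<in> cl A" using A(3) by (simp add: closure_iff[OF A(1)] closure_iff[OF \<open>B \<subseteq> E\<close>])
qed

lemma closure_mono: "B \<subseteq> E \<Longrightarrow> A \<subseteq> B \<Longrightarrow> cl A \<subseteq> cl B"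
  unfolding matroid_closure_def by blast

lemma closure_superset: "A \<subseteq> cl A"
  unfolding matroid_closure_def by blast

lemma indep_insert:
  assumes I: "indep I" and b: "b \<in> E" "b \<notin> cl I"
  shows "indep (insert b I)"
  unfolding matroid_indep_def
proof (intro conjI ballI)
  have IE: "I \<subseteq> E" using I by (auto simp: matroid_indep_def)
  show "insert b I \<subseteq> E" using IE b by auto
  have bI: "b \<notin> I" using b closure_superset[of I] by blast
  fix i assume i: "i \<in> insert b I"
  show "i \<notin> cl (insert b I - {i})"
  proof (cases "i = b")
    case True
    then show ?thesis using b bI by (simp add: insert_absorb)
  next
    case False
    then have iI: "i \<in> I" using i by simp
    show ?thesis
    proof
      assume "i \<in> cl (insert b I - {i})"
      then have "i \<in> cl (insert b (I - {i}))" using False by (simp add: insert_Diff_if)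
      moreover have "i \<notin> cl (I - {i})" using I iI by (auto simp: matroid_indep_def)
      ultimately have "b \<in> cl (insert i (I - {i}))"
        using closure_exchange[of "I - {i}" b i] IE b by auto
      then show False using b iI by (simp add: insert_absorb)
    qed
  qed
qed

lemma indep_subset: "indep I \<Longrightarrow> J \<subseteq> I \<Longrightarrow> indep J"
proof -
  assume I: "indep I" and J: "J \<subseteq> I"
  have IE: "I \<subseteq> E" using I by (simp add: matroid_indep_def)
  have "j \<notin> cl (J - {j})" if "j \<in> J" for j
  proof -
    have "cl (J - {j}) \<subseteq> cl (I - {j})" using IE J by (intro closure_mono) auto
    moreover have "j \<notin> cl (I - {j})" using I J that by (auto simp: matroid_indep_def)
    ultimately show ?thesis by auto
  qed
  then show ?thesis using IE J by (auto simp: matroid_indep_def)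
qed

text \<open>An element of \<open>I\<close> outside \<open>B\<close> is exchanged for an element of
  \<open>B\<close> outside the closure of the rest of \<open>I\<close>; this keeps the size of
  \<open>I\<close> and lowers the number of its elements outside \<open>B\<close>.\<close>

lemma steinitz:
  assumes "indep I" "B \<subseteq> E" "I \<subseteq> cl B"
  shows "card I \<le> card B"
  using assms
proof (induction "card (I - B)" arbitrary: I rule: less_induct)
  case less
  have IE: "I \<subseteq> E" using less.prems by (auto simp: matroid_indep_def)
  have fin: "finite I" "finite B"
    using finite_subset[OF IE finite_ground] finite_subset[OF less.prems(2) finite_ground] by auto
  show ?case
  proof (cases "I \<subseteq> B")
    case True
    then show ?thesis using fin by (intro card_mono)
  next
    case False
    then obtain x where x: "x \<in> I" "x \<notin> B" by auto
    have nx: "x \<notin> cl (I - {x})" using x less.prems by (auto simp: matroid_indep_def)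
    obtain b where b: "b \<in> B" "b \<notin> cl (I - {x})"
    proof (cases "B \<subseteq> cl (I - {x})")
      case True
      then have "cl B \<subseteq> cl (I - {x})" using IE by (intro closure_closure) auto
      then show ?thesis using nx less.prems x by auto
    qed (use that in blast)
    have ind: "indep (insert b (I - {x}))"
      using b less.prems indep_subset[of I "I - {x}"] by (intro indep_insert) auto
    have bn: "b \<notin> I - {x}" using b closure_superset[of "I - {x}"] by blast
    have "insert b (I - {x}) - B = I - B - {x}" using b by auto
    then have "card (insert b (I - {x}) - B) < card (I - B)"
      using card_Diff1_less[of "I - B" x] x fin by simp
    moreover have "insert b (I - {x}) \<subseteq> cl B" using less.prems b closure_superset[of B] by auto
    ultimately have "card (insert b (I - {x})) \<le> card B"
      using less.hyps ind less.prems by blast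
    moreover have "card (insert b (I - {x})) = card I"
      using bn x fin card.remove[of I x] by simp
    ultimately show ?thesis by simp
  qed
qed

lemma finite_indep_subsets: "finite (card ` {I. I \<subseteq> A \<and> indep I})"
proof -
  have "{I. I \<subseteq> A \<and> indep I} \<subseteq> Pow E" by (auto simp: matroid_indep_def)
  then show ?thesis using finite_ground by (meson finite_Pow_iff finite_imageI finite_subset)
qed

lemma rank_eqI:
  assumes "indep I" "I \<subseteq> A" "A \<subseteq> cl I"
  shows "rank A = card I"
  unfolding matroid_rank_def
proof (rule Max_eqI)
  have IE: "I \<subseteq> E" using assms by (auto simp: matroid_indep_def)
  show "y \<le> card I" if "y \<in> card ` {I. I \<subseteq> A \<and> indep I}" for y
    using that steinitz[OF _ IE] assms(3) by auto
qed (use assms finite_indep_subsets in auto)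

lemma basis_exists:
  assumes "A \<subseteq> E"
  obtains I where "indep I" "I \<subseteq> A" "A \<subseteq> cl I" "card I = rank A"
proof -
  have "indep {}" by (simp add: matroid_indep_def)
  then have "card ` {I. I \<subseteq> A \<and> indep I} \<noteq> {}" by auto
  then have "rank A \<in> card ` {I. I \<subseteq> A \<and> indep I}"
    unfolding matroid_rank_def using finite_indep_subsets by (intro Max_in)
  then obtain I where I: "indep I" "I \<subseteq> A" "card I = rank A" by auto
  have "A \<subseteq> cl I"
  proof
    fix a assume a: "a \<in> A"
    show "a \<in> cl I"
    proof (rule ccontr)
      assume na: "a \<notin> cl I"
      then have "indep (insert a I)" using I a assms by (intro indep_insert) auto
      then have "card (insert a I) \<in> card ` {I. I \<subseteq> A \<and> indep I}" using I a by auto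
      then have "card (insert a I) \<le> rank A"
        unfolding matroid_rank_def using finite_indep_subsets by (intro Max_ge)
      moreover have "a \<notin> I" using na closure_superset[of I] by blast
      moreover have "finite I" using finite_subset[OF subset_trans[OF I(2) assms] finite_ground] .
      ultimately show False using I by simp
    qed
  qed
  then show ?thesis using that I by blast
qed

lemma rank_empty: "rank {} = 0"
  using rank_eqI[of "{}" "{}"] by (simp add: matroid_indep_def)

text \<open>A basis of the zero set of \<open>T\<close> together with one lost coordinate
  \<open>e\<close> is a basis of the zero set of \<open>W\<close>, because by
  \<open>parallel\<close> all other lost coordinates depend on it.\<close>

lemma rank_covered:
  assumes cov: "covered W T"
  shows "rank (zero_set E W) = Suc (rank (zero_set E T))"
proof -
  have L: "W \<in> L" "T \<in> L" and less: "covector_less W T" using cov by (auto simp: covered_def)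
  obtain e where e: "W e = 0" "T e \<noteq> 0" using less by (rule covector_lessE)
  have eE: "e \<in> E" using in_ground[OF L(2) e(2)] .
  obtain I where I: "indep I" "I \<subseteq> zero_set E T" "zero_set E T \<subseteq> cl I" "card I = rank (zero_set E T)"
    using basis_exists[of "zero_set E T"] by (auto simp: zero_set_def)
  have IE: "I \<subseteq> E" using I by (auto simp: matroid_indep_def)
  have eI: "e \<notin> cl I" using I L e IE by (auto simp: closure_iff zero_set_def)
  have ind: "indep (insert e I)" using I eE eI by (intro indep_insert)
  have "zero_set E W \<subseteq> cl (insert e I)"
  proof
    fix f assume f: "f \<in> zero_set E W"
    have "Y f = 0" if Y: "Y \<in> L" "\<forall>a\<in>insert e I. Y a = 0" for Y
    proof -
      have Y0: "Y x = 0" if "T x = 0" for x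
      proof (cases "x \<in> E")
        case True
        then have "x \<in> cl I" using I(3) that by (auto simp: zero_set_def)
        then show ?thesis using Y by (simp add: closure_iff[OF IE])
      qed (use outside_ground[OF Y(1)] in auto)
      show ?thesis
      proof (cases "T f = 0")
        case False
        then show ?thesis using parallel[OF cov Y(1) Y0 e] Y f by (auto simp: zero_set_def)
      qed (rule Y0)
    qed
    then show "f \<in> cl (insert e I)" using f eE IE by (auto simp: closure_iff zero_set_def)
  qed
  moreover have "insert e I \<subseteq> zero_set E W"
    using I e eE covector_leD0[OF covector_less_imp_le[OF less]] by (auto simp: zero_set_def)
  ultimately have "rank (zero_set E W) = card (insert e I)" using ind by (intro rank_eqI)
  moreover have "e \<notin> I" using eI closure_superset[of I] by blast
  moreover have "finite I" using finite_subset[OF IE finite_ground] .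
  ultimately show ?thesis using I by simp
qed

end

text \<open>For lists of topes followed by a descending chain of other covectors: the last tope of the list
  is never removed, and every covector of the chain but the last one is.\<close>

definition tope_between :: "('e \<Rightarrow> int) set \<Rightarrow> ('e \<Rightarrow> int) \<Rightarrow> ('e \<Rightarrow> int) \<Rightarrow> ('e \<Rightarrow> int) \<Rightarrow> bool" where
  "tope_between P A B C \<longleftrightarrow>
     (if B \<in> P then C \<in> P \<and> (\<forall>e. B e = A e \<or> B e = C e) else C \<notin> P)"

lemma between_four_points:
  fixes a b c d :: "'e \<Rightarrow> int"
  shows "(\<forall>e. b e = a e \<or> b e = c e) \<and> (\<forall>e. c e = a e \<or> c e = d e) \<longleftrightarrow>
    (\<forall>e. c e = b e \<or> c e = d e) \<and> (\<forall>e. b e = a e \<or> b e = d e)"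
proof -
  have "(b e = a e \<or> b e = c e) \<and> (c e = a e \<or> c e = d e) \<longleftrightarrow>
    (c e = b e \<or> c e = d e) \<and> (b e = a e \<or> b e = d e)" for e by auto
  then show ?thesis by (simp only: all_conj_distrib[symmetric])
qed

lemma chain_betweenness_tope_between:
  "chain_betweenness (tope_between P) (- P) covector_less"
proof
  show "tope_between P a b c \<and> tope_between P a c d \<longleftrightarrow> tope_between P b c d \<and> tope_between P a b d"
    for a b c d
    using between_four_points[of b a c d] unfolding tope_between_def by (auto split: if_splits)
  show "tope_between P a b c" if "b \<in> - P" "c \<in> - P" for a b c
    using that by (simp add: tope_between_def)
qed (use covector_less_trans in auto)

section \<open>Visible parts of intervals of covectors, and homology spheres\<close>

context finite_oriented_matroid
begin

sublocale chain_betweenness "tope_between (topes L)" "- topes L" covector_less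
  by (rule chain_betweenness_tope_between)

definition iv :: "('e \<Rightarrow> int) \<Rightarrow> ('e \<Rightarrow> int) \<Rightarrow> ('e \<Rightarrow> int) set" where
  "iv X Y = {Z \<in> L. covector_less X Z \<and> covector_less Z Y}"

text \<open>The proper faces of \<open>Y\<close> above \<open>X\<close> that lie on a hyperplane
  separating \<open>Y\<close> from \<open>T\<close>; geometrically, the part of the boundary of
  \<open>Y\<close> that is visible from \<open>T\<close>.\<close>

definition cut :: "('e \<Rightarrow> int) \<Rightarrow> ('e \<Rightarrow> int) \<Rightarrow> ('e \<Rightarrow> int) \<Rightarrow> ('e \<Rightarrow> int) set" where
  "cut X Y T = {Z \<in> iv X Y. \<exists>e\<in>sep Y T. Z e = 0}"

lemma below_not_tope: "Z \<in> L \<Longrightarrow> Y \<in> L \<Longrightarrow> covector_less Z Y \<Longrightarrow> Z \<notin> topes L"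
  unfolding topes_def covector_less_def by auto

lemma cut_subset: "cut X Y T \<subseteq> iv X Y"
  by (auto simp: cut_def)

lemma iv_mono: "covector_le Y Y' \<Longrightarrow> iv X Y \<subseteq> iv X Y'"
  unfolding iv_def using covector_less_le_trans by blast

text \<open>One step of a gallery from \<open>T\<close> towards \<open>Y\<close>: passing through
  the facet \<open>W\<close> flips precisely the coordinates in \<open>G\<close>, all of which
  separated \<open>T\<close> from \<open>Y\<close>. A common face \<open>X\<close> of
  \<open>T\<close> and \<open>Y\<close> is zero on these, so it stays a face throughout.\<close>

lemma reflection:
  assumes L: "T \<in> L" "Y \<in> L" and zero: "\<And>e. T e = 0 \<longleftrightarrow> Y e = 0"
    and cov: "covered W T" and off: "\<forall>f. Y f = T f \<longrightarrow> W f = T f"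
  defines "G \<equiv> {e. W e = 0 \<and> T e \<noteq> 0}" and "T' \<equiv> opp W T"
  shows "T' \<in> L" "G \<subseteq> sep Y T" "G \<noteq> {}" "sep Y T' = sep Y T - G" "\<And>e. T' e = 0 \<longleftrightarrow> Y e = 0"
    "card (sep Y T') < card (sep Y T)"
    "\<And>X. covector_le X T \<Longrightarrow> covector_le X Y \<Longrightarrow> covector_le X W \<and> covector_le X T'"
proof -
  have W: "W \<in> L" "covector_less W T" using cov by (auto simp: covered_def)
  note le = covector_less_imp_le[OF W(2)]
  show "T' \<in> L" unfolding T'_def using W L by (intro opp_closed)
  show G: "G \<subseteq> sep Y T"
  proof
    fix e assume e: "e \<in> G"
    then have "Y e \<noteq> T e" using off[rule_format, of e] by (auto simp: G_def)
    then show "e \<in> sep Y T" using sep_or_eq[OF L(2,1), of e] e zero[of e] by (auto simp: G_def)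
  qed
  obtain x where "W x = 0" "T x \<noteq> 0" using W(2) by (rule covector_lessE)
  then show G0: "G \<noteq> {}" by (auto simp: G_def)
  have W_T: "W e = T e" if "W e \<noteq> 0" for e
    using that by (rule covector_leD[OF le])
  have T'_eq: "T' e = (if W e = 0 then - T e else T e)" for e
    using W_T[of e] by (simp add: T'_def opp_apply)
  show T'0: "T' e = 0 \<longleftrightarrow> Y e = 0" for e
    using zero[of e] by (simp add: T'_eq)
  show S: "sep Y T' = sep Y T - G"
    unfolding set_eq_iff
  proof
    fix e
    show "e \<in> sep Y T' \<longleftrightarrow> e \<in> sep Y T - G"
    proof (cases "W e = 0")
      case True
      show ?thesis
      proof (cases "T e = 0")
        case True
        then have "Y e = 0" using zero by simp
        then show ?thesis by (simp add: sep_iff)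
      next
        case False
        then have eG: "e \<in> G" using \<open>W e = 0\<close> by (simp add: G_def)
        then have "Y e = - T e" "Y e \<noteq> 0" using subsetD[OF G eG] by (simp_all add: sep_iff)
        moreover from this have "T' e = Y e" using \<open>W e = 0\<close> by (simp add: T'_eq)
        ultimately show ?thesis using eG by (simp add: sep_iff)
      qed
    next
      case False
      then show ?thesis by (simp add: T'_eq sep_iff G_def)
    qed
  qed
  show "card (sep Y T') < card (sep Y T)"
    unfolding S by (rule psubset_card_mono[OF finite_sep[OF L(2)]]) (use G G0 in blast)
  show "covector_le X W \<and> covector_le X T'" if X: "covector_le X T" "covector_le X Y" for X
  proof
    have *: "X e = W e" if "X e \<noteq> 0" for e
      using covector_leD[OF X(1) that] covector_leD[OF X(2) that] off[rule_format, of e] by simp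
    then show "covector_le X W" by (intro covector_leI)
    show "covector_le X T'"
      using * by (intro covector_leI) (simp add: T'_def opp_apply)
  qed
qed

text \<open>By \<open>parallel\<close>, a face \<open>Z\<close> of \<open>Y\<close> that vanishes at
  one coordinate of the wall \<open>G\<close> vanishes on all of it. Where \<open>Z\<close> is zero
  outside \<open>G\<close>, nothing separates \<open>Y\<close> from \<open>T\<close>, so there
  \<open>W\<close> agrees with \<open>Y\<close>; hence \<open>sv_comp Z W\<close> is
  \<open>Y\<close> with the wall set to zero, a covector above \<open>Z\<close>.\<close>

lemma facet_zero_on:
  assumes L: "T \<in> L" "Y \<in> L" and zero: "\<And>e. T e = 0 \<longleftrightarrow> Y e = 0"
    and cov: "covered W T" and off: "\<forall>f. Y f = T f \<longrightarrow> W f = T f"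
    and Z: "Z \<in> L" "covector_le Z Y" "x \<in> {e. W e = 0 \<and> T e \<noteq> 0}" "Z x = 0"
      "\<And>e. e \<in> sep Y T - {e. W e = 0 \<and> T e \<noteq> 0} \<Longrightarrow> Z e \<noteq> 0"
  shows "zero_on Y {e. W e = 0 \<and> T e \<noteq> 0} \<in> L" "covector_le Z (zero_on Y {e. W e = 0 \<and> T e \<noteq> 0})"
proof -
  define G where "G = {e. W e = 0 \<and> T e \<noteq> 0}"
  have W: "W \<in> L" "covector_less W T" using cov by (auto simp: covered_def)
  note le = covector_less_imp_le[OF W(2)]
  have ZT: "Z e = 0" if "T e = 0" for e
    using covector_leD0[OF Z(2), of e] zero[of e] that by simp
  have x: "W x = 0" "T x \<noteq> 0" using Z(3) by auto
  have ZG: "Z e = 0" if "e \<in> G" for e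
    using that by (intro parallel[OF cov Z(1) ZT x Z(4)]) (auto simp: G_def)
  have "covector_le Z (zero_on Y G)"
  proof (rule covector_leI)
    fix e assume "Z e \<noteq> 0"
    then show "Z e = zero_on Y G e"
      using ZG[of e] covector_leD[OF Z(2), of e] by (auto simp: zero_on_def)
  qed
  then show "covector_le Z (zero_on Y {e. W e = 0 \<and> T e \<noteq> 0})" by (simp add: G_def)
  have "sv_comp Z W e = zero_on Y G e" for e
  proof (cases "e \<in> G")
    case True
    then show ?thesis using ZG[OF True] by (simp add: sv_comp_def zero_on_def G_def)
  next
    case False
    show ?thesis
    proof (cases "Z e = 0")
      case f: False
      then show ?thesis using False covector_leD[OF Z(2) f] by (simp add: sv_comp_def zero_on_def)
    next
      case True
      have "W e = Y e"
      proof (cases "T e = 0")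
        case True
        then show ?thesis using zero[of e] covector_leD0[OF le True] by simp
      next
        case T: False
        then have "W e = T e" using False covector_leD[OF le, of e] by (simp add: G_def)
        have "e \<notin> sep Y T" using True False Z(5)[of e] by (auto simp: G_def)
        moreover have "Y e \<noteq> 0" using T zero[of e] by simp
        ultimately have "Y e = T e" using sep_or_eq[OF L(2,1) _ T] by blast
        then show ?thesis using \<open>W e = T e\<close> by simp
      qed
      then show ?thesis using True False by (simp add: sv_comp_def zero_on_def)
    qed
  qed
  then have "sv_comp Z W = zero_on Y G" by auto
  then show "zero_on Y {e. W e = 0 \<and> T e \<noteq> 0} \<in> L"
    using comp_closed[OF Z(1) W(1)] by (simp add: G_def)
qed

text \<open>Induction along a gallery from \<open>T\<close> to \<open>Y\<close>. The step to
  \<open>T'\<close> hides only faces in the single wall \<open>G\<close>. If there are any, the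
  visible part is the union of the part visible from \<open>T'\<close> and the closed face
  \<open>YG\<close>, which is a cone; the two meet in the part of the boundary of \<open>YG\<close>
  visible from \<open>W\<close>. The excluded positions are \<open>Y\<close>, from which nothing is
  visible, and the antipode, from which everything is.\<close>

lemma acyclic_cut:
  assumes "X \<in> L" "Y \<in> L" "T \<in> L" "covector_less X Y" "covector_le X T"
    and "\<And>e. T e = 0 \<longleftrightarrow> Y e = 0" and "T \<noteq> Y" "T \<noteq> opp X Y"
    and "ch_ok X (iv X Y) \<rho>"
  shows "acyclic (ch X (cut X Y T) \<rho>)"
  using assms(2-)
proof (induction "card (sep Y T)" arbitrary: Y T rule: less_induct)
  case less
  note L = less.prems(2,1) and XY = less.prems(3) and XT = less.prems(4) and zero = less.prems(5)
    and neq = less.prems(6,7) and ok = less.prems(8)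
  note leXY = covector_less_imp_le[OF XY]
  obtain W where cov: "covered W T" and off: "\<forall>f. Y f = T f \<longrightarrow> W f = T f"
    using neighbour[OF L zero neq(1)] by metis
  define G where "G = {e. W e = 0 \<and> T e \<noteq> 0}"
  define T' where "T' = opp W T"
  note R = reflection[OF L zero cov off, folded G_def T'_def]
  have W: "W \<in> L" "covector_less W T" using cov by (auto simp: covered_def)
  note le = covector_less_imp_le[OF W(2)]
  have XW: "covector_le X W" and XT': "covector_le X T'" using R(7)[OF XT leXY] by auto
  define S where "S = sep Y T - G"
  have sepT': "sep Y T' = S" using R(4) by (simp add: S_def)
  \<comment> \<open>The faces that cease to be visible on the way from \<open>T\<close> to
    \<open>T'\<close>: of the separating coordinates they vanish only at some in the wall
    \<open>G\<close>.\<close>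
  define D where "D = {Z \<in> iv X Y. (\<exists>e\<in>G. Z e = 0) \<and> (\<forall>e\<in>S. Z e \<noteq> 0)}"
  have cutT: "cut X Y T = cut X Y T' \<union> D"
    using R(2) unfolding cut_def D_def sepT' S_def by blast
  have opp_far: "T' \<noteq> opp X Y"
  proof
    assume T'opp: "T' = opp X Y"
    obtain x where x: "x \<in> G" using R(3) by auto
    then have xs: "x \<in> sep Y T" using R(2) by auto
    have "X x = 0"
      using xs covector_leD[OF XT, of x] covector_leD[OF leXY, of x] by (auto simp: sep_iff)
    then have "x \<in> sep Y T'" using T'opp xs by (auto simp: sep_iff opp_apply)
    then show False using x R(4) by simp
  qed
  show ?case
  proof (cases "D = {}")
    case True
    \<comment> \<open>If \<open>T'\<close> were \<open>Y\<close>, then \<open>W\<close> would be a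
      face of \<open>Y\<close> in the wall \<open>G\<close>, hence in \<open>D\<close>, unless
      \<open>W = X\<close>; but that makes \<open>T\<close> the excluded antipode.\<close>
    have "T' \<noteq> Y"
    proof
      assume T'Y: "T' = Y"
      then have S0: "S = {}" using sepT' by (auto simp: sep_iff)
      have "W \<noteq> X"
      proof
        assume WX: "W = X"
        have "T e = opp X Y e" for e
        proof (cases "X e = 0")
          case True
          have "Y e = opp W T e" using T'Y by (simp add: T'_def)
          then show ?thesis using True WX by (simp add: opp_apply)
        next
          case False
          then show ?thesis using covector_leD[OF XT False] by (simp add: opp_apply)
        qed
        then show False using neq by auto
      qed
      then have "covector_less X W" using XW by (auto simp: covector_less_def)
      moreover have "covector_less W Y"
      proof -
        obtain x where x: "x \<in> G" using R(3) by auto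
        have "covector_le W Y" using T'Y by (intro covector_leI) (auto simp: T'_def opp_apply)
        then show ?thesis using x zero[of x] by (intro covector_lessI[of W Y x]) (auto simp: G_def)
      qed
      ultimately have "W \<in> D" using W R(3) S0 by (auto simp: D_def iv_def G_def)
      then show False using True by simp
    qed
    then have "acyclic (ch X (cut X Y T') \<rho>)"
      using less.hyps[OF R(6) less.prems(1) R(1) XY XT' R(5) _ opp_far ok] by blast
    then show ?thesis using cutT True by simp
  next
    case False
    then obtain Z0 x0 where Z0: "Z0 \<in> iv X Y" "x0 \<in> G" "Z0 x0 = 0" "\<And>e. e \<in> S \<Longrightarrow> Z0 e \<noteq> 0"
      by (auto simp: D_def)
    define YG where "YG = zero_on Y G"
    have facet: "zero_on Y G \<in> L" "covector_le Z (zero_on Y G)" if "Z \<in> D" for Z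
    proof -
      obtain x where "Z \<in> L" "covector_le Z Y" "x \<in> G" "Z x = 0" "\<And>e. e \<in> S \<Longrightarrow> Z e \<noteq> 0"
        using \<open>Z \<in> D\<close> by (auto simp: D_def iv_def covector_less_def)
      then show "zero_on Y G \<in> L" "covector_le Z (zero_on Y G)"
        using facet_zero_on[OF L zero cov off, of Z x] by (auto simp: G_def S_def)
    qed
    have Z0D: "Z0 \<in> D" using Z0 by (auto simp: D_def)
    have YGL: "YG \<in> L" using facet[OF Z0D] by (simp add: YG_def)
    have Z0YG: "covector_le Z0 YG" using facet[OF Z0D] by (simp add: YG_def)
    have XYG: "covector_less X YG"
      using Z0 Z0YG covector_less_le_trans by (auto simp: iv_def)
    have YGY: "covector_less YG Y"
      using Z0(2) zero[of x0] by (intro covector_lessI[of YG Y x0] covector_leI) (auto simp: YG_def zero_on_def G_def)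
    have YGiv: "YG \<in> iv X Y" using YGL XYG YGY by (simp add: iv_def)
    have YGS: "YG e \<noteq> 0" if "e \<in> S" for e
      using that by (auto simp: YG_def zero_on_def S_def sep_iff)
    have YG0: "YG e = 0" if "e \<in> G" for e using that by (simp add: YG_def zero_on_def)
    have ivYG: "insert YG (iv X YG) \<subseteq> iv X Y"
      using YGiv iv_mono[OF covector_less_imp_le[OF YGY]] by auto
    have okYG: "ch_ok X (insert YG (iv X YG)) \<rho>" using ok ivYG by (rule ch_ok_subset)
    have cutT2: "cut X Y T = cut X Y T' \<union> insert YG (iv X YG)"
    proof (intro equalityI subsetI)
      fix Z assume "Z \<in> cut X Y T"
      then have "Z \<in> cut X Y T' \<or> Z \<in> D" using cutT by auto
      moreover have "Z \<in> insert YG (iv X YG)" if "Z \<in> D"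
        using that facet(2)[OF that] by (auto simp: D_def iv_def YG_def covector_less_def)
      ultimately show "Z \<in> cut X Y T' \<union> insert YG (iv X YG)" by auto
    next
      fix Z assume Z: "Z \<in> cut X Y T' \<union> insert YG (iv X YG)"
      show "Z \<in> cut X Y T"
      proof (cases "Z \<in> cut X Y T'")
        case True
        then show ?thesis using cutT by auto
      next
        case False
        then have Z': "Z \<in> insert YG (iv X YG)" using Z by auto
        then have "covector_le Z YG" by (auto simp: iv_def covector_less_def)
        then have "Z x0 = 0" using covector_leD0[of Z YG x0] YG0[OF Z0(2)] by auto
        then show ?thesis using Z' ivYG Z0(2) R(2) by (auto simp: cut_def)
      qed
    qed
    have cone: "acyclic (ch X (insert YG (iv X YG)) \<rho>)"
      by (rule acyclic_cone[OF okYG, of YG]) (auto simp: iv_def)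
    show ?thesis
    proof (cases "T' = Y")
      case True
      then have "cut X Y T' = {}" by (auto simp: cut_def sep_iff)
      then show ?thesis using cutT2 cone by simp
    next
      case T'Y: False
      have ac1: "acyclic (ch X (cut X Y T') \<rho>)"
        using less.hyps[OF R(6) less.prems(1) R(1) XY XT' R(5) T'Y opp_far ok] .
      have W0: "W e = 0 \<longleftrightarrow> YG e = 0" for e
      proof (cases "W e = 0")
        case True
        have "T e = 0 \<or> e \<in> G" using True by (simp add: G_def)
        then show ?thesis using True zero[of e] by (auto simp: YG_def zero_on_def)
      next
        case False
        then have "T e \<noteq> 0" using covector_leD0[OF le, of e] by blast
        then have "Y e \<noteq> 0" using zero[of e] by simp
        then show ?thesis using False by (simp add: YG_def zero_on_def G_def)
      qed
      have sepW: "sep YG W = S"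
        unfolding set_eq_iff
      proof
        fix e
        show "e \<in> sep YG W \<longleftrightarrow> e \<in> S"
        proof (cases "W e = 0")
          case True
          then have "T e = 0 \<or> e \<in> G" by (simp add: G_def)
          then show ?thesis
            using True zero[of e] by (auto simp: YG_def zero_on_def S_def sep_iff)
        next
          case False
          then have "W e = T e" "e \<notin> G" using covector_leD[OF le, of e] by (simp_all add: G_def)
          then show ?thesis by (simp add: YG_def zero_on_def S_def sep_iff)
        qed
      qed
      have S0: "S \<noteq> {}"
      proof
        assume "S = {}"
        then have "T' e = Y e" for e
          using sep_or_eq[OF L(2) R(1), of e] R(5)[of e] sepT' by auto
        then show False using T'Y by auto
      qed
      have WYG: "W \<noteq> YG" using S0 sepW by (auto simp: sep_iff)
      have Wopp: "W \<noteq> opp X YG"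
      proof
        assume Wopp: "W = opp X YG"
        have "T e = opp X Y e" for e
        proof (cases "X e = 0")
          case False
          then show ?thesis using covector_leD[OF XT False] by (simp add: opp_apply)
        next
          case X0: True
          show ?thesis
          proof (cases "e \<in> G")
            case True
            then show ?thesis using subsetD[OF R(2) True] X0 by (simp add: sep_iff opp_apply)
          next
            case False
            have "W e = T e"
            proof (cases "W e = 0")
              case True
              then show ?thesis using False by (simp add: G_def)
            qed (rule covector_leD[OF le])
            moreover have "W e = - Y e" using Wopp X0 False by (simp add: opp_apply YG_def zero_on_def)
            ultimately show ?thesis using X0 by (simp add: opp_apply)
          qed
        qed
        then show False using neq by auto
      qed
      have ac2: "acyclic (ch X (cut X YG W) \<rho>)"
      proof (rule less.hyps[OF _ YGL W(1) XYG XW W0 WYG Wopp])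
        show "card (sep YG W) < card (sep Y T)" using R(6) sepW sepT' by simp
        show "ch_ok X (iv X YG) \<rho>" using okYG by (rule ch_ok_subset) auto
      qed
      \<comment> \<open>Both sides consist of the faces of \<open>YG\<close> with a zero in
        \<open>S\<close>; \<open>YG\<close> itself drops out because it has no zero there.\<close>
      have inter: "cut X Y T' \<inter> insert YG (iv X YG) = cut X YG W"
        using YGS ivYG unfolding cut_def sepT' sepW by auto
      show ?thesis
        unfolding cutT2
      proof (rule acyclic_ch_Un)
        show "ch_ok X (cut X Y T' \<union> insert YG (iv X YG)) \<rho>"
          using ok by (rule ch_ok_subset) (use ivYG cut_subset[of X Y T'] in blast)
        show "Z \<in> cut X Y T'" if VZ: "V \<in> cut X Y T'" "Z \<in> insert YG (iv X YG)" "covector_less Z V" for V Z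
        proof -
          obtain x where x: "x \<in> sep Y T'" "V x = 0" using VZ(1) by (auto simp: cut_def)
          have "Z x = 0" using covector_leD0[OF covector_less_imp_le[OF VZ(3)] x(2)] .
          then show ?thesis using VZ(2) ivYG x(1) by (auto simp: cut_def)
        qed
        show "Z \<in> insert YG (iv X YG)" if "V \<in> insert YG (iv X YG)" "Z \<in> cut X Y T'" "covector_less Z V" for V Z
        proof -
          have "covector_le V YG" using that(1) by (auto simp: iv_def covector_less_def)
          then have "covector_less Z YG" by (rule covector_less_le_trans[OF that(3)])
          then show ?thesis using that(2) by (auto simp: cut_def iv_def)
        qed
        show "acyclic (ch X (cut X Y T' \<inter> insert YG (iv X YG)) \<rho>)" using ac2 inter by simp
      qed (use ac1 cone in auto)
    qed
  qed
qed

text \<open>The open interval from \<open>X\<close> to \<open>Y\<close> is a homology sphere. Up to acyclic pieces its chains reduce to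
  the single maximal chain \<open>p\<close> of a suitable flag of facets, uniformly in the prefix.\<close>

lemma sphere:
  assumes "X \<in> L" "Y \<in> L" "covector_less X Y"
    and "\<And>\<rho>. \<rho> \<in> R \<Longrightarrow> ch_ok X (iv X Y) \<rho>" and "convex (chs X (\<lambda>_. iv X Y) R)"
  obtains p where "desc p" "set p \<subseteq> iv X Y"
    "length p + Suc (rank (zero_set E Y)) = rank (zero_set E X)"
    "\<And>k z. hgen ((\<lambda>\<rho>. \<rho> @ p @ [X]) ` R) k z \<Longrightarrow>
      \<exists>z'. hgen (chs X (\<lambda>_. iv X Y) R) k z' \<and> (z' = 0 \<longleftrightarrow> z = 0)"
proof -
  have "\<exists>p. desc p \<and> set p \<subseteq> iv X Y \<and> length p + Suc (rank (zero_set E Y)) = rank (zero_set E X) \<and>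
    (\<forall>k z. hgen ((\<lambda>\<rho>. \<rho> @ p @ [X]) ` R) k z \<longrightarrow>
      (\<exists>z'. hgen (chs X (\<lambda>_. iv X Y) R) k z' \<and> (z' = 0 \<longleftrightarrow> z = 0)))"
    using assms(2-)
  proof (induction "card {e \<in> E. X e = 0 \<and> Y e \<noteq> 0}" arbitrary: Y R rule: less_induct)
    case less
    note YL = less.prems(1) and XY = less.prems(2) and ok = less.prems(3) and conv = less.prems(4)
    note leXY = covector_less_imp_le[OF XY]
    show ?case
    proof (cases "iv X Y = {}")
      case True
      then have "covered X Y" using assms(1) YL XY by (auto simp: covered_def iv_def)
      then have "rank (zero_set E X) = Suc (rank (zero_set E Y))" by (rule rank_covered)
      moreover have "chs X (\<lambda>_. iv X Y) R = (\<lambda>\<rho>. \<rho> @ [] @ [X]) ` R"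
        using True by (auto simp: chs_def ch_def)
      ultimately show ?thesis by (intro exI[of _ "[]"]) auto
    next
      case False
      \<comment> \<open>From the antipode every proper face of \<open>Y\<close> above
        \<open>X\<close> is visible. After one step towards \<open>Y\<close> exactly one of them,
        \<open>M\<close>, is hidden, and the others form an acyclic family.\<close>
      define T where "T = opp X Y"
      have TL: "T \<in> L" unfolding T_def using assms(1) YL by (rule opp_closed)
      have zero: "T e = 0 \<longleftrightarrow> Y e = 0" for e
        using covector_leD[OF leXY, of e] by (auto simp: T_def opp_apply)
      obtain x where x: "X x = 0" "Y x \<noteq> 0" using XY by (rule covector_lessE)
      then have TY: "T \<noteq> Y" by (auto simp: T_def opp_apply fun_eq_iff)
      have XT: "covector_le X T" by (intro covector_leI) (simp add: T_def opp_apply)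
      obtain W where cov: "covered W T" and off: "\<forall>f. Y f = T f \<longrightarrow> W f = T f"
        using neighbour[OF TL YL zero TY] by metis
      define G where "G = {e. W e = 0 \<and> T e \<noteq> 0}"
      define T' where "T' = opp W T"
      note R = reflection[OF TL YL zero cov off, folded G_def T'_def]
      have W: "W \<in> L" "covector_less W T" using cov by (auto simp: covered_def)
      note le = covector_less_imp_le[OF W(2)]
      have XW: "covector_le X W" and XT': "covector_le X T'" using R(7)[OF XT leXY] by auto
      have sepT: "sep Y T = {e. X e = 0 \<and> Y e \<noteq> 0}"
        unfolding set_eq_iff
      proof
        fix e
        show "e \<in> sep Y T \<longleftrightarrow> e \<in> {e. X e = 0 \<and> Y e \<noteq> 0}"
          using covector_leD[OF leXY, of e] by (auto simp: T_def opp_apply sep_iff)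
      qed
      \<comment> \<open>The antipode of the facet \<open>W\<close> seen from \<open>X\<close>; it
        turns out to be the face of \<open>Y\<close> in the wall \<open>G\<close>.\<close>
      define M where "M = opp X W"
      have MinL: "M \<in> L" unfolding M_def using assms(1) W(1) by (rule opp_closed)
      have MG: "M = zero_on Y G"
      proof
        fix e show "M e = zero_on Y G e"
        proof (cases "X e = 0")
          case False
          moreover have "e \<notin> G" using False covector_leD[OF XW False] by (auto simp: G_def)
          ultimately show ?thesis using covector_leD[OF leXY False] by (simp add: M_def opp_apply zero_on_def)
        next
          case True
          show ?thesis
          proof (cases "W e = 0")
            case W0: True
            have "T e = 0 \<or> e \<in> G" using W0 by (simp add: G_def)
            then show ?thesis using True W0 zero[of e] by (auto simp: M_def opp_apply zero_on_def)
          next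
            case False
            then have "W e = - Y e" using True covector_leD[OF le False] by (simp add: T_def opp_apply)
            then show ?thesis using True False by (simp add: M_def opp_apply zero_on_def G_def)
          qed
        qed
      qed
      \<comment> \<open>Every coordinate where \<open>X\<close> is zero and \<open>Y\<close> is not
        belongs to the separation. A hidden face therefore vanishes, apart from the zeros of
        \<open>Y\<close>, exactly on \<open>G\<close>.\<close>
      have unique: "Z = M" if Z: "Z \<in> iv X Y" "x \<in> G" "Z x = 0" "\<And>e. e \<in> sep Y T - G \<Longrightarrow> Z e \<noteq> 0" for Z x
      proof
        fix e
        have Z': "Z \<in> L" "covector_le X Z" "covector_le Z Y" using Z(1) by (auto simp: iv_def covector_less_def)
        show "Z e = M e"
        proof (cases "Z e = 0")
          case True
          have "Y e = 0 \<or> e \<in> G"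
            using True Z(4)[of e] covector_leD[OF Z'(2), of e] unfolding sepT by auto
          then show ?thesis using True by (auto simp: MG zero_on_def)
        next
          case False
          have "covector_le Z M"
            using facet_zero_on(2)[OF TL YL zero cov off Z'(1,3), of x] Z by (auto simp: MG G_def)
          then show ?thesis using False by (rule covector_leD)
        qed
      qed
      \<comment> \<open>If \<open>W\<close> were \<open>X\<close>, the wall \<open>G\<close> would
        be the whole separation; every element of the interval would be hidden and thus equal to
        \<open>M = X\<close>, although the interval is not empty.\<close>
      have WX: "W \<noteq> X"
      proof
        assume WX: "W = X"
        have G': "G = sep Y T" unfolding sepT G_def WX using zero by auto
        obtain Z where Z: "Z \<in> iv X Y" using False by auto
        then have Z': "Z \<in> L" "covector_le X Z" "covector_less Z Y" "covector_less X Z"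
          by (auto simp: iv_def covector_less_def)
        obtain y where y: "Z y = 0" "Y y \<noteq> 0" using Z'(3) by (rule covector_lessE)
        then have "y \<in> G" unfolding G' sepT using covector_leD[OF Z'(2), of y] by auto
        then have "Z = M" using Z y G' by (intro unique[of Z y]) auto
        then have "Z = X" using WX by (auto simp: M_def opp_apply fun_eq_iff)
        then show False using Z'(4) by simp
      qed
      have XM: "covector_less X M"
      proof -
        have "covector_less X W" using XW WX by (auto simp: covector_less_def)
        then obtain y where "X y = 0" "W y \<noteq> 0" by (rule covector_lessE)
        then show ?thesis
          by (intro covector_lessI[of X M y] covector_leI) (auto simp: M_def opp_apply)
      qed
      obtain g where g: "g \<in> G" using R(3) by auto
      have MY: "covector_less M Y"
        using g zero[of g] by (intro covector_lessI[of M Y g] covector_leI) (auto simp: MG zero_on_def G_def)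
      have Miv: "M \<in> iv X Y" using MinL XM MY by (simp add: iv_def)
      define \<Lambda>1 where "\<Lambda>1 = cut X Y T'"
      have Mnz: "M e \<noteq> 0" if "e \<in> sep Y T'" for e
        using that unfolding R(4) MG by (auto simp: zero_on_def sep_iff)
      have ivY: "iv X Y = insert M \<Lambda>1"
      proof (intro equalityI subsetI)
        fix Z assume Z: "Z \<in> iv X Y"
        show "Z \<in> insert M \<Lambda>1"
        proof (cases "Z \<in> \<Lambda>1")
          case False
          then have nz: "\<And>e. e \<in> sep Y T - G \<Longrightarrow> Z e \<noteq> 0" using Z unfolding \<Lambda>1_def cut_def R(4) by auto
          have Z': "covector_le X Z" "covector_less Z Y" using Z by (auto simp: iv_def covector_less_def)
          obtain y where y: "Z y = 0" "Y y \<noteq> 0" using Z'(2) by (rule covector_lessE)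
          then have "y \<in> sep Y T" unfolding sepT using covector_leD[OF Z'(1), of y] by auto
          then have "y \<in> G" using nz[of y] y by auto
          then have "Z = M" using unique[OF Z _ y(1) nz] by blast
          then show ?thesis by simp
        qed simp
      qed (use Miv in \<open>auto simp: \<Lambda>1_def cut_def\<close>)
      have M1: "M \<notin> \<Lambda>1" using Mnz by (auto simp: \<Lambda>1_def cut_def)
      have M2: "\<not> covector_less M Z" if "Z \<in> \<Lambda>1" for Z
        using that Mnz covector_leD[of M Z] by (fastforce simp: \<Lambda>1_def cut_def covector_less_def)
      have below: "{Z \<in> \<Lambda>1. covector_less Z M} = iv X M"
      proof (intro equalityI subsetI)
        fix Z assume Z: "Z \<in> iv X M"
        then have "Z \<in> iv X Y" using iv_mono[OF covector_less_imp_le[OF MY]] by auto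
        moreover have "Z \<noteq> M" "covector_less Z M" using Z by (auto simp: iv_def)
        ultimately show "Z \<in> {Z \<in> \<Lambda>1. covector_less Z M}" using ivY by auto
      qed (auto simp: \<Lambda>1_def cut_def iv_def)
      have T'Y: "T' \<noteq> Y"
      proof
        assume T'Y: "T' = Y"
        have "W e = X e" for e
        proof (cases "X e = 0")
          case False
          then show ?thesis using covector_leD[OF XW False] by simp
        next
          case True
          show ?thesis
          proof (rule ccontr)
            assume "W e \<noteq> X e"
            then have "W e \<noteq> 0" using True by simp
            have "T' e = Y e" using T'Y by simp
            then have "W e = Y e" using \<open>W e \<noteq> 0\<close> by (simp add: T'_def opp_apply)
            moreover have "W e = - Y e"
              using covector_leD[OF le \<open>W e \<noteq> 0\<close>] True by (simp add: T_def opp_apply)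
            ultimately show False using \<open>W e \<noteq> 0\<close> by simp
          qed
        qed
        then show False using WX by auto
      qed
      have T'T: "T' \<noteq> opp X Y" using g by (auto simp: T'_def T_def[symmetric] G_def opp_apply fun_eq_iff)
      have ac: "acyclic (ch X \<Lambda>1 \<rho>)" if "\<rho> \<in> R" for \<rho>
        unfolding \<Lambda>1_def
        by (rule acyclic_cut[OF assms(1) YL R(1) XY XT' R(5) T'Y T'T ok[OF that]])
      let ?S = "chs X (\<lambda>_. iv X Y) R" and ?S1 = "chs X (\<lambda>_. \<Lambda>1) R"
      have \<Lambda>1iv: "\<Lambda>1 \<subseteq> iv X Y" using ivY by auto
      have sub: "subcomplex ?S1 ?S" using ok \<Lambda>1iv by (rule subcomplex_chs)
      have acS1: "acyclic ?S1"
        by (rule acyclic_chs[OF ok \<Lambda>1iv convex_subcomplex[OF conv sub] ac])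
      let ?R' = "(\<lambda>\<rho>. \<rho> @ [M]) ` R"
      \<comment> \<open>Modulo the acyclic chains that avoid \<open>M\<close> only the chains
        through \<open>M\<close> remain. They form the same problem for the smaller interval below
        \<open>M\<close>, with \<open>M\<close> moved into the prefix; this produces the entries of
        \<open>p\<close> one at a time.\<close>
      have quot: "?S - ?S1 = chs X (\<lambda>_. iv X M) ?R'"
        using chs_quotient[of R X M \<Lambda>1] ok M1 M2 unfolding below ivY[symmetric] by blast
      have convM: "convex (chs X (\<lambda>_. iv X M) ?R')"
        using convex_quotient[OF conv sub] quot by simp
      have okM: "ch_ok X (iv X M) \<rho>'" if \<rho>': "\<rho>' \<in> ?R'" for \<rho>'
      proof -
        obtain \<rho> where \<rho>: "\<rho> \<in> R" "\<rho>' = \<rho> @ [M]" using \<rho>' by auto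
        have "M \<notin> iv X M" "M \<noteq> X" using XM by (auto simp: iv_def covector_less_def)
        moreover have "last \<rho> \<noteq> M"
          using ok[OF \<rho>(1)] Miv last_in_set[of \<rho>] unfolding ch_ok_def by blast
        ultimately show ?thesis
          using ok[OF \<rho>(1)] iv_mono[OF covector_less_imp_le[OF MY], of X] \<rho>(2)
          by (auto simp: ch_ok_def distinct_adj_append_iff)
      qed
      have "card {e \<in> E. X e = 0 \<and> M e \<noteq> 0} < card {e \<in> E. X e = 0 \<and> Y e \<noteq> 0}"
      proof (rule psubset_card_mono)
        show "finite {e \<in> E. X e = 0 \<and> Y e \<noteq> 0}" using finite_ground by simp
        have "g \<in> sep Y T" using g R(2) by auto
        then have "g \<in> {e \<in> E. X e = 0 \<and> Y e \<noteq> 0}" using in_ground[OF YL] unfolding sepT by auto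
        moreover have "M g = 0" using g by (simp add: MG zero_on_def)
        ultimately show "{e \<in> E. X e = 0 \<and> M e \<noteq> 0} \<subset> {e \<in> E. X e = 0 \<and> Y e \<noteq> 0}"
          using covector_leD0[OF covector_less_imp_le[OF MY]] by blast
      qed
      from less.hyps[OF this MinL XM okM convM] obtain p where p: "desc p" "set p \<subseteq> iv X M"
          "length p + Suc (rank (zero_set E M)) = rank (zero_set E X)"
          "\<And>k z. hgen ((\<lambda>\<rho>. \<rho> @ p @ [X]) ` ?R') k z \<Longrightarrow>
            \<exists>z'. hgen (chs X (\<lambda>_. iv X M) ?R') k z' \<and> (z' = 0 \<longleftrightarrow> z = 0)"
        by blast
      have covM: "covered M Y"
      proof -
        have "\<not> covector_less V Y" if V: "V \<in> L" "covector_less M V" for V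
        proof
          assume VY: "covector_less V Y"
          have Viv: "V \<in> iv X Y" using V VY covector_less_trans[OF XM V(2)] by (simp add: iv_def)
          then have "V \<in> \<Lambda>1" using ivY V by auto
          then show False using M2 V by auto
        qed
        then show ?thesis using MinL YL MY by (auto simp: covered_def)
      qed
      have "\<exists>z'. hgen ?S k z' \<and> (z' = 0 \<longleftrightarrow> z = 0)"
        if z: "hgen ((\<lambda>\<rho>. \<rho> @ (M # p) @ [X]) ` R) k z" for k z
      proof -
        have "(\<lambda>\<rho>. \<rho> @ p @ [X]) ` ?R' = (\<lambda>\<rho>. \<rho> @ (M # p) @ [X]) ` R"
          by (auto simp: image_image)
        then obtain z1 where z1: "hgen (?S - ?S1) k z1" "z1 = 0 \<longleftrightarrow> z = 0" using p(4) z quot by metis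
        obtain z2 where "hgen ?S k z2" "z2 = 0 \<longleftrightarrow> z1 = 0"
          using hgen_lift[OF conv sub acS1 z1(1)] .
        then show ?thesis using z1 by auto
      qed
      moreover have "desc (M # p)" using p by (auto simp: iv_def)
      moreover have "set (M # p) \<subseteq> iv X Y" using p Miv iv_mono[OF covector_less_imp_le[OF MY], of X] by auto
      moreover have "length (M # p) + Suc (rank (zero_set E Y)) = rank (zero_set E X)"
        using p(3) rank_covered[OF covM] by simp
      ultimately show ?thesis by (intro exI[of _ "M # p"]) blast
    qed
  qed
  then show ?thesis using that by blast
qed

end

section \<open>Walks of topes\<close>

lemma append_eq_append_notin2:
  assumes "u @ c # v = \<tau> @ s" "c \<notin> set s"
  obtains v' where "\<tau> = u @ c # v'" "v = v' @ s"
proof -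
  from assms(1) obtain us where "u = \<tau> @ us \<and> us @ c # v = s \<or> u @ us = \<tau> \<and> c # v = us @ s"
    by (auto simp: append_eq_append_conv2)
  then show ?thesis
  proof
    assume "u = \<tau> @ us \<and> us @ c # v = s"
    then show ?thesis using assms(2) by auto
  next
    assume *: "u @ us = \<tau> \<and> c # v = us @ s"
    then have "us \<noteq> []" using assms(2) by auto
    then obtain v' where "us = c # v'" "v = v' @ s" using * by (cases us) auto
    then show ?thesis using * that by auto
  qed
qed

lemma crossing_vector_Nil [simp]: "crossing_vector [] = (\<lambda>_. 0)"
  and crossing_vector_single [simp]: "crossing_vector [a] = (\<lambda>_. 0)"
  by (simp_all add: crossing_vector_def)

lemma crossing_vector_Cons:
  "crossing_vector (a # b # l) e = indicator (sep a b) e + crossing_vector (b # l) e"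
proof -
  have "{..<Suc (length l)} = insert 0 (Suc ` {..<length l})"
    by (auto simp: lessThan_Suc_eq_insert_0)
  then show ?thesis
    by (simp add: crossing_vector_def sum.reindex)
qed

lemma crossing_vector_append:
  "crossing_vector (u @ a # v) e = crossing_vector (u @ [a]) e + crossing_vector (a # v) e"
proof (induction u)
  case (Cons x u)
  show ?case
    by (cases u) (use Cons in \<open>simp_all add: crossing_vector_Cons\<close>)
qed simp

lemma indicator_sep_between:
  fixes a b c :: "'a \<Rightarrow> int"
  assumes "b e = a e \<or> b e = c e"
  shows "indicator (sep a b) e + indicator (sep b c) e = (indicator (sep a c) e :: nat)"
proof -
  have "e \<notin> sep x y" if "x e = y e" for x y :: "'a \<Rightarrow> int"
    using that by (simp add: sep_iff)
  moreover have "e \<in> sep b c \<longleftrightarrow> e \<in> sep a c" if "b e = a e"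
    using that by (simp only: sep_iff)
  moreover have "e \<in> sep a b \<longleftrightarrow> e \<in> sep a c" if "b e = c e"
    using that by (simp only: sep_iff)
  ultimately show ?thesis using assms by (cases "b e = a e") (simp_all add: indicator_def)
qed

lemma crossing_vector_delete:
  assumes "\<And>e. b e = a e \<or> b e = c e"
  shows "crossing_vector (u @ a # b # c # v) = crossing_vector (u @ a # c # v)"
proof
  fix e
  show "crossing_vector (u @ a # b # c # v) e = crossing_vector (u @ a # c # v) e"
    using indicator_sep_between[of b e a c, OF assms]
    by (simp add: crossing_vector_append[of u a "b # c # v"] crossing_vector_append[of u a "c # v"]
        crossing_vector_Cons)
qed

section \<open>Topes and walks with a prescribed crossing vector\<close>

locale simple_oriented_matroid = finite_oriented_matroid +
  assumes simple: "simple_om E L"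
begin

lemma not_loop: "e \<in> E \<Longrightarrow> \<exists>Y\<in>L. Y e \<noteq> 0"
proof -
  assume e: "e \<in> E"
  then have "matroid_indep E L {e, e}" using simple unfolding simple_om_def by blast
  then have "e \<notin> matroid_closure E L {}" by (simp add: matroid_indep_def)
  then show "\<exists>Y\<in>L. Y e \<noteq> 0" using e by (simp add: closure_iff)
qed

text \<open>No element is a loop, so a zero coordinate in the ground set could be filled by
  composing with a covector that is nonzero there.\<close>

lemma tope_iff: "B \<in> topes L \<longleftrightarrow> B \<in> L \<and> (\<forall>e\<in>E. B e \<noteq> 0)"
proof
  assume B: "B \<in> topes L"
  then have BL: "B \<in> L" by (simp add: topes_def)
  have "B e \<noteq> 0" if e: "e \<in> E" for e
  proof
    assume B0: "B e = 0"
    obtain Y where Y: "Y \<in> L" "Y e \<noteq> 0" using not_loop[OF e] by auto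
    have "covector_le B (sv_comp B Y)" by (intro covector_leI) (simp add: sv_comp_def)
    then have "sv_comp B Y = B" using B comp_closed[OF BL Y(1)] unfolding topes_def by blast
    then have "sv_comp B Y e = 0" using B0 by simp
    then show False using B0 Y(2) by (simp add: sv_comp_def)
  qed
  then show "B \<in> L \<and> (\<forall>e\<in>E. B e \<noteq> 0)" using BL by blast
next
  assume B: "B \<in> L \<and> (\<forall>e\<in>E. B e \<noteq> 0)"
  have "X = B" if X: "X \<in> L" "covector_le B X" for X
  proof
    fix e show "X e = B e"
    proof (cases "e \<in> E")
      case True
      then show ?thesis using B covector_leD[OF X(2), of e] by simp
    next
      case False
      then show ?thesis using B outside_ground[OF X(1)] outside_ground[of B] by simp
    qed
  qed
  then show "B \<in> topes L" using B by (simp add: topes_def)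
qed

lemma tope_in_L: "B \<in> topes L \<Longrightarrow> B \<in> L"
  by (simp add: topes_def)

lemma tope_zero_iff: "B \<in> topes L \<Longrightarrow> B e = 0 \<longleftrightarrow> e \<notin> E"
  using tope_iff[of B] outside_ground[of B e] by auto

lemma tope_sep_iff:
  assumes "B \<in> topes L" "C \<in> topes L"
  shows "e \<in> sep B C \<longleftrightarrow> B e \<noteq> C e"
  using sep_or_eq[OF assms[THEN tope_in_L], of e] tope_zero_iff[OF assms(1), of e]
    tope_zero_iff[OF assms(2), of e] by (auto simp: sep_iff)

lemma tope_comp: "Y \<in> L \<Longrightarrow> T \<in> topes L \<Longrightarrow> sv_comp Y T \<in> topes L"
  using comp_closed[of Y T] unfolding tope_iff by (auto simp: sv_comp_def)

lemma tope_opp: "Y \<in> L \<Longrightarrow> T \<in> topes L \<Longrightarrow> opp Y T \<in> topes L"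
  using opp_closed[of Y T] unfolding tope_iff by (auto simp: opp_apply)

lemma tope_betweenD:
  "tope_between (topes L) a b c \<Longrightarrow> b \<in> topes L \<Longrightarrow> c \<in> topes L"
  "tope_between (topes L) a b c \<Longrightarrow> b \<in> topes L \<Longrightarrow> b e = a e \<or> b e = c e"
  "tope_between (topes L) a b c \<Longrightarrow> b \<notin> topes L \<Longrightarrow> c \<notin> topes L"
  by (auto simp: tope_between_def)

lemma tope_betweenI:
  "b \<in> topes L \<Longrightarrow> c \<in> topes L \<Longrightarrow> (\<And>e. b e = a e \<or> b e = c e) \<Longrightarrow> tope_between (topes L) a b c"
  by (simp add: tope_between_def)

text \<open>The basis of the magnitude complex for \<open>C\<close> and \<open>w\<close>, in all
  degrees at once.\<close>

definition walks :: "('a \<Rightarrow> int) \<Rightarrow> ('a \<Rightarrow> nat) \<Rightarrow> ('a \<Rightarrow> int) list set" where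
  "walks C w = {\<tau>. \<tau> \<noteq> [] \<and> set \<tau> \<subseteq> topes L \<and> distinct_adj \<tau> \<and> last \<tau> = C \<and> crossing_vector \<tau> = w}"

text \<open>The new neighbours \<open>a\<close> and \<open>c\<close> differ: if they were equal,
  \<open>b\<close> would agree with \<open>a\<close> in every coordinate.\<close>

lemma walks_delete:
  assumes \<tau>: "u @ a # b # c # v \<in> walks C w" and b: "\<And>e. b e = a e \<or> b e = c e"
  shows "u @ a # c # v \<in> walks C w"
proof -
  have "a \<noteq> b" using \<tau> by (auto simp: walks_def distinct_adj_append_iff)
  then have "a \<noteq> c" using b by (metis ext)
  then show ?thesis
    using \<tau> crossing_vector_delete[of b a c u v, OF b]
    by (auto simp: walks_def distinct_adj_append_iff split: if_splits)
qed

lemma walks_insert: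
  assumes \<tau>: "u @ a # c # v \<in> walks C w" and b: "\<And>e. b e = a e \<or> b e = c e" "b \<in> topes L" "b \<noteq> a" "b \<noteq> c"
  shows "u @ a # b # c # v \<in> walks C w"
  using \<tau> b crossing_vector_delete[of b a c u v, OF b(1)]
  by (auto simp: walks_def distinct_adj_append_iff split: if_splits)

lemma crossing_vector_eq_0:
  assumes "set l \<subseteq> topes L" "crossing_vector l e = 0"
  shows "\<forall>T\<in>set l. T e = last l e"
  using assms
proof (induction l)
  case (Cons a l)
  show ?case
  proof (cases l)
    case l: (Cons b l')
    have ab: "a \<in> topes L" "b \<in> topes L" "e \<notin> sep a b" "crossing_vector l e = 0" "set l \<subseteq> topes L"
      using Cons.prems l by (auto simp: crossing_vector_Cons indicator_eq_0_iff)
    have "a e = b e" using ab(3) tope_sep_iff[OF ab(1,2), of e] by simp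
    moreover have IH: "\<forall>T\<in>set l. T e = last l e" using Cons.IH ab by simp
    moreover have "b e = last l e" by (rule bspec[OF IH]) (simp add: l)
    ultimately show ?thesis using l by simp
  qed simp
qed simp

lemma walks_agree: "\<tau> \<in> walks C w \<Longrightarrow> T \<in> set \<tau> \<Longrightarrow> w e = 0 \<Longrightarrow> T e = C e"
  using crossing_vector_eq_0[of \<tau> e] by (auto simp: walks_def)

text \<open>The tope just before the terminal one. It is the first step of the walk when this is
  read backwards from \<open>C\<close>.\<close>

definition first_step :: "('a \<Rightarrow> int) list \<Rightarrow> ('a \<Rightarrow> int)" where
  "first_step \<tau> = last (butlast \<tau>)"

lemma first_step_append [simp]: "first_step (u @ a # c # v) = first_step (a # c # v)"
  by (simp add: first_step_def butlast_append)

lemma first_step_pair [simp]: "first_step [a, c] = a"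
  by (simp add: first_step_def)

lemma first_step_Cons [simp]: "first_step (a # b # c # v) = first_step (b # c # v)"
  by (simp add: first_step_def)

end

lemma append_Cons_eq_append_Cons:
  assumes "p @ y # q = \<alpha> @ t # \<beta>"
  obtains (before) \<alpha>2 where "\<alpha> = p @ y # \<alpha>2" "q = \<alpha>2 @ t # \<beta>"
    | (same) "p = \<alpha>" "y = t" "q = \<beta>"
    | (after) \<beta>1 where "p = \<alpha> @ t # \<beta>1" "\<beta> = \<beta>1 @ y # q"
proof -
  from assms obtain us where "p = \<alpha> @ us \<and> us @ y # q = t # \<beta> \<or> p @ us = \<alpha> \<and> y # q = us @ t # \<beta>"
    by (auto simp: append_eq_append_conv2)
  then show ?thesis
  proof
    assume *: "p = \<alpha> @ us \<and> us @ y # q = t # \<beta>"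
    show ?thesis using * same after by (cases us) auto
  next
    assume *: "p @ us = \<alpha> \<and> y # q = us @ t # \<beta>"
    show ?thesis using * same before by (cases us) auto
  qed
qed

lemma crossing_vector_constant: "(\<And>T. T \<in> set l \<Longrightarrow> T e = x) \<Longrightarrow> crossing_vector l e = 0"
proof (induction l)
  case (Cons a l)
  show ?case
  proof (cases l)
    case l: (Cons b l')
    have "a e = x" "b e = x" using Cons.prems l by auto
    then have "e \<notin> sep a b" by (simp add: sep_iff)
    moreover have "crossing_vector l e = 0" using Cons by simp
    ultimately show ?thesis using l by (simp add: crossing_vector_Cons)
  qed simp
qed simp

section \<open>Walks followed by a chain of faces of the terminal tope\<close>

locale walk_face = simple_oriented_matroid +
  fixes C :: "'a \<Rightarrow> int" and w :: "'a \<Rightarrow> nat" and X :: "'a \<Rightarrow> int"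
  assumes C_tope: "C \<in> topes L" and X_in_L: "X \<in> L" and X_less: "covector_less X C"
    and w_zero: "\<And>e. w e \<noteq> 0 \<Longrightarrow> X e = 0"
    and X_max: "\<And>Y. Y \<in> L \<Longrightarrow> covector_le Y C \<Longrightarrow> (\<And>e. w e \<noteq> 0 \<Longrightarrow> Y e = 0) \<Longrightarrow> covector_le Y X"
begin

lemma C_in_L: "C \<in> L"
  using C_tope by (rule tope_in_L)

lemma X_not_tope: "X \<notin> topes L"
  using X_in_L C_in_L X_less by (rule below_not_tope)

lemma iv_not_tope: "Y \<in> iv X C \<Longrightarrow> Y \<notin> topes L"
  using below_not_tope[OF _ C_in_L] by (auto simp: iv_def)

lemma ch_ok_walk:
  assumes "\<tau> \<in> walks C w"
  shows "ch_ok X (iv X C) \<tau>"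
proof -
  have "iv X C \<subseteq> - topes L" using iv_not_tope by blast
  then show ?thesis
    using assms X_not_tope unfolding ch_ok_def walks_def iv_def by auto
qed

text \<open>Some coordinate is crossed: for \<open>w = 0\<close> the tope \<open>C\<close> itself
  would satisfy the conditions in \<open>X_max\<close>, against \<open>X\<close> being strictly
  below \<open>C\<close>. So a walk does not consist of \<open>C\<close> alone.\<close>

lemma walk_last:
  assumes "\<tau> \<in> walks C w"
  obtains u a where "\<tau> = u @ [a, C]"
proof -
  obtain y where y: "w y \<noteq> 0"
  proof (rule ccontr)
    assume none: "\<not> thesis"
    have w0: "w e = 0" for e using none that by blast
    have "covector_le C X" by (rule X_max[OF C_in_L]) (simp_all add: w0)
    then show False using X_less covector_le_antisym by (auto simp: covector_less_def)
  qed
  have \<tau>: "\<tau> \<noteq> []" "last \<tau> = C" "crossing_vector \<tau> = w" using assms by (auto simp: walks_def)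
  then have \<tau>': "\<tau> = butlast \<tau> @ [C]" by (metis append_butlast_last_id)
  have "butlast \<tau> \<noteq> []"
  proof
    assume "butlast \<tau> = []"
    then have "\<tau> = [C]" using \<tau>' by simp
    then have "w y = 0" using \<tau>(3) by auto
    then show False using y by simp
  qed
  then have "butlast \<tau> = butlast (butlast \<tau>) @ [last (butlast \<tau>)]" by simp
  then have "\<tau> = butlast (butlast \<tau>) @ [last (butlast \<tau>), C]" using \<tau>' by (metis append.assoc append_Cons append_Nil)
  then show ?thesis using that by blast
qed

text \<open>A coordinate in the support of \<open>X\<close> is never crossed, so all topes of the
  walk have the sign of \<open>C\<close> there.\<close>

lemma X_le_walk:
  assumes "\<tau> \<in> walks C w" "T \<in> set \<tau>"
  shows "covector_le X T"
proof (rule covector_leI)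
  fix e assume Xe: "X e \<noteq> 0"
  then have "w e = 0" using w_zero by blast
  then have "T e = C e" using walks_agree[OF assms] by blast
  then show "X e = T e" using covector_leD[OF covector_less_imp_le[OF X_less] Xe] by simp
qed

lemma first_step_facts:
  assumes "\<tau> \<in> walks C w"
  shows "first_step \<tau> \<in> topes L" "first_step \<tau> \<noteq> C" "covector_le X (first_step \<tau>)"
proof -
  obtain u a where ua: "\<tau> = u @ [a, C]" using assms by (rule walk_last)
  have "first_step \<tau> = a" by (simp add: ua)
  then show "first_step \<tau> \<in> topes L" "first_step \<tau> \<noteq> C" "covector_le X (first_step \<tau>)"
    using assms X_le_walk[OF assms, of a] unfolding ua walks_def
    by (auto simp: distinct_adj_append_iff)
qed

lemma sep_first_step_mono:
  assumes "u @ a # b # c # v \<in> walks C w" "\<And>e. b e = a e \<or> b e = c e"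
  shows "sep C (first_step (u @ a # b # c # v)) \<subseteq> sep C (first_step (u @ a # c # v))"
proof (cases v)
  case Nil
  then have c: "c = C" using assms(1) by (simp add: walks_def)
  have "e \<in> sep C a" if e: "e \<in> sep C b" for e
  proof -
    have "b e \<noteq> C e" using e by (auto simp: sep_iff)
    then have "b e = a e" using assms(2)[of e] c by auto
    then show ?thesis using e by (simp add: sep_iff)
  qed
  then show ?thesis using Nil c by auto
qed simp

definition total :: "('a \<Rightarrow> int) list set" where
  "total = chs X (\<lambda>\<tau>. cut X C (first_step \<tau>)) (walks C w)"

lemma total_iff: "l \<in> total \<longleftrightarrow>
  (\<exists>\<tau> \<sigma>. l = \<tau> @ \<sigma> @ [X] \<and> \<tau> \<in> walks C w \<and> desc \<sigma> \<and> set \<sigma> \<subseteq> cut X C (first_step \<tau>))"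
  by (auto simp: total_def chs_def ch_def)

lemma suffix_not_tope: "set \<sigma> \<subseteq> cut X C T \<Longrightarrow> y \<in> set (\<sigma> @ [X]) \<Longrightarrow> y \<notin> topes L"
  using X_not_tope iv_not_tope cut_subset[of X C T] by auto

lemma total_face:
  assumes l: "\<tau> \<in> walks C w" "set \<sigma> \<subseteq> cut X C T"
    and l': "l' \<in> keys (list_bd (tope_between (topes L)) (\<tau> @ \<sigma> @ [X]))"
  obtains (walk) u a b c v where "\<tau> = u @ a # b # c # v" "l' = (u @ a # c # v) @ \<sigma> @ [X]"
      "\<And>e. b e = a e \<or> b e = c e"
    | (chain) \<sigma>1 b \<sigma>2 where "\<sigma> = \<sigma>1 @ b # \<sigma>2" "l' = \<tau> @ (\<sigma>1 @ \<sigma>2) @ [X]"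
proof -
  obtain u a b c v where uv: "\<tau> @ \<sigma> @ [X] = u @ a # b # c # v" "l' = u @ a # c # v"
      "tope_between (topes L) a b c"
    using l' by (rule keys_list_bdE)
  show ?thesis
  proof (cases "b \<in> topes L")
    case True
    then have c: "c \<in> topes L" and btw: "b e = a e \<or> b e = c e" for e
      using tope_betweenD[OF uv(3)] by auto
    have "c \<notin> set (\<sigma> @ [X])" using suffix_not_tope[OF l(2), of c] c by blast
    moreover have "(u @ [a, b]) @ c # v = \<tau> @ (\<sigma> @ [X])" using uv(1) by simp
    ultimately obtain v' where v': "\<tau> = (u @ [a, b]) @ c # v'" "v = v' @ (\<sigma> @ [X])"
      using append_eq_append_notin2 by metis
    show ?thesis
    proof (rule walk)
      show "\<tau> = u @ a # b # c # v'" "l' = (u @ a # c # v') @ \<sigma> @ [X]" using v' uv(2) by simp_all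
    qed (rule btw)
  next
    case False
    then have "b \<notin> set \<tau>" using l(1) by (auto simp: walks_def)
    moreover have "(u @ [a]) @ b # (c # v) = \<tau> @ (\<sigma> @ [X])" using uv(1) by simp
    ultimately obtain \<tau>1 where \<tau>1: "u @ [a] = \<tau> @ \<tau>1" "\<sigma> @ [X] = \<tau>1 @ b # c # v"
      using append_eq_append_notin by metis
    have "c # v = butlast (c # v) @ [last (c # v)]" by simp
    moreover have "last (c # v) = X" using arg_cong[OF \<tau>1(2), of last] by (simp split: if_splits)
    ultimately have cv: "c # v = butlast (c # v) @ [X]" by metis
    then have "\<sigma> @ [X] = (\<tau>1 @ b # butlast (c # v)) @ [X]" using \<tau>1(2) by simp
    then have "\<sigma> = \<tau>1 @ b # butlast (c # v)" by simp
    moreover have "l' = \<tau> @ (\<tau>1 @ butlast (c # v)) @ [X]"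
    proof -
      have "l' = (u @ [a]) @ c # v" using uv(2) by simp
      also have "\<dots> = (\<tau> @ \<tau>1) @ butlast (c # v) @ [X]" using \<tau>1(1) cv by metis
      finally show ?thesis by simp
    qed
    ultimately show ?thesis by (rule chain)
  qed
qed

lemma cut_mono: "sep C T \<subseteq> sep C T' \<Longrightarrow> cut X C T \<subseteq> cut X C T'"
  unfolding cut_def by blast

lemma total_closed:
  assumes "l \<in> total" "l' \<in> keys (list_bd (tope_between (topes L)) l)"
  shows "l' \<in> total"
proof -
  obtain \<tau> \<sigma> where l: "l = \<tau> @ \<sigma> @ [X]" "\<tau> \<in> walks C w" "desc \<sigma>" "set \<sigma> \<subseteq> cut X C (first_step \<tau>)"
    using assms(1) unfolding total_iff by blast
  show ?thesis
  proof (rule total_face[OF l(2,4) assms(2)[unfolded l(1)]])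
    fix u a b c v
    assume w: "\<tau> = u @ a # b # c # v" "l' = (u @ a # c # v) @ \<sigma> @ [X]" "\<And>e. b e = a e \<or> b e = c e"
    have "cut X C (first_step \<tau>) \<subseteq> cut X C (first_step (u @ a # c # v))"
      using sep_first_step_mono[of u a b c v] w l(2) by (intro cut_mono) simp
    then have "set \<sigma> \<subseteq> cut X C (first_step (u @ a # c # v))" using l(4) by blast
    moreover have "u @ a # c # v \<in> walks C w" using walks_delete[of u a b c v C w] w l(2) by simp
    ultimately show "l' \<in> total" unfolding total_iff using w(2) l(3) by blast
  next
    fix \<sigma>1 b \<sigma>2 assume "\<sigma> = \<sigma>1 @ b # \<sigma>2" "l' = \<tau> @ (\<sigma>1 @ \<sigma>2) @ [X]"
    then show "l' \<in> total" unfolding total_iff using l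
      by (intro exI[of _ \<tau>] exI[of _ "\<sigma>1 @ \<sigma>2"]) auto
  qed
qed

lemma convex_total: "convex total"
  unfolding convex_def using total_closed by blast

end

section \<open>The matching that inserts and removes gates\<close>

locale gated = walk_face +
  fixes Y :: "'a \<Rightarrow> int"
  assumes Y_in_L: "Y \<in> L" and X_less_Y: "covector_less X Y" and Y_less_C: "covector_less Y C"
begin

abbreviation "gate t \<equiv> sv_comp Y t"

text \<open>The key of a walk is the walk without its gate, so that a fibre of the key consists of two
  walks, one with and one without the gate.\<close>

definition gate_key :: "('a \<Rightarrow> int) list \<Rightarrow> ('a \<Rightarrow> int) list" where
  "gate_key \<tau> = (let \<beta> = rev (takeWhile (covector_le Y) (rev \<tau>));
      \<alpha> = rev (dropWhile (covector_le Y) (rev \<tau>))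
    in if hd \<beta> = gate (last \<alpha>) then \<alpha> @ tl \<beta> else \<tau>)"

text \<open>The length of the key alone would not do: when the last tope outside the star of
  \<open>Y\<close> is removed and the tope after it was its gate but is not the gate of the tope
  before, the key keeps its length. The second summand, the position of the last tope outside the
  star, drops in this case.\<close>

definition gate_rank :: "('a \<Rightarrow> int) list \<Rightarrow> nat" where
  "gate_rank k = length k + length (dropWhile (covector_le Y) (rev k))"

definition split_at :: "('a \<Rightarrow> int) list \<Rightarrow> ('a \<Rightarrow> int) \<Rightarrow> ('a \<Rightarrow> int) list \<Rightarrow> bool" where
  "split_at \<alpha> t \<beta> \<longleftrightarrow> \<not> covector_le Y t \<and> (\<forall>b\<in>set \<beta>. covector_le Y b)"

lemma split_at_while:
  assumes "split_at \<alpha> t \<beta>"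
  shows "takeWhile (covector_le Y) (rev (\<alpha> @ t # \<beta>)) = rev \<beta>"
    "dropWhile (covector_le Y) (rev (\<alpha> @ t # \<beta>)) = t # rev \<alpha>"
proof -
  have *: "\<And>b. b \<in> set (rev \<beta>) \<Longrightarrow> covector_le Y b" "\<not> covector_le Y t"
    using assms by (auto simp: split_at_def)
  have "takeWhile (covector_le Y) (rev \<beta> @ t # rev \<alpha>) = rev \<beta> @ takeWhile (covector_le Y) (t # rev \<alpha>)"
    by (rule takeWhile_append2) (rule *(1))
  then show "takeWhile (covector_le Y) (rev (\<alpha> @ t # \<beta>)) = rev \<beta>" using *(2) by simp
  have "dropWhile (covector_le Y) (rev \<beta> @ t # rev \<alpha>) = dropWhile (covector_le Y) (t # rev \<alpha>)"
    by (rule dropWhile_append2) (rule *(1))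
  then show "dropWhile (covector_le Y) (rev (\<alpha> @ t # \<beta>)) = t # rev \<alpha>" using *(2) by simp
qed

lemma gate_key_split:
  assumes "split_at \<alpha> t \<beta>"
  shows "gate_key (\<alpha> @ t # \<beta>) = (if hd \<beta> = gate t then \<alpha> @ t # tl \<beta> else \<alpha> @ t # \<beta>)"
  unfolding gate_key_def split_at_while[OF assms] by (simp add: Let_def)

lemma gate_rank_split:
  assumes "split_at \<alpha> t \<beta>" "\<beta> \<noteq> []"
  shows "gate_rank (gate_key (\<alpha> @ t # \<beta>)) =
    length \<alpha> + length \<beta> + 1 + length \<alpha> + 1 - (if hd \<beta> = gate t then 1 else 0)"
proof -
  have "split_at \<alpha> t (tl \<beta>)" using assms by (cases \<beta>) (auto simp: split_at_def)
  then show ?thesis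
    using assms(2) split_at_while(2)[OF assms(1)] split_at_while(2)[of \<alpha> t "tl \<beta>"]
    by (simp add: gate_key_split[OF assms(1)] gate_rank_def del: rev_append rev.simps)
qed

text \<open>If all topes of the walk were in the star of \<open>Y\<close>, no coordinate in the
  support of \<open>Y\<close> would be crossed. Then \<open>Y\<close> would vanish wherever
  \<open>w\<close> is nonzero and, by maximality, lie below \<open>X\<close>.\<close>

lemma walk_split:
  assumes "\<tau> \<in> walks C w"
  obtains \<alpha> t \<beta> where "\<tau> = \<alpha> @ t # \<beta>" "split_at \<alpha> t \<beta>" "\<beta> \<noteq> []"
proof -
  have \<tau>: "\<tau> \<noteq> []" "last \<tau> = C" "crossing_vector \<tau> = w" using assms by (auto simp: walks_def)
  have "\<exists>t\<in>set \<tau>. \<not> covector_le Y t"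
  proof (rule ccontr)
    assume "\<not> ?thesis"
    then have all: "covector_le Y t" if "t \<in> set \<tau>" for t using that by blast
    have "Y e = 0" if we: "w e \<noteq> 0" for e
    proof (rule ccontr)
      assume Ye: "Y e \<noteq> 0"
      have "crossing_vector \<tau> e = 0"
      proof (rule crossing_vector_constant)
        show "T e = Y e" if "T \<in> set \<tau>" for T using covector_leD[OF all[OF that] Ye] by simp
      qed
      then show False using we \<tau>(3) by simp
    qed
    then have "covector_le Y X" by (rule X_max[OF Y_in_L covector_less_imp_le[OF Y_less_C]])
    then show False using X_less_Y covector_le_antisym by (auto simp: covector_less_def)
  qed
  then obtain \<alpha> t \<beta> where *: "\<tau> = \<alpha> @ t # \<beta>" "\<not> covector_le Y t" "\<forall>b\<in>set \<beta>. \<not> \<not> covector_le Y b"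
    by (rule split_list_last_propE)
  have "\<beta> \<noteq> []"
  proof
    assume "\<beta> = []"
    then have "t = C" using * \<tau>(2) by simp
    then show False using *(2) covector_less_imp_le[OF Y_less_C] by simp
  qed
  with * show ?thesis by (intro that[of \<alpha> t \<beta>]) (simp_all add: split_at_def)
qed

text \<open>The gate property: the tope \<open>gate t\<close> lies between \<open>t\<close> and
  every tope of the star of \<open>Y\<close>, so it can be inserted between \<open>t\<close> and any
  other member of the star that follows.\<close>

lemma gate_between: "covector_le Y b \<Longrightarrow> gate t e = t e \<or> gate t e = b e"
  using covector_leD[of Y b e] by (simp add: sv_comp_def)

lemma le_gate: "covector_le Y (gate t)"
  by (rule covector_leI) (simp add: sv_comp_def)

lemma split_unique:
  assumes "\<alpha> @ t # \<beta> = \<alpha>' @ t' # \<beta>'" "split_at \<alpha> t \<beta>" "split_at \<alpha>' t' \<beta>'"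
  shows "\<alpha> = \<alpha>' \<and> t = t' \<and> \<beta> = \<beta>'"
proof -
  have "rev \<beta> = rev \<beta>'" "t # rev \<alpha> = t' # rev \<alpha>'"
    using split_at_while[OF assms(2)] split_at_while[OF assms(3)] assms(1) by simp_all
  then show ?thesis by simp
qed

definition crossed :: "('a \<Rightarrow> int) list \<Rightarrow> bool" where
  "crossed \<tau> \<longleftrightarrow> (\<exists>e\<in>sep C (first_step \<tau>). Y e = 0)"

text \<open>A tope and its gate agree on the zero set of \<open>Y\<close>, so the condition is
  unaffected even when the gate becomes the first step.\<close>

lemma crossed_gate:
  assumes "u @ t # c # v \<in> walks C w" "covector_le Y c" "gate t \<noteq> c"
  shows "crossed (u @ t # gate t # c # v) \<longleftrightarrow> crossed (u @ t # c # v)"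
proof (cases v)
  case Nil
  have *: "gate t e = t e" if "Y e = 0" for e using that by (simp add: sv_comp_def)
  have "e \<in> sep C (gate t) \<longleftrightarrow> e \<in> sep C t" if "Y e = 0" for e
    using *[OF that] by (simp add: sep_iff)
  then show ?thesis using Nil by (auto simp: crossed_def)
qed (simp add: crossed_def)

lemma insert_gate:
  assumes \<tau>: "\<alpha> @ t # \<beta> \<in> walks C w" "split_at \<alpha> t \<beta>" "\<beta> \<noteq> []" "hd \<beta> \<noteq> gate t"
  shows "\<alpha> @ t # gate t # \<beta> \<in> walks C w" "split_at \<alpha> t (gate t # \<beta>)"
    "crossed (\<alpha> @ t # gate t # \<beta>) \<longleftrightarrow> crossed (\<alpha> @ t # \<beta>)"
proof -
  obtain c v where \<beta>: "\<beta> = c # v" using \<tau>(3) by (cases \<beta>) auto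
  have Yc: "covector_le Y c" and Yt: "\<not> covector_le Y t" using \<tau>(2) \<beta> by (auto simp: split_at_def)
  have tt: "t \<in> topes L" using \<tau>(1) by (auto simp: walks_def)
  have gt: "gate t \<in> topes L" using tope_comp[OF Y_in_L tt] .
  have gn: "gate t \<noteq> t" using le_gate[of t] Yt by auto
  show "\<alpha> @ t # gate t # \<beta> \<in> walks C w"
    unfolding \<beta> by (rule walks_insert[OF \<tau>(1)[unfolded \<beta>] gate_between[OF Yc] gt gn]) (use \<tau>(4) \<beta> in auto)
  show "split_at \<alpha> t (gate t # \<beta>)" using \<tau>(2) le_gate by (simp add: split_at_def)
  show "crossed (\<alpha> @ t # gate t # \<beta>) \<longleftrightarrow> crossed (\<alpha> @ t # \<beta>)"
    unfolding \<beta> using \<tau>(1,4) Yc by (intro crossed_gate) (auto simp: \<beta>)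
qed

text \<open>Were the gate the terminal tope \<open>C\<close>, the first step would be
  \<open>t\<close>, which agrees with its gate on the zero set of \<open>Y\<close>;
  \<open>crossed\<close> excludes this. So the gate has a successor in the star and can be
  removed.\<close>

lemma remove_gate:
  assumes \<tau>: "\<alpha> @ t # \<beta> \<in> walks C w" "split_at \<alpha> t \<beta>" "\<beta> \<noteq> []" "hd \<beta> = gate t"
    and cr: "crossed (\<alpha> @ t # \<beta>)"
  shows "tl \<beta> \<noteq> []" "hd (tl \<beta>) \<noteq> gate t" "\<alpha> @ t # tl \<beta> \<in> walks C w" "split_at \<alpha> t (tl \<beta>)"
    "crossed (\<alpha> @ t # tl \<beta>)"
proof -
  have \<beta>: "\<beta> = gate t # tl \<beta>" using \<tau>(3,4) by (metis list.collapse)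
  show tl: "tl \<beta> \<noteq> []"
  proof
    assume "tl \<beta> = []"
    then have \<beta>': "\<beta> = [gate t]" using \<beta> by simp
    then have "gate t = C" using \<tau>(1) by (simp add: walks_def)
    moreover obtain e where e: "e \<in> sep C (first_step (\<alpha> @ t # \<beta>))" "Y e = 0" using cr by (auto simp: crossed_def)
    ultimately have "e \<in> sep C t" "C e = t e" using \<beta>' by (auto simp: sv_comp_def)
    then show False by (auto simp: sep_iff)
  qed
  then obtain c v where cv: "tl \<beta> = c # v" by (cases "tl \<beta>") auto
  have \<tau>': "\<alpha> @ t # gate t # c # v \<in> walks C w" using \<tau>(1) \<beta> cv by metis
  show "hd (tl \<beta>) \<noteq> gate t" using \<tau>' cv by (auto simp: walks_def distinct_adj_append_iff)
  have "c \<in> set \<beta>" using cv list.set_sel(2)[of \<beta> c] \<tau>(3) by simp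
  then have Yc: "covector_le Y c" using \<tau>(2) by (simp add: split_at_def)
  show w: "\<alpha> @ t # tl \<beta> \<in> walks C w"
    unfolding cv by (rule walks_delete[OF \<tau>' gate_between[OF Yc]])
  show "split_at \<alpha> t (tl \<beta>)" using \<tau>(2) list.set_sel(2)[of \<beta>] \<tau>(3) by (auto simp: split_at_def)
  have "crossed (\<alpha> @ t # gate t # c # v)" using cr \<beta> cv by metis
  then show "crossed (\<alpha> @ t # tl \<beta>)"
    unfolding cv using crossed_gate[OF w[unfolded cv] Yc] \<open>hd (tl \<beta>) \<noteq> gate t\<close> cv by auto
qed

definition gated_lists :: "('a \<Rightarrow> int) list \<Rightarrow> ('a \<Rightarrow> int) list set" where
  "gated_lists s = {\<tau> @ s | \<tau>. \<tau> \<in> walks C w \<and> crossed \<tau>}"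

text \<open>Only the removal of the gate preserves the key: every other deletion shortens the key, or
  brings the first tope outside the star of \<open>Y\<close> closer to the start of the list.\<close>

lemma gate_key_mono:
  assumes \<tau>: "\<tau> \<in> walks C w" "\<tau> = u @ x # y # z # v" and \<tau>': "\<tau>' = u @ x # z # v" "\<tau>' \<in> walks C w"
    and btw: "\<And>e. y e = x e \<or> y e = z e"
  shows "gate_key \<tau>' = gate_key \<tau> \<or> gate_rank (gate_key \<tau>') < gate_rank (gate_key \<tau>)"
proof -
  obtain \<alpha> t \<beta> where sp: "\<tau> = \<alpha> @ t # \<beta>" "split_at \<alpha> t \<beta>" "\<beta> \<noteq> []" using \<tau>(1) by (rule walk_split)
  note rk = gate_rank_split[OF sp(2,3), folded sp(1)]
  have "(u @ [x]) @ y # (z # v) = \<alpha> @ t # \<beta>" using \<tau>(2) sp(1) by simp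
  then show ?thesis
  proof (cases rule: append_Cons_eq_append_Cons)
    case (before \<alpha>2)
    have \<tau>'': "\<tau>' = (u @ x # \<alpha>2) @ t # \<beta>" using before \<tau>'(1) by simp
    have "split_at (u @ x # \<alpha>2) t \<beta>" using sp(2) by (simp add: split_at_def)
    from gate_rank_split[OF this sp(3), folded \<tau>'']
    have "gate_rank (gate_key \<tau>') < gate_rank (gate_key \<tau>)" unfolding rk using before(1) by simp
    then show ?thesis ..
  next
    case same
    have Yz: "covector_le Y z" using sp(2) same(3) by (auto simp: split_at_def)
    \<comment> \<open>The star of \<open>Y\<close> is convex: with \<open>x\<close> and
      \<open>z\<close> in it, the tope \<open>y\<close> between them would be in it as well.\<close>
    have "\<not> covector_le Y x"
    proof
      assume Yx: "covector_le Y x"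
      have "covector_le Y y"
      proof (rule covector_leI)
        fix e assume "Y e \<noteq> 0"
        then show "Y e = y e" using covector_leD[OF Yx] covector_leD[OF Yz] btw[of e] by metis
      qed
      then show False using sp(2) same(2) by (simp add: split_at_def)
    qed
    then have sp': "split_at u x \<beta>" using sp(2) by (simp add: split_at_def)
    have "\<tau>' = u @ x # \<beta>" using same(3) \<tau>'(1) by simp
    from gate_rank_split[OF sp' sp(3), folded this]
    have "gate_rank (gate_key \<tau>') < gate_rank (gate_key \<tau>)" unfolding rk same(1)[symmetric] by simp
    then show ?thesis ..
  next
    case (after \<beta>1)
    show ?thesis
    proof (cases "\<beta>1 = []")
      case True
      then have ux: "u = \<alpha>" "x = t" "\<beta> = y # z # v" using after by auto
      have \<tau>'': "\<tau>' = \<alpha> @ t # z # v" using ux \<tau>'(1) by simp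
      have sp': "split_at \<alpha> t (z # v)" using sp(2) ux by (simp add: split_at_def)
      show ?thesis
      proof (cases "y = gate t")
        case True
        have "z \<noteq> y" using \<tau> by (auto simp: walks_def distinct_adj_append_iff)
        then have "gate_key \<tau>' = \<tau>'" using gate_key_split[OF sp'] \<tau>'' True by simp
        moreover have "gate_key \<tau> = \<tau>'" using gate_key_split[OF sp(2)] sp(1) ux True \<tau>'' by simp
        ultimately show ?thesis by simp
      next
        case False
        have "gate_rank (gate_key \<tau>') < gate_rank (gate_key \<tau>)"
          unfolding rk using gate_rank_split[OF sp', folded \<tau>''] ux False by simp
        then show ?thesis ..
      qed
    next
      case False
      then obtain \<beta>2 where \<beta>2: "\<beta>1 = \<beta>2 @ [x]" "u = \<alpha> @ t # \<beta>2"
        using after(1) by (cases \<beta>1 rule: rev_cases) auto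
      have \<tau>'': "\<tau>' = \<alpha> @ t # (\<beta>1 @ z # v)" using \<beta>2 \<tau>'(1) by simp
      have sp': "split_at \<alpha> t (\<beta>1 @ z # v)" using sp(2) after(2) by (simp add: split_at_def)
      have "hd (\<beta>1 @ z # v) = hd \<beta>" using after(2) False by simp
      then have "gate_rank (gate_key \<tau>') < gate_rank (gate_key \<tau>)"
        unfolding rk using gate_rank_split[OF sp', folded \<tau>''] after(2) False by simp
      then show ?thesis ..
    qed
  qed
qed

lemma acyclic_gated:
  assumes conv: "convex (gated_lists s)" and s: "s \<noteq> []" "set s \<inter> topes L = {}"
    and adj: "distinct_adj (C # s)"
  shows "acyclic (gated_lists s)"
proof -
  define tp where "tp = filter (\<lambda>y. y \<in> topes L)"
  have tp: "tp (\<tau> @ s) = \<tau>" if "\<tau> \<in> walks C w" for \<tau>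
  proof -
    have "tp \<tau> = \<tau>" unfolding tp_def using that by (intro filter_True) (auto simp: walks_def)
    moreover have "tp s = []" unfolding tp_def using s by (intro filter_False) auto
    ultimately show ?thesis by (simp add: tp_def)
  qed
  show ?thesis
  proof (rule acyclicI_fibres[where key = "\<lambda>l. gate_key (tp l)" and rk = gate_rank, OF conv])
    fix a b assume a: "a \<in> gated_lists s" and b: "b \<in> gated_lists s"
      and ab: "b \<in> keys (list_bd (tope_between (topes L)) a)"
    obtain \<tau> where \<tau>: "a = \<tau> @ s" "\<tau> \<in> walks C w" using a by (auto simp: gated_lists_def)
    obtain \<tau>' where \<tau>': "b = \<tau>' @ s" "\<tau>' \<in> walks C w" using b by (auto simp: gated_lists_def)
    obtain u x y z v where uv: "a = u @ x # y # z # v" "b = u @ x # z # v" "tope_between (topes L) x y z"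
      using ab by (rule keys_list_bdE)
    have len: "length \<tau> = Suc (length \<tau>')" using uv \<tau> \<tau>' by (metis add_Suc_right add_right_cancel length_Cons length_append add_Suc)
    \<comment> \<open>Both lists end in the same suffix \<open>s\<close>. Removing an entry that is
      not a tope would leave the walk unchanged and so not shorten the list.\<close>
    have y: "y \<in> topes L"
    proof (rule ccontr)
      assume "y \<notin> topes L"
      then have "tp a = tp b" unfolding uv tp_def by simp
      then show False using tp[OF \<tau>(2)] tp[OF \<tau>'(2)] \<tau>(1) \<tau>'(1) len by simp
    qed
    then have z: "z \<in> topes L" and btw: "y e = x e \<or> y e = z e" for e
      using tope_betweenD[OF uv(3)] by auto
    have "z \<notin> set s" using z s by blast
    moreover have "(u @ [x, y]) @ z # v = \<tau> @ s" using uv \<tau> by simp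
    ultimately obtain v' where v': "\<tau> = (u @ [x, y]) @ z # v'" "v = v' @ s"
      using append_eq_append_notin2 by metis
    have "\<tau>' = u @ x # z # v'" using uv(2) v'(2) \<tau>'(1) by simp
    then have "gate_key \<tau>' = gate_key \<tau> \<or> gate_rank (gate_key \<tau>') < gate_rank (gate_key \<tau>)"
      using v'(1) by (intro gate_key_mono[OF \<tau>(2) _ _ \<tau>'(2) btw]) auto
    then show "gate_key (tp b) = gate_key (tp a) \<or> gate_rank (gate_key (tp b)) < gate_rank (gate_key (tp a))"
      using tp \<tau> \<tau>' by simp
  next
    fix k
    let ?F = "{a \<in> gated_lists s. gate_key (tp a) = k}"
    show "acyclic ?F"
    proof (cases "?F = {}")
      case False
      then obtain \<tau>0 where \<tau>0: "\<tau>0 \<in> walks C w" "crossed \<tau>0" "gate_key \<tau>0 = k"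
        using tp by (auto simp: gated_lists_def)
      obtain \<alpha> t \<beta> where k: "k = \<alpha> @ t # \<beta>" "split_at \<alpha> t \<beta>" "\<beta> \<noteq> []" "hd \<beta> \<noteq> gate t"
          "k \<in> walks C w" "crossed k"
      proof -
        obtain \<alpha> t \<beta> where sp: "\<tau>0 = \<alpha> @ t # \<beta>" "split_at \<alpha> t \<beta>" "\<beta> \<noteq> []" using \<tau>0(1) by (rule walk_split)
        show ?thesis
        proof (cases "hd \<beta> = gate t")
          case True
          note rg = remove_gate[OF \<tau>0(1)[unfolded sp(1)] sp(2,3) True \<tau>0(2)[unfolded sp(1)]]
          have "k = \<alpha> @ t # tl \<beta>" using \<tau>0(3) sp(1) gate_key_split[OF sp(2)] True by simp
          then show ?thesis using that[of \<alpha> t "tl \<beta>"] rg by simp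
        next
          case False
          have "k = \<alpha> @ t # \<beta>" using \<tau>0(3) sp(1) gate_key_split[OF sp(2)] False by simp
          then show ?thesis using that[of \<alpha> t \<beta>] sp \<tau>0 False by simp
        qed
      qed
      define k' where "k' = \<alpha> @ t # gate t # \<beta>"
      note ig = insert_gate[OF k(5)[unfolded k(1)] k(2,3,4), folded k'_def]
      have F: "?F = {k @ s, k' @ s}"
      proof (intro equalityI subsetI)
        fix a assume "a \<in> ?F"
        then obtain \<tau> where \<tau>: "a = \<tau> @ s" "\<tau> \<in> walks C w" "crossed \<tau>" "gate_key \<tau> = k"
          using tp by (auto simp: gated_lists_def)
        obtain \<alpha>' t' \<beta>' where sp: "\<tau> = \<alpha>' @ t' # \<beta>'" "split_at \<alpha>' t' \<beta>'" "\<beta>' \<noteq> []"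
          using \<tau>(2) by (rule walk_split)
        have "\<tau> = k \<or> \<tau> = k'"
        proof (cases "hd \<beta>' = gate t'")
          case True
          note rg = remove_gate[OF \<tau>(2)[unfolded sp(1)] sp(2,3) True \<tau>(3)[unfolded sp(1)]]
          have "\<alpha>' @ t' # tl \<beta>' = \<alpha> @ t # \<beta>" using \<tau>(4) sp(1) gate_key_split[OF sp(2)] True k(1) by simp
          then have "\<alpha>' = \<alpha> \<and> t' = t \<and> tl \<beta>' = \<beta>" using split_unique rg(4) k(2) by blast
          then have "\<tau> = k'" using sp True unfolding k'_def by (metis list.collapse)
          then show ?thesis ..
        next
          case False
          then show ?thesis using \<tau>(4) sp(1) gate_key_split[OF sp(2)] by simp
        qed
        then show "a \<in> {k @ s, k' @ s}" using \<tau>(1) by auto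
      next
        fix a assume "a \<in> {k @ s, k' @ s}"
        moreover have "k @ s \<in> ?F"
          using k gate_key_split[OF k(2)] tp[OF k(5)] by (auto simp: gated_lists_def)
        moreover have "crossed k'" using ig(3) k by simp
        then have "k' @ s \<in> ?F"
          using ig(1) gate_key_split[OF ig(2)] tp[OF ig(1)] k(1) by (auto simp: gated_lists_def k'_def)
        ultimately show "a \<in> ?F" by auto
      qed
      obtain c v where \<beta>: "\<beta> = c # v" using k(3) by (cases \<beta>) auto
      have Yc: "covector_le Y c" using k(2) \<beta> by (simp add: split_at_def)
      have tops: "gate t \<in> topes L" "c \<in> topes L" using ig(1) \<beta> by (auto simp: walks_def k'_def)
      have k's: "k' @ s = \<alpha> @ t # gate t # c # (v @ s)" "k @ s = \<alpha> @ t # c # (v @ s)"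
        using k(1) \<beta> by (simp_all add: k'_def)
      have "distinct_adj (k' @ s)"
        using ig(1) adj s by (auto simp: walks_def distinct_adj_append_iff distinct_adj_Cons)
      then have "\<bar>Poly_Mapping.lookup (list_bd (tope_between (topes L)) (k' @ s)) (k @ s)\<bar> = 1"
        unfolding k's using tops gate_between[OF Yc] by (intro lookup_list_bd tope_betweenI) auto
      then show ?thesis unfolding F by (rule acyclic_pair)
    qed (simp only: acyclic_empty)
  qed
qed

end

section \<open>Comparison of the subcomplexes of bare and of turning walks\<close>

context walk_face
begin

definition walk_part :: "('a \<Rightarrow> int) list \<Rightarrow> ('a \<Rightarrow> int) list" where
  "walk_part = filter (\<lambda>y. y \<in> topes L)"

definition face_part :: "('a \<Rightarrow> int) list \<Rightarrow> ('a \<Rightarrow> int) list" where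
  "face_part = filter (\<lambda>y. y \<notin> topes L)"

lemma parts:
  assumes "\<tau> \<in> walks C w" "set \<sigma> \<subseteq> cut X C T"
  shows "walk_part (\<tau> @ \<sigma> @ [X]) = \<tau>" "face_part (\<tau> @ \<sigma> @ [X]) = \<sigma> @ [X]"
proof -
  have \<tau>: "set \<tau> \<subseteq> topes L" using assms(1) by (auto simp: walks_def)
  have s: "y \<notin> topes L" if "y \<in> set (\<sigma> @ [X])" for y using suffix_not_tope[OF assms(2) that] .
  have "walk_part \<tau> = \<tau>" "face_part \<tau> = []"
    unfolding walk_part_def face_part_def using \<tau> by (intro filter_True filter_False; blast)+
  moreover have "walk_part (\<sigma> @ [X]) = []" "face_part (\<sigma> @ [X]) = \<sigma> @ [X]"
    unfolding walk_part_def face_part_def using s by (intro filter_True filter_False; blast)+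
  ultimately show "walk_part (\<tau> @ \<sigma> @ [X]) = \<tau>" "face_part (\<tau> @ \<sigma> @ [X]) = \<sigma> @ [X]"
    unfolding walk_part_def face_part_def by simp_all
qed

lemma totalE:
  assumes "l \<in> total"
  obtains \<tau> \<sigma> where "l = \<tau> @ \<sigma> @ [X]" "\<tau> \<in> walks C w" "desc \<sigma>" "set \<sigma> \<subseteq> cut X C (first_step \<tau>)"
    "walk_part l = \<tau>" "face_part l = \<sigma> @ [X]"
proof -
  obtain \<tau> \<sigma> where *: "l = \<tau> @ \<sigma> @ [X]" "\<tau> \<in> walks C w" "desc \<sigma>" "set \<sigma> \<subseteq> cut X C (first_step \<tau>)"
    using assms unfolding total_iff by blast
  show ?thesis using that[OF *] parts[OF *(2,4)] *(1) by simp
qed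

lemma totalI: "\<tau> \<in> walks C w \<Longrightarrow> desc \<sigma> \<Longrightarrow> set \<sigma> \<subseteq> cut X C (first_step \<tau>) \<Longrightarrow> \<tau> @ \<sigma> @ [X] \<in> total"
  unfolding total_iff by blast

abbreviation "bare \<equiv> (\<lambda>\<tau>. \<tau> @ [X]) ` walks C w"

lemma subcomplex_bare: "subcomplex bare total"
  unfolding subcomplex_def
proof (intro conjI subsetI ballI)
  show "l \<in> total" if "l \<in> bare" for l
    using that totalI[of _ "[]"] by auto
  fix a l assume a: "a \<in> bare" and l: "l \<in> keys (list_bd (tope_between (topes L)) a) \<inter> total"
  obtain \<tau> where \<tau>: "a = \<tau> @ [] @ [X]" "\<tau> \<in> walks C w" using a by auto
  have l': "l \<in> keys (list_bd (tope_between (topes L)) (\<tau> @ [] @ [X]))" using l \<tau> by simp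
  have e: "set [] \<subseteq> cut X C C" by simp
  show "l \<in> bare"
  proof (rule total_face[OF \<tau>(2) e l'])
    fix u a b c v
    assume *: "\<tau> = u @ a # b # c # v" "l = (u @ a # c # v) @ [] @ [X]" "\<And>e. b e = a e \<or> b e = c e"
    have "u @ a # c # v \<in> walks C w" using walks_delete[of u a b c v C w] * \<tau>(2) by simp
    then show "l \<in> bare" using *(2) by auto
  qed auto
qed

lemma cut_down:
  assumes "Z \<in> iv X C" "covector_le Z Y" "Y \<in> cut X C T"
  shows "Z \<in> cut X C T"
proof -
  obtain e where e: "e \<in> sep C T" "Y e = 0" using assms(3) by (auto simp: cut_def)
  have "Z e = 0" using covector_leD0[OF assms(2) e(2)] .
  then show ?thesis using e(1) assms(1) by (auto simp: cut_def)
qed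

text \<open>By \<open>cut_down\<close> a zero of the top covector is inherited by all covectors
  below it, so the condition on the whole chain is the condition on its head.\<close>

lemma gated_fibre:
  assumes \<sigma>: "desc \<sigma>" "set \<sigma> \<subseteq> iv X C" "\<sigma> \<noteq> []"
  shows "{l \<in> total - bare. face_part l = \<sigma> @ [X]} =
    {\<tau> @ (\<sigma> @ [X]) | \<tau>. \<tau> \<in> walks C w \<and> (\<exists>e\<in>sep C (first_step \<tau>). hd \<sigma> e = 0)}"
proof (intro equalityI subsetI)
  fix l assume "l \<in> {l \<in> total - bare. face_part l = \<sigma> @ [X]}"
  then have l: "l \<in> total" "face_part l = \<sigma> @ [X]" by auto
  obtain \<tau> \<sigma>' where *: "l = \<tau> @ \<sigma>' @ [X]" "\<tau> \<in> walks C w" "set \<sigma>' \<subseteq> cut X C (first_step \<tau>)" "face_part l = \<sigma>' @ [X]"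
    using l(1) by (rule totalE)
  have "\<sigma>' = \<sigma>" using *(4) l(2) by simp
  moreover from this have "hd \<sigma> \<in> cut X C (first_step \<tau>)" using *(3) \<sigma>(3) by (cases \<sigma>) auto
  then have "\<exists>e\<in>sep C (first_step \<tau>). hd \<sigma> e = 0" by (auto simp: cut_def)
  ultimately show "l \<in> {\<tau> @ (\<sigma> @ [X]) | \<tau>. \<tau> \<in> walks C w \<and> (\<exists>e\<in>sep C (first_step \<tau>). hd \<sigma> e = 0)}"
    using * by blast
next
  fix l assume "l \<in> {\<tau> @ (\<sigma> @ [X]) | \<tau>. \<tau> \<in> walks C w \<and> (\<exists>e\<in>sep C (first_step \<tau>). hd \<sigma> e = 0)}"
  then obtain \<tau> where \<tau>: "l = \<tau> @ \<sigma> @ [X]" "\<tau> \<in> walks C w" "\<exists>e\<in>sep C (first_step \<tau>). hd \<sigma> e = 0" by blast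
  obtain Y \<sigma>1 where Y: "\<sigma> = Y # \<sigma>1" using \<sigma>(3) by (cases \<sigma>) auto
  have Yc: "Y \<in> cut X C (first_step \<tau>)" using \<tau>(3) \<sigma>(2) Y by (auto simp: cut_def)
  have "Z \<in> cut X C (first_step \<tau>)" if "Z \<in> set \<sigma>" for Z
  proof (rule cut_down[OF _ _ Yc])
    show "Z \<in> iv X C" using that \<sigma>(2) by blast
    show "covector_le Z Y" using that \<sigma>(1) Y by (auto simp: covector_less_def)
  qed
  then have sub: "set \<sigma> \<subseteq> cut X C (first_step \<tau>)" by blast
  have "l \<in> total" unfolding \<tau>(1) using \<tau>(2) \<sigma>(1) sub by (rule totalI)
  moreover have fp: "face_part l = \<sigma> @ [X]" unfolding \<tau>(1) by (rule parts[OF \<tau>(2) sub])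
  moreover have "l \<notin> bare"
  proof
    assume "l \<in> bare"
    then obtain \<tau>' where "l = \<tau>' @ [] @ [X]" "\<tau>' \<in> walks C w" by auto
    then have "face_part l = [] @ [X]" using parts(2)[of \<tau>' "[]"] by simp
    then show False using fp \<sigma>(3) by simp
  qed
  ultimately show "l \<in> {l \<in> total - bare. face_part l = \<sigma> @ [X]}" by blast
qed

lemma acyclic_chains: "acyclic (total - bare)"
proof (rule acyclicI_fibres[where key = face_part and rk = length])
  show conv: "convex (total - bare)" by (rule convex_quotient[OF convex_total subcomplex_bare])
  have mono: "face_part b = face_part a \<or> length (face_part b) < length (face_part a)"
    if "b \<in> keys (list_bd (tope_between (topes L)) a)" for a b
    unfolding face_part_def using that by (rule filter_face)
  then show "face_part b = face_part a \<or> length (face_part b) < length (face_part a)"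
    if "b \<in> keys (list_bd (tope_between (topes L)) a)" for a b using that .
  fix k
  have convk: "convex {l \<in> total - bare. face_part l = k}"
    using conv mono by (rule convex_fibre)
  show "acyclic {l \<in> total - bare. face_part l = k}"
  proof (cases "{l \<in> total - bare. face_part l = k} = {}")
    case False
    then obtain l where l: "l \<in> total" "l \<notin> bare" "face_part l = k" by blast
    obtain \<tau> \<sigma> where *: "l = \<tau> @ \<sigma> @ [X]" "\<tau> \<in> walks C w" "desc \<sigma>" "set \<sigma> \<subseteq> cut X C (first_step \<tau>)" "face_part l = \<sigma> @ [X]"
      using l(1) by (rule totalE)
    have k: "k = \<sigma> @ [X]" using * l by simp
    have \<sigma>iv: "set \<sigma> \<subseteq> iv X C" using *(4) cut_subset[of X C "first_step \<tau>"] by blast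
    have \<sigma>0: "\<sigma> \<noteq> []" using * l(2) by auto
    have Y: "hd \<sigma> \<in> iv X C" using \<sigma>iv \<sigma>0 by (cases \<sigma>) auto
    \<comment> \<open>Gates are taken with respect to the top covector of the chain, whose admission
      decides that of the whole chain.\<close>
    interpret G: gated E L C w X "hd \<sigma>"
      by unfold_locales (use Y in \<open>auto simp: iv_def\<close>)
    have eq: "{l \<in> total - bare. face_part l = k} = G.gated_lists (\<sigma> @ [X])"
      unfolding k gated_fibre[OF *(3) \<sigma>iv \<sigma>0] G.gated_lists_def G.crossed_def by simp
    show ?thesis
      unfolding eq
    proof (rule G.acyclic_gated)
      show "convex (G.gated_lists (\<sigma> @ [X]))" using convk eq by simp
      show "set (\<sigma> @ [X]) \<inter> topes L = {}" using suffix_not_tope[OF *(4)] by blast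
      have "X \<notin> set \<sigma>" using \<sigma>iv by (auto simp: iv_def)
      then have "distinct_adj (\<sigma> @ [X])"
        using desc_distinct_adj[OF *(3)] last_in_set[of \<sigma>] by (auto simp: distinct_adj_append_iff)
      moreover have "C \<noteq> hd (\<sigma> @ [X])" using Y \<sigma>0 by (auto simp: iv_def)
      ultimately show "distinct_adj (C # \<sigma> @ [X])" by (simp add: distinct_adj_Cons)
    qed simp
  qed (simp only: acyclic_empty)
qed

definition CX :: "'a \<Rightarrow> int" where
  "CX = opp X C"

lemma CX_tope: "CX \<in> topes L"
  unfolding CX_def by (rule tope_opp[OF X_in_L C_tope])

lemma sep_CX: "e \<in> sep C CX \<longleftrightarrow> e \<in> E \<and> X e = 0"
  using tope_zero_iff[OF C_tope, of e] covector_leD[OF covector_less_imp_le[OF X_less], of e]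
  by (cases "X e = 0") (auto simp: sep_iff CX_def opp_apply)

lemma cut_CX: "cut X C CX = iv X C"
proof
  show "iv X C \<subseteq> cut X C CX"
  proof
    fix Z assume Z: "Z \<in> iv X C"
    then have less: "covector_less X Z" "covector_less Z C" by (auto simp: iv_def)
    obtain e where e: "Z e = 0" "C e \<noteq> 0" using less(2) by (rule covector_lessE)
    have "X e = 0" using covector_leD0[OF covector_less_imp_le[OF less(1)] e(1)] .
    then have "e \<in> sep C CX" using e(2) in_ground[OF C_in_L] by (simp add: sep_CX)
    then show "Z \<in> cut X C CX" using Z e(1) by (auto simp: cut_def)
  qed
qed (rule cut_subset)

abbreviation "turning \<equiv> {\<tau> \<in> walks C w. first_step \<tau> = CX}"

lemma turning_total: "chs X (\<lambda>_. iv X C) turning = {l \<in> total. first_step (walk_part l) = CX}"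
proof (intro equalityI subsetI)
  fix l assume "l \<in> chs X (\<lambda>_. iv X C) turning"
  then obtain \<tau> \<sigma> where *: "\<tau> \<in> walks C w" "first_step \<tau> = CX" "l = \<tau> @ \<sigma> @ [X]" "desc \<sigma>" "set \<sigma> \<subseteq> iv X C"
    by (auto simp: chs_def elim!: chE)
  have sub: "set \<sigma> \<subseteq> cut X C (first_step \<tau>)" using *(2,5) cut_CX by simp
  have "walk_part l = \<tau>" unfolding *(3) by (rule parts[OF *(1) sub])
  then show "l \<in> {l \<in> total. first_step (walk_part l) = CX}"
    using totalI[OF *(1,4) sub] *(2,3) by simp
next
  fix l assume "l \<in> {l \<in> total. first_step (walk_part l) = CX}"
  then have l: "l \<in> total" "first_step (walk_part l) = CX" by auto
  obtain \<tau> \<sigma> where *: "l = \<tau> @ \<sigma> @ [X]" "\<tau> \<in> walks C w" "desc \<sigma>" "set \<sigma> \<subseteq> cut X C (first_step \<tau>)" "walk_part l = \<tau>"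
    using l(1) by (rule totalE)
  then have "l \<in> ch X (iv X C) \<tau>" using l(2) cut_CX by (auto intro: chI)
  then show "l \<in> chs X (\<lambda>_. iv X C) turning" using * l(2) by (auto simp: chs_def)
qed

text \<open>Removing a tope can only enlarge the separation of \<open>C\<close> from the first step,
  and for \<open>CX\<close> it is already the whole zero set of \<open>X\<close>. A tope above
  \<open>X\<close> that is separated from \<open>C\<close> on all of this set is \<open>CX\<close>
  again.\<close>

lemma subcomplex_turning: "subcomplex (chs X (\<lambda>_. iv X C) turning) total"
  unfolding turning_total subcomplex_def
proof (intro conjI subsetI ballI)
  fix a l assume a: "a \<in> {l \<in> total. first_step (walk_part l) = CX}"
    and l: "l \<in> keys (list_bd (tope_between (topes L)) a) \<inter> total"
  then have aT: "a \<in> total" "first_step (walk_part a) = CX" and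
    l1: "l \<in> keys (list_bd (tope_between (topes L)) a)" and lT: "l \<in> total" by auto
  obtain \<tau> \<sigma> where *: "a = \<tau> @ \<sigma> @ [X]" "\<tau> \<in> walks C w" "desc \<sigma>" "set \<sigma> \<subseteq> cut X C (first_step \<tau>)" "walk_part a = \<tau>"
    using aT(1) by (rule totalE)
  have fs: "first_step \<tau> = CX" using aT(2) *(5) by simp
  obtain \<tau>' \<sigma>' where **: "l = \<tau>' @ \<sigma>' @ [X]" "\<tau>' \<in> walks C w" "walk_part l = \<tau>'"
    using lT by (rule totalE)
  have "first_step \<tau>' = CX"
  proof (rule total_face[OF *(2,4) l1[unfolded *(1)]])
    fix u a b c v
    assume w: "\<tau> = u @ a # b # c # v" "l = (u @ a # c # v) @ \<sigma> @ [X]" "\<And>e. b e = a e \<or> b e = c e"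
    have w': "u @ a # c # v \<in> walks C w" using walks_delete[of u a b c v C w] w *(2) by simp
    have \<tau>': "\<tau>' = u @ a # c # v" using parts(1)[OF w' *(4)] w(2) **(3) by simp
    have sub: "sep C CX \<subseteq> sep C (first_step \<tau>')"
      using sep_first_step_mono[of u a b c v] w *(2) fs \<tau>' by simp
    note ff = first_step_facts[OF **(2)]
    show "first_step \<tau>' = CX"
    proof
      fix e
      show "first_step \<tau>' e = CX e"
      proof (cases "X e = 0")
        case True
        show ?thesis
        proof (cases "e \<in> E")
          case eE: True
          then have "e \<in> sep C CX" using True by (simp add: sep_CX)
          then have "e \<in> sep C (first_step \<tau>')" using sub by blast
          then show ?thesis using True by (simp add: sep_iff CX_def opp_apply)
        next
          case False
          then show ?thesis using tope_zero_iff[OF ff(1), of e] tope_zero_iff[OF CX_tope, of e] by simp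
        qed
      next
        case False
        then show ?thesis using covector_leD[OF ff(3) False] by (simp add: CX_def opp_apply)
      qed
    qed
  next
    fix \<sigma>1 b \<sigma>2 assume s: "\<sigma> = \<sigma>1 @ b # \<sigma>2" "l = \<tau> @ (\<sigma>1 @ \<sigma>2) @ [X]"
    have "set (\<sigma>1 @ \<sigma>2) \<subseteq> cut X C (first_step \<tau>)" using *(4) s(1) by auto
    then have "walk_part (\<tau> @ (\<sigma>1 @ \<sigma>2) @ [X]) = \<tau>" by (rule parts(1)[OF *(2)])
    then have "\<tau>' = \<tau>" using s(2) **(3) by simp
    then show "first_step \<tau>' = CX" using fs by simp
  qed
  then show "l \<in> {l \<in> total. first_step (walk_part l) = CX}" using lT **(3) by simp
qed auto

text \<open>Over a fixed walk the chains form the order complex of the faces of \<open>C\<close>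
  visible from the first step, which is neither \<open>C\<close> nor the antipode \<open>CX\<close>;
  \<open>acyclic_cut\<close> applies to it.\<close>

lemma acyclic_not_turning: "acyclic (total - chs X (\<lambda>_. iv X C) turning)"
proof -
  let ?R = "{\<tau> \<in> walks C w. first_step \<tau> \<noteq> CX}"
  let ?\<Lambda> = "\<lambda>\<tau>. cut X C (first_step \<tau>)"
  have eq: "total - chs X (\<lambda>_. iv X C) turning = chs X ?\<Lambda> ?R"
    unfolding turning_total
  proof (intro equalityI subsetI)
    fix l assume "l \<in> total - {l \<in> total. first_step (walk_part l) = CX}"
    then have l: "l \<in> total" "first_step (walk_part l) \<noteq> CX" by auto
    obtain \<tau> \<sigma> where *: "l = \<tau> @ \<sigma> @ [X]" "\<tau> \<in> walks C w" "desc \<sigma>" "set \<sigma> \<subseteq> cut X C (first_step \<tau>)" "walk_part l = \<tau>"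
      using l(1) by (rule totalE)
    then have "l \<in> ch X (?\<Lambda> \<tau>) \<tau>" by (auto intro: chI)
    then show "l \<in> chs X ?\<Lambda> ?R" using * l(2) by (auto simp: chs_def)
  next
    fix l assume "l \<in> chs X ?\<Lambda> ?R"
    then obtain \<tau> \<sigma> where *: "\<tau> \<in> walks C w" "first_step \<tau> \<noteq> CX" "l = \<tau> @ \<sigma> @ [X]" "desc \<sigma>" "set \<sigma> \<subseteq> ?\<Lambda> \<tau>"
      by (auto simp: chs_def elim!: chE)
    have "walk_part l = \<tau>" unfolding *(3) by (rule parts[OF *(1,5)])
    then show "l \<in> total - {l \<in> total. first_step (walk_part l) = CX}"
      using totalI[OF *(1,4,5)] *(2,3) by simp
  qed
  show ?thesis
    unfolding eq
  proof (rule acyclic_chs[where \<Gamma> = "iv X C"])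
    show "convex (chs X ?\<Lambda> ?R)"
      using convex_quotient[OF convex_total subcomplex_turning] eq by simp
    fix \<tau> assume \<tau>: "\<tau> \<in> ?R"
    then have \<tau>w: "\<tau> \<in> walks C w" by simp
    note ff = first_step_facts[OF \<tau>w]
    show "ch_ok X (iv X C) \<tau>" using \<tau>w by (rule ch_ok_walk)
    show "acyclic (ch X (?\<Lambda> \<tau>) \<tau>)"
    proof (rule acyclic_cut[OF X_in_L C_in_L tope_in_L[OF ff(1)] X_less ff(3)])
      show "first_step \<tau> e = 0 \<longleftrightarrow> C e = 0" for e
        using tope_zero_iff[OF ff(1), of e] tope_zero_iff[OF C_tope, of e] by simp
      show "first_step \<tau> \<noteq> opp X C" using \<tau> by (simp add: CX_def)
    qed (rule ff(2), rule ch_ok_walk[OF \<tau>w])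
  qed (rule cut_subset)
qed

text \<open>Both subcomplexes of \<open>total\<close> have acyclic quotients, so the generator is
  extended from the turning walks to \<open>total\<close> and then restricted to the bare ones.
  Stripping the final \<open>X\<close> accounts for the degree \<open>Suc m\<close>.\<close>

lemma hgen_walks_if_turning:
  assumes "hgen (chs X (\<lambda>_. iv X C) turning) (Suc m) z"
  shows "\<exists>z'. hgen (walks C w) m z' \<and> (z' = 0 \<longleftrightarrow> z = 0)"
proof -
  have "hgen total (Suc m) z"
    by (rule hgen_extend[OF convex_total subcomplex_turning acyclic_not_turning assms])
  then obtain z1 where z1: "hgen bare (m + length [X]) z1" "z1 = 0 \<longleftrightarrow> z = 0"
    using hgen_restrict[OF convex_total subcomplex_bare acyclic_chains] by (metis One_nat_def add.right_neutral add_Suc_right length_Cons list.size(3))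
  have "\<tau> \<noteq> [] \<and> last \<tau> = C \<and> distinct_adj (\<tau> @ [X])" if "\<tau> \<in> walks C w" for \<tau>
    using that X_less by (auto simp: walks_def distinct_adj_append_iff)
  then show ?thesis
    using hgen_append_iff[of "walks C w" C "[X]" m "z = 0"] z1 by blast
qed

text \<open>A step from \<open>CX\<close> to \<open>C\<close> crosses the whole zero set of
  \<open>X\<close>, hence also \<open>e\<close>, which no walk may cross. There are no turning
  walks, and the empty complex has generator zero.\<close>

lemma acyclic_walks:
  assumes "e \<in> E" "X e = 0" "w e = 0"
  shows "acyclic (walks C w)"
proof -
  have "turning = {}"
  proof (rule ccontr)
    assume "turning \<noteq> {}"
    then obtain \<tau> where \<tau>: "\<tau> \<in> walks C w" "first_step \<tau> = CX" by auto
    obtain u a where ua: "\<tau> = u @ [a, C]" using \<tau>(1) by (rule walk_last)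
    then have a: "a = CX" using \<tau>(2) by simp
    have "e \<in> sep C CX" using assms by (simp add: sep_CX)
    then have "e \<in> sep CX C" by (auto simp: sep_iff)
    then have "crossing_vector \<tau> e \<noteq> 0"
      by (simp add: ua a crossing_vector_append[of u CX "[C]"] crossing_vector_Cons)
    then show False using \<tau>(1) assms(3) by (auto simp: walks_def)
  qed
  then have "chs X (\<lambda>_. iv X C) turning = {}" unfolding chs_def by (simp only: UN_empty)
  then have "hgen (chs X (\<lambda>_. iv X C) turning) (Suc 0) 0"
    using acyclic_iff_hgen[of "{}" "Suc 0"] by simp
  then obtain z' where "hgen (walks C w) 0 z'" "z' = 0" using hgen_walks_if_turning by blast
  then show ?thesis using acyclic_iff_hgen by blast
qed

text \<open>Turning walks are the walks to \<open>CX\<close> with \<open>C\<close> appended, and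
  \<open>sphere\<close> replaces the chains behind them by the single chain \<open>p\<close>. So the
  complex becomes that of the walks to \<open>CX\<close> with a fixed suffix.\<close>

lemma hgen_walks:
  assumes pos: "\<And>e. e \<in> E \<Longrightarrow> X e = 0 \<Longrightarrow> w e \<noteq> 0"
    and w': "\<And>e. w e = w' e + (if e \<in> E \<and> X e = 0 then 1 else 0)"
    and z: "hgen (walks CX w') n z"
  shows "\<exists>z'. hgen (walks C w) (n + rank (zero_set E X)) z' \<and> (z' = 0 \<longleftrightarrow> z = 0)"
proof -
  have CXC: "CX \<noteq> C"
  proof
    assume eq: "CX = C"
    obtain e where e: "X e = 0" "C e \<noteq> 0" using X_less by (rule covector_lessE)
    then have "e \<in> sep C CX" using in_ground[OF C_in_L] by (simp add: sep_CX)
    then show False by (simp add: eq sep_iff)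
  qed
  have ind: "(indicator (sep CX C) e :: nat) = (if e \<in> E \<and> X e = 0 then 1 else 0)" for e
    using sep_CX[of e] by (auto simp: sep_iff indicator_def)
  have cv: "crossing_vector (u @ [CX, C]) e = crossing_vector (u @ [CX]) e + (if e \<in> E \<and> X e = 0 then 1 else 0)" for u e
    by (simp add: crossing_vector_append[of u CX "[C]"] crossing_vector_Cons ind)
  \<comment> \<open>The step from \<open>CX\<close> to \<open>C\<close> crosses every coordinate of
    the zero set of \<open>X\<close> exactly once, which is the difference of \<open>w\<close> and
    \<open>w'\<close>.\<close>
  have turning: "turning = (\<lambda>q. q @ [C]) ` walks CX w'"
  proof (intro equalityI subsetI)
    fix \<tau> assume "\<tau> \<in> turning"
    then have \<tau>: "\<tau> \<in> walks C w" "first_step \<tau> = CX" by auto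
    obtain u a where ua: "\<tau> = u @ [a, C]" using \<tau>(1) by (rule walk_last)
    then have a: "a = CX" using \<tau>(2) by simp
    have "crossing_vector (u @ [CX]) e = w' e" for e
      using cv[of u e] w'[of e] \<tau>(1) by (auto simp: walks_def ua a)
    then have "u @ [CX] \<in> walks CX w'"
      using \<tau>(1) by (auto simp: walks_def ua a distinct_adj_append_iff)
    then have "(u @ [CX]) @ [C] \<in> (\<lambda>q. q @ [C]) ` walks CX w'" by (rule imageI)
    then show "\<tau> \<in> (\<lambda>q. q @ [C]) ` walks CX w'" by (simp add: ua a)
  next
    fix \<tau> assume "\<tau> \<in> (\<lambda>q. q @ [C]) ` walks CX w'"
    then obtain q where q: "\<tau> = q @ [C]" "q \<in> walks CX w'" by auto
    then obtain u where u: "q = u @ [CX]" by (cases q rule: rev_cases) (auto simp: walks_def)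
    have "crossing_vector (u @ [CX, C]) e = w e" for e
      using cv[of u e] w'[of e] q(2) by (auto simp: walks_def u)
    then show "\<tau> \<in> turning"
      using q C_tope CX_tope CXC by (auto simp: walks_def u distinct_adj_append_iff)
  qed
  have conv: "convex (chs X (\<lambda>_. iv X C) turning)"
    using convex_subcomplex[OF convex_total subcomplex_turning] .
  have ok: "ch_ok X (iv X C) \<tau>" if "\<tau> \<in> turning" for \<tau> using ch_ok_walk that by simp
  obtain p where p: "desc p" "set p \<subseteq> iv X C" "length p + Suc (rank (zero_set E C)) = rank (zero_set E X)"
      "\<And>k z. hgen ((\<lambda>\<rho>. \<rho> @ p @ [X]) ` turning) k z \<Longrightarrow>
        \<exists>z'. hgen (chs X (\<lambda>_. iv X C) turning) k z' \<and> (z' = 0 \<longleftrightarrow> z = 0)"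
  proof (rule sphere[OF X_in_L C_in_L X_less _ conv])
    show "ch_ok X (iv X C) \<rho>" if "\<rho> \<in> turning" for \<rho> using that by (rule ok)
  qed (rule that)
  let ?s = "C # p @ [X]"
  have "zero_set E C = {}" using tope_zero_iff[OF C_tope] by (auto simp: zero_set_def)
  \<comment> \<open>The suffix has one entry more than the rank: \<open>C\<close>, the rank minus
    one covectors of \<open>p\<close>, and \<open>X\<close>. The surplus one is taken off again
    together with \<open>X\<close>.\<close>
  then have len: "n + length ?s = Suc (n + rank (zero_set E X))" using p(3) rank_empty by simp
  have "distinct_adj ?s"
  proof -
    have Xp: "X \<notin> set p" using p(2) by (auto simp: iv_def)
    then have "distinct_adj (p @ [X])"
      using desc_distinct_adj[OF p(1)] last_in_set[of p] by (auto simp: distinct_adj_append_iff)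
    moreover have "C \<noteq> hd (p @ [X])" using p(2) X_less by (cases p) (auto simp: iv_def)
    ultimately show ?thesis by (simp add: distinct_adj_Cons)
  qed
  then have adj: "q \<noteq> [] \<and> last q = CX \<and> distinct_adj (q @ ?s)" if "q \<in> walks CX w'" for q
    using that CXC by (auto simp: walks_def distinct_adj_append_iff)
  have im: "(\<lambda>q. q @ ?s) ` walks CX w' = (\<lambda>\<rho>. \<rho> @ p @ [X]) ` turning"
    unfolding turning image_image by simp
  obtain z1 where z1: "hgen ((\<lambda>q. q @ ?s) ` walks CX w') (n + length ?s) z1" "z1 = 0 \<longleftrightarrow> z = 0"
    using hgen_append_iff[of "walks CX w'" CX ?s n "z = 0", OF adj] z by blast
  obtain z2 where z2: "hgen (chs X (\<lambda>_. iv X C) turning) (Suc (n + rank (zero_set E X))) z2" "z2 = 0 \<longleftrightarrow> z1 = 0"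
    using p(4) z1(1) unfolding im len by blast
  show ?thesis using hgen_walks_if_turning[OF z2(1)] z2(2) z1(2) by simp
qed

end

section \<open>Induction on the crossing vector\<close>

context simple_oriented_matroid
begin

lemma walks_zero: "C \<in> topes L \<Longrightarrow> walks C (\<lambda>_. 0) = {[C]}"
proof (intro equalityI subsetI)
  fix \<tau> assume C: "C \<in> topes L" and \<tau>: "\<tau> \<in> walks C (\<lambda>_. 0)"
  have all: "T = C" if "T \<in> set \<tau>" for T
    using walks_agree[OF \<tau> that] by auto
  have \<tau>': "\<tau> \<noteq> []" "distinct_adj \<tau>" using \<tau> by (auto simp: walks_def)
  obtain a l where l: "\<tau> = a # l" using \<tau>' by (cases \<tau>) auto
  have "l = []" using all \<tau>' l by (cases l) auto
  then show "\<tau> \<in> {[C]}" using all l by simp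
qed (simp add: walks_def)

lemma hgen_point:
  assumes "S = {l}"
  shows "hgen S (length l) (frag_of l)"
proof -
  have r0: "rbd S c = 0" if c: "keys c \<subseteq> S" for c
  proof (rule ccontr)
    assume "rbd S c \<noteq> 0"
    then obtain b where "b \<in> keys (rbd S c)" by fastforce
    then obtain a where "a \<in> keys c" "b \<in> keys (list_bd (tope_between (topes L)) a)" "b \<in> S" by (rule keys_rbdE)
    then have "l \<in> keys (list_bd (tope_between (topes L)) l)" using c assms by auto
    then have "length l = Suc (length l)" by (rule deg_bd)
    then show False by simp
  qed
  have c_eq: "c = frag_cmul (Poly_Mapping.lookup c l) (frag_of l)" if "keys c \<subseteq> S" for c
    using that assms by (intro poly_mapping_eqI) (auto simp: in_keys_iff)
  show ?thesis
    unfolding hgen_def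
  proof (intro conjI allI impI)
    show "keys (frag_of l) \<subseteq> S \<inter> {b. length b = length l}" using assms by simp
    show "rbd S (frag_of l) = 0" using assms by (intro r0) simp
    show "\<exists>m d. keys d \<subseteq> S \<and> c = frag_cmul m (frag_of l) + rbd S d" if "keys c \<subseteq> S" for c
      using c_eq[OF that] by (intro exI[of _ "Poly_Mapping.lookup c l"] exI[of _ 0]) simp
    show "frag_cmul m (frag_of l) = 0" if "keys d \<subseteq> S" "rbd S d = frag_cmul m (frag_of l)" for m d
      using r0[OF that(1)] that(2) by simp
  qed
qed

text \<open>The composition of two faces of \<open>C\<close> is a face of \<open>C\<close> that
  vanishes where both do. So a suitable face of largest support lies above all the others.\<close>

lemma exists_face:
  assumes C: "C \<in> topes L"
  shows "\<exists>X\<in>L. covector_le X C \<and> (\<forall>e. w e \<noteq> (0 :: nat) \<longrightarrow> X e = 0) \<and>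
    (\<forall>Y\<in>L. covector_le Y C \<longrightarrow> (\<forall>e. w e \<noteq> 0 \<longrightarrow> Y e = 0) \<longrightarrow> covector_le Y X)"
proof -
  define P where "P Y \<longleftrightarrow> Y \<in> L \<and> covector_le Y C \<and> (\<forall>e. w e \<noteq> 0 \<longrightarrow> Y e = 0)" for Y
  define s where "s Y = card {e \<in> E. Y e \<noteq> 0}" for Y :: "'a \<Rightarrow> int"
  have P0: "P (\<lambda>_. 0)" unfolding P_def using zero_covector by (auto simp: covector_le_def)
  have "s Y < Suc (card E)" for Y
    unfolding s_def using finite_ground by (intro le_imp_less_Suc card_mono) auto
  then obtain X where X: "P X" "\<And>Y. P Y \<Longrightarrow> s Y \<le> s X"
    using ex_has_greatest_nat[of P _ s "Suc (card E)", OF P0] by auto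
  have XP: "X \<in> L" "covector_le X C" "\<And>e. w e \<noteq> 0 \<Longrightarrow> X e = 0" using X(1) by (auto simp: P_def)
  have "covector_le Y X" if Y: "Y \<in> L" "covector_le Y C" "\<And>e. w e \<noteq> 0 \<Longrightarrow> Y e = 0" for Y
  proof (rule covector_leI)
    fix e assume Ye: "Y e \<noteq> 0"
    have "sv_comp X Y e = 0 \<or> sv_comp X Y e = C e" for e
      using covector_leD[OF XP(2), of e] covector_leD[OF Y(2), of e] by (auto simp: sv_comp_def)
    then have "covector_le (sv_comp X Y) C" by (auto simp: covector_le_def)
    then have "P (sv_comp X Y)"
      unfolding P_def using comp_closed[OF XP(1) Y(1)] XP(3) Y(3) by (auto simp: sv_comp_def)
    then have le: "s (sv_comp X Y) \<le> s X" by (rule X(2))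
    have "X e \<noteq> 0"
    proof
      assume Xe: "X e = 0"
      have "{e \<in> E. X e \<noteq> 0} \<subset> {e \<in> E. sv_comp X Y e \<noteq> 0}"
        using Xe Ye in_ground[OF Y(1) Ye] by (auto simp: sv_comp_def)
      then have "s X < s (sv_comp X Y)" unfolding s_def using finite_ground by (intro psubset_card_mono) auto
      then show False using le by simp
    qed
    then show "Y e = X e" using covector_leD[OF XP(2), of e] covector_leD[OF Y(2) Ye] by simp
  qed
  with XP show ?thesis by (intro bexI[of _ X] conjI ballI impI allI) auto
qed

lemma finite_levels: "finite {j. j \<ge> 1 \<and> upper_level E w j \<noteq> {}}"
proof (rule finite_subset)
  show "{j. j \<ge> 1 \<and> upper_level E w j \<noteq> {}} \<subseteq> (\<Union>e\<in>E. {..w e})" by (auto simp: upper_level_def)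
qed (use finite_ground in auto)

lemma kappa_shift:
  assumes U: "upper_level E w 1 \<noteq> {}" and w': "\<And>j. j \<ge> 1 \<Longrightarrow> upper_level E w (Suc j) = upper_level E w' j"
  shows "kappa E L w = rank (upper_level E w 1) + kappa E L w'"
proof -
  let ?J = "\<lambda>w. {j. j \<ge> 1 \<and> upper_level E w j \<noteq> {}}"
  have J: "?J w = insert 1 (Suc ` ?J w')"
  proof (intro equalityI subsetI)
    fix j assume j: "j \<in> ?J w"
    show "j \<in> insert 1 (Suc ` ?J w')"
    proof (cases "j = 1")
      case False
      then obtain i where "j = Suc i" "i \<ge> 1" using j by (cases j) auto
      then show ?thesis using j w'[of i] by auto
    qed simp
  qed (use U w' in auto)
  have "kappa E L w = (\<Sum>j\<in>insert 1 (Suc ` ?J w'). rank (upper_level E w j))"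
    unfolding kappa_def J ..
  also have "\<dots> = rank (upper_level E w 1) + (\<Sum>j\<in>Suc ` ?J w'. rank (upper_level E w j))"
    using finite_levels[of w'] by (subst sum.insert) auto
  also have "(\<Sum>j\<in>Suc ` ?J w'. rank (upper_level E w j)) = (\<Sum>j\<in>?J w'. rank (upper_level E w (Suc j)))"
    by (subst sum.reindex) auto
  also have "\<dots> = kappa E L w'" unfolding kappa_def by (rule sum.cong) (auto simp: w')
  finally show ?thesis .
qed

text \<open>The induction changes the tope: subtracting the lowest level of \<open>w\<close>
  replaces \<open>C\<close> by its antipode \<open>CX\<close>. So the statement is proved for all
  topes together, and admissibility has to be carried across the antipode.\<close>

theorem walks_homology:
  assumes "C \<in> topes L" "\<And>e. e \<notin> E \<Longrightarrow> w e = 0"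
  shows "\<exists>z. hgen (walks C w) (Suc (kappa E L w)) z \<and> (z = 0 \<longleftrightarrow> \<not> admissible E L w C)"
  using assms
proof (induction "\<Sum>e\<in>E. w e" arbitrary: C w rule: less_induct)
  case less
  note C = less.prems(1) and wE = less.prems(2)
  show ?case
  proof (cases "\<forall>e. w e = 0")
    case True
    then have w0: "w = (\<lambda>_. 0)" by auto
    have U: "upper_level E w j = {}" if "j \<ge> 1" for j using that by (auto simp: upper_level_def w0)
    have S0: "{j. j \<ge> 1 \<and> upper_level E w j \<noteq> {}} = {}" using U by blast
    have "kappa E L w = 0" unfolding kappa_def S0 by simp
    moreover have "admissible E L w C" using U by (auto simp: admissible_def)
    moreover have "hgen (walks C w) (length [C]) (frag_of [C])"
      by (rule hgen_point) (simp add: w0 walks_zero[OF C])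
    ultimately show ?thesis by (intro exI[of _ "frag_of [C]"]) auto
  next
    case False
    then obtain e0 where e0: "w e0 \<noteq> 0" by auto
    then have e0E: "e0 \<in> E" using wE[of e0] by auto
    obtain X where X': "X \<in> L" "covector_le X C" "\<forall>e. w e \<noteq> 0 \<longrightarrow> X e = 0"
      "\<forall>Y\<in>L. covector_le Y C \<longrightarrow> (\<forall>e. w e \<noteq> 0 \<longrightarrow> Y e = 0) \<longrightarrow> covector_le Y X"
      using exists_face[OF C, of w] by blast
    have X: "X \<in> L" "covector_le X C" "w e \<noteq> 0 \<Longrightarrow> X e = 0" for e using X' by blast+
    have X_max: "covector_le Y X" if "Y \<in> L" "covector_le Y C" "\<And>e. w e \<noteq> 0 \<Longrightarrow> Y e = 0" for Y
      using X'(4) that by blast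
    have XC: "covector_less X C"
      using X(2) X(3)[OF e0] tope_zero_iff[OF C, of e0] e0E by (intro covector_lessI[of X C e0]) auto
    interpret F: walk_face E L C w X
    proof unfold_locales
      show "covector_le Y X" if "Y \<in> L" "covector_le Y C" "\<And>e. w e \<noteq> 0 \<Longrightarrow> Y e = 0" for Y
        using that by (rule X_max)
    qed (rule C, rule X(1), rule XC, rule X(3))
    define U where "U = upper_level E w 1"
    have U: "e \<in> U \<longleftrightarrow> w e \<noteq> 0" for e
      using wE[of e] by (cases "e \<in> E") (auto simp: U_def upper_level_def)
    have U0: "upper_level E w 1 \<noteq> {}" using e0 U by (auto simp: U_def)
    show ?thesis
    proof (cases "\<exists>e\<in>E. X e = 0 \<and> w e = 0")
      case True
      then obtain e1 where e1: "e1 \<in> E" "X e1 = 0" "w e1 = 0" by blast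
      have "acyclic (walks C w)" using e1 by (rule F.acyclic_walks)
      \<comment> \<open>A zero generator may be placed in any degree.\<close>
      then have h0: "hgen (walks C w) (Suc (kappa E L w)) 0" by (rule acyclic_iff_hgen[THEN iffD1])
      \<comment> \<open>Admissibility would make \<open>zero_on C U\<close> a face of
        \<open>C\<close> that vanishes only on the support of \<open>w\<close>; being below
        \<open>X\<close>, it would vanish at \<open>e1\<close> too.\<close>
      have na: "\<not> admissible E L w C"
      proof
        assume "admissible E L w C"
        then have Z: "zero_on C U \<in> L" using U0 by (auto simp: admissible_def U_def)
        have "covector_le (zero_on C U) X"
        proof (rule X_max[OF Z])
          show "covector_le (zero_on C U) C" by (auto simp: covector_le_def zero_on_def)
          show "zero_on C U e = 0" if "w e \<noteq> 0" for e using that U by (simp add: zero_on_def)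
        qed
        then have "zero_on C U e1 = 0" using e1(2) by (rule covector_leD0)
        moreover have "e1 \<notin> U" using e1(3) U by simp
        ultimately have "C e1 = 0" by (simp add: zero_on_def)
        then show False using tope_zero_iff[OF C, of e1] e1(1) by simp
      qed
      show ?thesis
      proof (intro exI conjI)
        show "hgen (walks C w) (Suc (kappa E L w)) 0" by (rule h0)
      qed (simp only: na simp_thms)
    next
      case pos: False
      have pos': "w e \<noteq> 0" if e: "e \<in> E" "X e = 0" for e
      proof
        assume "w e = 0"
        then have "\<exists>e\<in>E. X e = 0 \<and> w e = 0" by (intro bexI[of _ e] conjI e)
        then show False by (rule notE[OF pos])
      qed
      have UX: "e \<in> U \<longleftrightarrow> e \<in> E \<and> X e = 0" for e
      proof
        assume "e \<in> U"
        then have "w e \<noteq> 0" by (rule U[THEN iffD1])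
        then have "X e = 0" by (rule X(3))
        moreover have "e \<in> E"
        proof (rule ccontr)
          assume "e \<notin> E"
          then have "w e = 0" by (rule wE)
          then show False by (rule notE[OF \<open>w e \<noteq> 0\<close>])
        qed
        ultimately show "e \<in> E \<and> X e = 0" by simp
      next
        assume "e \<in> E \<and> X e = 0"
        then show "e \<in> U" unfolding U by (intro pos') simp_all
      qed
      define w' where "w' e = w e - 1" for e
      have ww: "w e = w' e + (if e \<in> E \<and> X e = 0 then 1 else 0)" for e
        using U[of e] UX[of e] by (auto simp: w'_def)
      have "(\<Sum>e\<in>E. w' e) < (\<Sum>e\<in>E. w e)"
      proof (rule sum_strict_mono_ex1[OF finite_ground])
        show "\<exists>e\<in>E. w' e < w e" using e0 by (intro bexI[of _ e0] e0E) (simp add: w'_def)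
      qed (simp add: w'_def)
      then obtain z where z: "hgen (walks F.CX w') (Suc (kappa E L w')) z" "z = 0 \<longleftrightarrow> \<not> admissible E L w' F.CX"
      proof -
        have "w' e = 0" if "e \<notin> E" for e using wE[OF that] by (simp add: w'_def)
        then show ?thesis using less.hyps[OF \<open>(\<Sum>e\<in>E. w' e) < (\<Sum>e\<in>E. w e)\<close> F.CX_tope] that by metis
      qed
      have lev: "upper_level E w (Suc j) = upper_level E w' j" if "j \<ge> 1" for j
        using that by (auto simp: upper_level_def w'_def)
      have k: "kappa E L w = rank U + kappa E L w'"
        unfolding U_def using U0 lev by (rule kappa_shift)
      have XU: "zero_set E X = U" unfolding set_eq_iff zero_set_def using UX by simp
      obtain z' where z': "hgen (walks C w) (Suc (kappa E L w') + rank U) z'" "z' = 0 \<longleftrightarrow> z = 0"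
        using F.hgen_walks[OF pos' ww z(1)] unfolding XU by metis
      \<comment> \<open>Taking antipodes with respect to \<open>X\<close> exchanges the faces of
        \<open>C\<close> and of \<open>CX\<close> above \<open>X\<close> and preserves their zero
        sets.\<close>
      have refl1: "zero_on F.CX V = opp X (zero_on C V)" and refl2: "zero_on C V = opp X (zero_on F.CX V)"
        if V: "V \<subseteq> U" for V
      proof -
        have "zero_on F.CX V e = opp X (zero_on C V) e \<and> zero_on C V e = opp X (zero_on F.CX V) e" for e
        proof (cases "X e = 0")
          case True
          then show ?thesis by (auto simp: zero_on_def opp_apply F.CX_def)
        next
          case False
          then have "e \<notin> V" using V UX by auto
          then show ?thesis using False covector_leD[OF X(2) False] by (simp add: zero_on_def opp_apply F.CX_def)
        qed
        then show "zero_on F.CX V = opp X (zero_on C V)" "zero_on C V = opp X (zero_on F.CX V)" by auto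
      qed
      have equiv: "zero_on F.CX V \<in> L \<longleftrightarrow> zero_on C V \<in> L" if V: "V \<subseteq> U" for V
      proof
        assume "zero_on F.CX V \<in> L"
        then show "zero_on C V \<in> L" unfolding refl2[OF V] by (rule opp_closed[OF X(1)])
      next
        assume "zero_on C V \<in> L"
        then show "zero_on F.CX V \<in> L" unfolding refl1[OF V] by (rule opp_closed[OF X(1)])
      qed
      \<comment> \<open>The lowest level is admissible automatically here: zeroing \<open>C\<close>
        on the support of \<open>w\<close> gives \<open>X\<close>.\<close>
      have ZU: "zero_on C U = X"
      proof
        fix e
        show "zero_on C U e = X e"
          using UX[of e] covector_leD[OF X(2), of e] outside_ground[OF X(1), of e] tope_zero_iff[OF C, of e]
          by (auto simp: zero_on_def)
      qed
      have sub: "upper_level E w' j \<subseteq> U" if "j \<ge> 1" for j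
        using that U by (auto simp: upper_level_def w'_def)
      have "admissible E L w C \<longleftrightarrow> admissible E L w' F.CX"
      proof
        assume adm: "admissible E L w C"
        show "admissible E L w' F.CX"
          unfolding admissible_def
        proof (intro allI impI)
          fix j :: nat assume j: "1 \<le> j" "upper_level E w' j \<noteq> {}"
          have "zero_on C (upper_level E w (Suc j)) \<in> L"
            using adm[unfolded admissible_def, rule_format, of "Suc j"] j(2) lev[OF j(1)] by simp
          then show "zero_on F.CX (upper_level E w' j) \<in> L" using equiv[OF sub[OF j(1)]] lev[OF j(1)] by simp
        qed
      next
        assume adm: "admissible E L w' F.CX"
        show "admissible E L w C"
          unfolding admissible_def
        proof (intro allI impI)
          fix j :: nat assume j: "1 \<le> j" "upper_level E w j \<noteq> {}"
          show "zero_on C (upper_level E w j) \<in> L"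
          proof (cases "j = 1")
            case True
            then show ?thesis using ZU X(1) by (simp add: U_def)
          next
            case False
            then obtain i where i: "j = Suc i" "1 \<le> i" using j(1) by (cases j) auto
            then have "zero_on F.CX (upper_level E w' i) \<in> L"
              using adm[unfolded admissible_def, rule_format, OF i(2)] j(2) lev[OF i(2)] by simp
            then show ?thesis using equiv[OF sub[OF i(2)]] lev[OF i(2)] i(1) by simp
          qed
        qed
      qed
      then have "z' = 0 \<longleftrightarrow> \<not> admissible E L w C" using z' z by blast
      moreover have "Suc (kappa E L w') + rank U = Suc (kappa E L w)" using k by simp
      ultimately show ?thesis using z'(1) by metis
    qed
  qed
qed

end

section \<open>Magnitude homology of the tope graph\<close>

lemma subgroup_free_Abelian_groupI:
  assumes "H \<subseteq> carrier (free_Abelian_group A)" "0 \<in> H" "\<And>x y. x \<in> H \<Longrightarrow> y \<in> H \<Longrightarrow> x - y \<in> H"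
  shows "subgroup H (free_Abelian_group A)"
proof -
  have neg: "- y \<in> H" if "y \<in> H" for y using assms(3)[OF assms(2) that] by simp
  have add: "x + y \<in> H" if "x \<in> H" "y \<in> H" for x y
    using assms(3)[OF that(1) neg[OF that(2)]] by simp
  show ?thesis
  proof
    show "inv\<^bsub>free_Abelian_group A\<^esub> x \<in> H" if "x \<in> H" for x
      using neg[OF that] subsetD[OF assms(1) that] by simp
  qed (use assms(1,2) add in simp_all)
qed

text \<open>The elements \<open>z i\<close> represent a basis of the quotient: \<open>gen\<close>
  says that they generate modulo \<open>B\<close>, and \<open>ind\<close> that they are independent
  modulo \<open>B\<close>.\<close>

lemma quotient_free_Abelian_group:
  assumes Z: "Z \<subseteq> carrier (free_Abelian_group A)" "0 \<in> Z" "\<And>x y. x \<in> Z \<Longrightarrow> y \<in> Z \<Longrightarrow> x - y \<in> Z"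
    and B: "B \<subseteq> Z" "0 \<in> B" "\<And>x y. x \<in> B \<Longrightarrow> y \<in> B \<Longrightarrow> x - y \<in> B"
    and z: "\<And>f. keys f \<subseteq> I \<Longrightarrow> frag_extend z f \<in> Z"
    and gen: "\<And>c. c \<in> Z \<Longrightarrow> \<exists>f. keys f \<subseteq> I \<and> c - frag_extend z f \<in> B"
    and ind: "\<And>f. keys f \<subseteq> I \<Longrightarrow> frag_extend z f \<in> B \<Longrightarrow> f = 0"
  shows "subgroup_generated (free_Abelian_group A) Z Mod B \<cong> free_Abelian_group I"
    "group (subgroup_generated (free_Abelian_group A) Z Mod B)"
proof -
  let ?F = "free_Abelian_group A"
  define K where "K = subgroup_generated ?F Z"
  have ZF: "subgroup Z ?F" using Z by (rule subgroup_free_Abelian_groupI)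
  have carK: "carrier K = Z"
    unfolding K_def by (rule subgroup.carrier_subgroup_generated_subgroup[OF ZF])
  have multK: "x \<otimes>\<^bsub>K\<^esub> y = x + y" for x y by (simp add: K_def)
  have commK: "comm_group K"
    unfolding K_def
    by (rule group.abelian_subgroup_generated[OF group_free_Abelian_group abelian_free_Abelian_group])
  have "subgroup B ?F" using B Z(1) by (intro subgroup_free_Abelian_groupI) auto
  then have BK: "subgroup B K"
    unfolding K_def using group.subgroup_subgroup_generated_iff[OF group_free_Abelian_group, of B A Z] B(1)
      subgroup.carrier_subgroup_generated_subgroup[OF ZF] by simp
  interpret N: normal B K by (rule comm_group.subgroup_imp_normal[OF commK BK])
  have coset: "B #>\<^bsub>K\<^esub> x = (\<lambda>b. b + x) ` B" for x
    by (auto simp: r_coset_def multK)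
  have Badd: "x + y \<in> B" if "x \<in> B" "y \<in> B" for x y
    using B(3)[OF that(1) B(3)[OF B(2) that(2)]] by simp
  have coset_eq: "B #>\<^bsub>K\<^esub> x = B #>\<^bsub>K\<^esub> y \<longleftrightarrow> x - y \<in> B" for x y
  proof
    assume "B #>\<^bsub>K\<^esub> x = B #>\<^bsub>K\<^esub> y"
    then have "0 + x \<in> (\<lambda>b. b + y) ` B" unfolding coset using B(2) by blast
    then obtain b where "b \<in> B" "x = b + y" by auto
    then show "x - y \<in> B" by simp
  next
    assume xy: "x - y \<in> B"
    have "b + x \<in> (\<lambda>b. b + y) ` B" if "b \<in> B" for b
      using Badd[OF that xy] by (intro image_eqI[of _ _ "b + (x - y)"]) simp_all
    moreover have "b + y \<in> (\<lambda>b. b + x) ` B" if "b \<in> B" for b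
      using B(3)[OF that xy] by (intro image_eqI[of _ _ "b - (x - y)"]) simp_all
    ultimately show "B #>\<^bsub>K\<^esub> x = B #>\<^bsub>K\<^esub> y" unfolding coset by blast
  qed
  show "group (subgroup_generated ?F Z Mod B)" using N.factorgroup_is_group by (simp add: K_def)
  let ?h = "\<lambda>f. B #>\<^bsub>K\<^esub> frag_extend z f"
  have "?h \<in> iso (free_Abelian_group I) (K Mod B)"
  proof (rule isoI[OF homI])
    show "?h f \<in> carrier (K Mod B)" if "f \<in> carrier (free_Abelian_group I)" for f
      using that z carK by (auto simp: carrier_FactGroup)
    show "?h (f \<otimes>\<^bsub>free_Abelian_group I\<^esub> f') = ?h f \<otimes>\<^bsub>K Mod B\<^esub> ?h f'"
      if "f \<in> carrier (free_Abelian_group I)" "f' \<in> carrier (free_Abelian_group I)" for f f'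
      using that z carK by (simp add: frag_extend_add N.rcos_sum multK)
    show "bij_betw ?h (carrier (free_Abelian_group I)) (carrier (K Mod B))"
    proof (rule bij_betw_imageI)
      show "inj_on ?h (carrier (free_Abelian_group I))"
      proof (rule inj_onI)
        fix f f' assume f: "f \<in> carrier (free_Abelian_group I)" "f' \<in> carrier (free_Abelian_group I)"
          and eq: "?h f = ?h f'"
        have "frag_extend z (f - f') \<in> B" using eq by (simp add: coset_eq frag_extend_diff)
        moreover have "keys (f - f') \<subseteq> I" using f by (intro keys_diff_subset) auto
        ultimately have "f - f' = 0" by (intro ind)
        then show "f = f'" by simp
      qed
      show "?h ` carrier (free_Abelian_group I) = carrier (K Mod B)"
      proof (intro equalityI subsetI)
        fix R assume "R \<in> carrier (K Mod B)"
        then obtain c where c: "c \<in> Z" "R = B #>\<^bsub>K\<^esub> c" using carK by (auto simp: carrier_FactGroup)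
        obtain f where f: "keys f \<subseteq> I" "c - frag_extend z f \<in> B" using gen[OF c(1)] by blast
        then have "R = ?h f" using c(2) coset_eq by simp
        then show "R \<in> ?h ` carrier (free_Abelian_group I)" using f(1) by simp
      qed (use z carK in \<open>auto simp: carrier_FactGroup\<close>)
    qed
  qed
  then have "free_Abelian_group I \<cong> K Mod B" by (rule is_isoI)
  then show "subgroup_generated ?F Z Mod B \<cong> free_Abelian_group I"
    unfolding K_def by (rule group.iso_sym[OF group_free_Abelian_group])
qed

text \<open>The index set must become a subset of the carrier of \<open>G\<close>; the images of the
  basis elements under an isomorphism form such a set, in bijection with \<open>I\<close>.\<close>

lemma is_free_abelianI:
  assumes "G \<cong> free_Abelian_group I" "group G"
  shows "is_free_abelian G"
proof -
  obtain h where h: "h \<in> iso (free_Abelian_group I) G"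
    using group.iso_sym[OF assms(2,1)] by (auto simp: is_iso_def)
  then have bij: "bij_betw h (carrier (free_Abelian_group I)) (carrier G)" by (simp add: iso_def)
  define S where "S = (h \<circ> frag_of) ` I"
  have "inj_on frag_of I" by (auto simp: inj_on_def frag_of_eq)
  moreover have "inj_on h (frag_of ` I)"
    by (rule inj_on_subset[OF bij_betw_imp_inj_on[OF bij]]) auto
  ultimately have "inj_on (h \<circ> frag_of) I" by (rule comp_inj_on)
  then have "I \<approx> S" unfolding S_def by (rule inj_on_image_eqpoll_self[THEN eqpoll_sym])
  then have "free_Abelian_group I \<cong> free_Abelian_group S" by (simp add: isomorphic_free_Abelian_groups)
  then have "G \<cong> free_Abelian_group S" by (rule iso_trans[OF assms(1)])
  moreover have "S \<subseteq> carrier G" using bij by (auto simp: S_def bij_betw_def)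
  ultimately show ?thesis by (auto simp: is_free_abelian_def)
qed

context based_complex
begin

text \<open>The component of degree \<open>k\<close> of an arbitrary decomposition is again one; it
  loses the multiple of \<open>z\<close> unless \<open>z\<close> has degree
  \<open>k\<close>.\<close>

lemma hgen_homogeneous:
  assumes z: "hgen S n z" and c: "keys c \<subseteq> S \<inter> {b. deg b = k}" "rbd S c = 0"
  shows "\<exists>m d. keys d \<subseteq> S \<inter> {b. deg b = Suc k} \<and> c = frag_cmul (if n = k then m else 0) z + rbd S d"
proof -
  have "keys c \<subseteq> S" using c by auto
  then obtain m d where d: "keys d \<subseteq> S" "c = frag_cmul m z + rbd S d"
    using hgen_cycleE[OF z _ c(2)] by metis
  have "c = restrict_frag {b. deg b = k} c" using c by (intro restrict_frag_id[symmetric]) auto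
  also have "\<dots> = frag_cmul m (restrict_frag {b. deg b = k} z) + rbd S (restrict_frag {b. deg b = Suc k} d)"
    by (subst d(2)) (simp add: restrict_frag_add restrict_frag_cmul restrict_rbd_deg)
  also have "restrict_frag {b. deg b = k} z = frag_cmul (if n = k then 1 else 0) z"
  proof -
    have kz: "keys z \<subseteq> {b. deg b = n}" using z by (auto simp: hgen_def)
    show ?thesis
    proof (cases "n = k")
      case True
      then show ?thesis using kz by (simp add: restrict_frag_id)
    next
      case False
      then have "keys z \<inter> {b. deg b = k} = {}" using kz by auto
      then show ?thesis using False by (simp add: restrict_frag_eq_0)
    qed
  qed
  finally have "c = frag_cmul (if n = k then m else 0) z + rbd S (restrict_frag {b. deg b = Suc k} d)" by simp
  then show ?thesis using d(1) by (intro exI[of _ m] exI[of _ "restrict_frag {b. deg b = Suc k} d"]) auto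
qed

end

section \<open>Distances in the tope graph and the magnitude complex\<close>

context simple_oriented_matroid
begin

text \<open>Simplicity enters here: the coordinates flipped by crossing a facet are parallel, so
  there is only one, and the reflected tope is adjacent in the tope graph.\<close>

lemma tope_neighbour:
  assumes B: "B \<in> topes L" and C: "C \<in> topes L" and neq: "B \<noteq> C"
  obtains B' e where "tope_adj L B B'" "B' \<in> topes L" "e \<in> sep B C" "sep B' C = sep B C - {e}"
proof -
  have zero: "B e = 0 \<longleftrightarrow> C e = 0" for e using tope_zero_iff[OF B, of e] tope_zero_iff[OF C, of e] by simp
  obtain W where cov: "covered W B" and off: "\<forall>f. C f = B f \<longrightarrow> W f = B f"
    by (rule neighbour[OF tope_in_L[OF B] tope_in_L[OF C] zero neq]) (intro that allI impI)
  define G where "G = {e. W e = 0 \<and> B e \<noteq> 0}"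
  define B' where "B' = opp W B"
  note R = reflection[OF tope_in_L[OF B] tope_in_L[OF C] zero cov off, folded G_def B'_def]
  have W: "W \<in> L" "covector_less W B" using cov by (auto simp: covered_def)
  obtain e where e: "e \<in> G" using R(3) by auto
  \<comment> \<open>Independence of \<open>{e, f}\<close> gives a covector that vanishes at
    \<open>f\<close> but not at \<open>e\<close>, against \<open>parallel\<close>.\<close>
  have "f = e" if f: "f \<in> G" for f
  proof (rule ccontr)
    assume fe: "f \<noteq> e"
    have We: "W e = 0" "B e \<noteq> 0" "W f = 0" "B f \<noteq> 0" using e f by (simp_all add: G_def)
    have eE: "e \<in> E" by (rule in_ground[OF tope_in_L[OF B] We(2)])
    have fE: "f \<in> E" by (rule in_ground[OF tope_in_L[OF B] We(4)])
    have "indep {e, f}" by (rule bspec[OF bspec[OF simple[unfolded simple_om_def] eE] fE])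
    then have "e \<notin> cl ({e, f} - {e})" unfolding matroid_indep_def by blast
    moreover have "{e, f} - {e} = {f}" using fe by blast
    ultimately have "e \<notin> cl {f}" by (simp only: simp_thms)
    then have "\<not> (\<forall>Y\<in>L. (\<forall>a\<in>{f}. Y a = 0) \<longrightarrow> Y e = 0)"
      using closure_iff[of "{f}" e] eE fE by simp
    then obtain Y where Y: "Y \<in> L" "Y f = 0" "Y e \<noteq> 0" by auto
    have BY: "Y x = 0" if "B x = 0" for x
      using that tope_zero_iff[OF B, of x] outside_ground[OF Y(1), of x] by simp
    have "Y e = 0" by (rule parallel[OF cov Y(1) BY We(3,4) Y(2) We(1,2)])
    then show False using Y(3) by simp
  qed
  with e have G: "G = {e}" by blast
  have B': "B' \<in> topes L" unfolding B'_def by (rule tope_opp[OF W(1) B])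
  have sym: "sep P C = sep C P" for P :: "'a \<Rightarrow> int"
  proof -
    have "P e = - C e \<and> P e \<noteq> 0 \<longleftrightarrow> C e = - P e \<and> C e \<noteq> 0" for e by arith
    then show ?thesis by (simp only: sep_def)
  qed
  have "B x \<noteq> B' x \<longleftrightarrow> x = e" for x
  proof -
    have "B x \<noteq> B' x \<longleftrightarrow> x \<in> G"
    proof (cases "W x = 0")
      case True
      then show ?thesis by (simp add: B'_def opp_apply G_def)
    next
      case False
      then have "B' x = B x"
        using covector_leD[OF covector_less_imp_le[OF W(2)] False] by (simp add: B'_def opp_apply)
      then show ?thesis using False by (simp add: G_def)
    qed
    then show ?thesis using G by simp
  qed
  then have "tope_adj L B B'" using B B' by (simp add: tope_adj_def)
  moreover have "e \<in> sep B C" unfolding sym[of B] by (rule subsetD[OF R(2) e])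
  moreover have "sep B' C = sep B C - {e}" using R(4) unfolding G sym[of B] sym[of B'] .
  ultimately show ?thesis by (intro that[of B' e] B')
qed

lemma sep_self: "sep B B = {}"
  by (auto simp: sep_def)

lemma tope_path_exists:
  assumes "B \<in> topes L" "C \<in> topes L"
  shows "(tope_adj L ^^ card (sep B C)) B C"
  using assms(1)
proof (induction "card (sep B C)" arbitrary: B)
  case 0
  have "sep B C = {}" using 0(1) finite_sep[OF tope_in_L[OF 0(2)], of C] by (metis card_0_eq)
  then have "B e = C e" for e using tope_sep_iff[OF 0(2) assms(2), of e] by simp
  then have "B = C" by (rule ext)
  then show ?case unfolding 0(1)[symmetric] by simp
next
  case (Suc n)
  have "B \<noteq> C"
  proof
    assume "B = C"
    then have "card (sep B C) = 0" by (simp only: sep_self card.empty)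
    then show False using Suc(2) by simp
  qed
  then obtain B' e where B': "tope_adj L B B'" "B' \<in> topes L" "e \<in> sep B C" "sep B' C = sep B C - {e}"
    by (rule tope_neighbour[OF Suc(3) assms(2)])
  have "card (sep B' C) = card (sep B C) - 1" unfolding B'(4) using B'(3) by (rule card_Diff_singleton)
  then have n: "n = card (sep B' C)" by (simp only: Suc(2)[symmetric] diff_Suc_1)
  have "(tope_adj L ^^ n) B' C" unfolding n using n B'(2) by (rule Suc(1))
  then have "(tope_adj L ^^ Suc n) B C" by (rule relpowp_Suc_I2[of "tope_adj L" B B' n C, OF B'(1)])
  then show ?case by (simp only: Suc(2))
qed

lemma tope_path_length: "(tope_adj L ^^ n) B C \<Longrightarrow> B \<in> topes L \<Longrightarrow> card (sep B C) \<le> n"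
proof (induction n arbitrary: C)
  case 0
  then have "B = C" by simp
  then have "sep B C = {}" by (simp only: sep_self)
  then show ?case by simp
next
  case (Suc n)
  obtain D where D: "(tope_adj L ^^ n) B D" "tope_adj L D C" by (rule relpowp_Suc_E[OF Suc.prems(1)])
  then have topes: "D \<in> topes L" "C \<in> topes L" by (simp_all add: tope_adj_def)
  have "\<exists>!e. D e \<noteq> C e" using D(2) by (simp only: tope_adj_def)
  then obtain e where e: "D x \<noteq> C x \<Longrightarrow> x = e" for x by blast
  have "sep B C \<subseteq> insert e (sep B D)"
  proof
    fix x assume "x \<in> sep B C"
    then have "B x \<noteq> C x" using tope_sep_iff[OF Suc.prems(2) topes(2)] by simp
    then show "x \<in> insert e (sep B D)"
      using e[of x] tope_sep_iff[OF Suc.prems(2) topes(1), of x] by (cases "D x = C x") simp_all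
  qed
  then have "card (sep B C) \<le> card (insert e (sep B D))"
    using finite_sep[OF tope_in_L[OF Suc.prems(2)]] by (intro card_mono) auto
  also have "\<dots> \<le> Suc (card (sep B D))" by (rule card_insert_le_m1) simp_all
  also have "\<dots> \<le> Suc n" using Suc.IH[OF D(1) Suc.prems(2)] by simp
  finally show ?case .
qed

lemma tope_dist_eq:
  assumes "B \<in> topes L" "C \<in> topes L"
  shows "tope_dist L B C = enat (card (sep B C))"
  unfolding graph_dist_def
proof (rule antisym)
  show "(INF n\<in>{n. (tope_adj L ^^ n) B C}. enat n) \<le> enat (card (sep B C))"
    using tope_path_exists[OF assms] by (intro INF_lower) simp
  show "enat (card (sep B C)) \<le> (INF n\<in>{n. (tope_adj L ^^ n) B C}. enat n)"
    using tope_path_length[OF _ assms(1)] by (intro INF_greatest) simp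
qed

text \<open>A coordinate that separates \<open>A\<close> from \<open>C\<close> separates exactly one
  of the two consecutive pairs, so the distances add up if and only if the two separations are
  disjoint. This turns the metric condition into \<open>tope_between\<close>.\<close>

lemma tope_dist_add_iff:
  assumes "A \<in> topes L" "B \<in> topes L" "C \<in> topes L"
  shows "tope_dist L A C = tope_dist L A B + tope_dist L B C \<longleftrightarrow> (\<forall>e. B e = A e \<or> B e = C e)"
proof -
  let ?P = "sep A B" and ?Q = "sep B C"
  have fin: "finite ?P" "finite ?Q" "finite (sep A C)"
    by (rule finite_sep[OF tope_in_L[OF assms(1)]] finite_sep[OF tope_in_L[OF assms(2)]])+
  note mem = tope_sep_iff[OF assms(1,2)] tope_sep_iff[OF assms(2,3)] tope_sep_iff[OF assms(1,3)]
  have PQ: "e \<in> ?P \<inter> ?Q \<longleftrightarrow> \<not> (B e = A e \<or> B e = C e)" for e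
    unfolding Int_iff mem by metis
  have sub: "sep A C \<subseteq> ?P \<union> ?Q"
    unfolding subset_iff Un_iff mem by metis
  have "card (sep A C) = card ?P + card ?Q \<longleftrightarrow> ?P \<inter> ?Q = {}"
  proof
    assume eq: "card (sep A C) = card ?P + card ?Q"
    have "card (sep A C) \<le> card (?P \<union> ?Q)" using sub fin by (intro card_mono) auto
    moreover have "card ?P + card ?Q = card (?P \<union> ?Q) + card (?P \<inter> ?Q)" using fin by (intro card_Un_Int)
    ultimately have "card (?P \<inter> ?Q) = 0" using eq by simp
    then show "?P \<inter> ?Q = {}" using fin by simp
  next
    assume disj: "?P \<inter> ?Q = {}"
    have "B e = A e \<or> B e = C e" for e
    proof -
      have "e \<notin> ?P \<inter> ?Q" by (simp only: disj empty_iff not_False_eq_True)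
      then show ?thesis by (simp only: PQ not_not)
    qed
    then have "?P \<union> ?Q \<subseteq> sep A C"
      unfolding subset_iff Un_iff mem by metis
    then have "sep A C = ?P \<union> ?Q" using sub by blast
    then show "card (sep A C) = card ?P + card ?Q" using card_Un_disjoint[OF fin(1,2) disj] by simp
  qed
  moreover have "?P \<inter> ?Q = {} \<longleftrightarrow> (\<forall>e. B e = A e \<or> B e = C e)"
    unfolding set_eq_iff PQ by (simp only: empty_iff simp_thms)
  ultimately show ?thesis
    unfolding tope_dist_eq[OF assms(1,2)] tope_dist_eq[OF assms(2,3)] tope_dist_eq[OF assms(1,3)] by simp
qed

lemma mag_boundary_tuple:
  assumes "set Bs \<subseteq> topes L"
  shows "(\<Sum>i\<in>{1..<length Bs - 1}. frag_cmul ((-1) ^ i) (mag_face (tope_dist L) i Bs)) =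
    list_bd (tope_between (topes L)) Bs"
  unfolding list_bd_def
proof (rule sum.cong)
  fix i assume i: "i \<in> {1..<length Bs - 1}"
  then have len: "i - 1 < length Bs" "i < length Bs" "i + 1 < length Bs" by auto
  then have t: "Bs ! (i - 1) \<in> topes L" "Bs ! i \<in> topes L" "Bs ! (i + 1) \<in> topes L"
    using assms nth_mem by blast+
  show "frag_cmul ((-1) ^ i) (mag_face (tope_dist L) i Bs) = frag_cmul ((-1) ^ i)
      (if tope_between (topes L) (Bs ! (i - 1)) (Bs ! i) (Bs ! (i + 1)) then frag_of (take i Bs @ drop (Suc i) Bs) else 0)"
    unfolding mag_face_def tope_dist_add_iff[OF t] using t by (simp add: tope_between_def)
qed simp

lemma mag_boundary_eq:
  assumes "\<And>Bs. Bs \<in> keys c \<Longrightarrow> set Bs \<subseteq> topes L"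
  shows "mag_boundary (tope_dist L) c = frag_extend (list_bd (tope_between (topes L))) c"
  unfolding mag_boundary_def using assms mag_boundary_tuple by (intro frag_extend_eq) auto

lemma sum_enat: "(\<Sum>i\<in>A. enat (f i)) = enat (\<Sum>i\<in>A. f i)"
  by (induction A rule: infinite_finite_induct) (auto simp: zero_enat_def)

lemma card_sep_sum:
  assumes "B \<in> topes L" "C \<in> topes L"
  shows "card (sep B C) = (\<Sum>e\<in>E. indicator (sep B C) e)"
proof -
  have "sep B C \<subseteq> E" using in_ground[OF tope_in_L[OF assms(1)]] by (auto simp: sep_iff)
  then show ?thesis using finite_ground by (simp add: indicator_def sum.If_cases Int_absorb1)
qed

text \<open>Counting separations by coordinates instead of by steps shows that the length of a tuple
  is the sum of its crossing vector.\<close>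

lemma mag_tuples_eq:
  "mag_tuples (topes L) (tope_dist L) k l =
    {\<tau>. length \<tau> = Suc k \<and> set \<tau> \<subseteq> topes L \<and> distinct_adj \<tau> \<and> (\<Sum>e\<in>E. crossing_vector \<tau> e) = l}"
proof -
  have "(\<Sum>i<k. tope_dist L (\<tau> ! i) (\<tau> ! Suc i)) = enat (\<Sum>e\<in>E. crossing_vector \<tau> e)"
    if \<tau>: "length \<tau> = Suc k" "set \<tau> \<subseteq> topes L" for \<tau>
  proof -
    have t: "\<tau> ! i \<in> topes L" "\<tau> ! Suc i \<in> topes L" if "i < k" for i
      using that \<tau> nth_mem by (metis Suc_less_eq less_SucI subsetD)+
    have "(\<Sum>i<k. tope_dist L (\<tau> ! i) (\<tau> ! Suc i)) =
        (\<Sum>i<k. enat (\<Sum>e\<in>E. indicator (sep (\<tau> ! i) (\<tau> ! Suc i)) e))"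
      using t by (intro sum.cong) (simp_all add: tope_dist_eq card_sep_sum)
    also have "\<dots> = enat (\<Sum>i<k. \<Sum>e\<in>E. indicator (sep (\<tau> ! i) (\<tau> ! Suc i)) e)" by (rule sum_enat)
    also have "(\<Sum>i<k. \<Sum>e\<in>E. indicator (sep (\<tau> ! i) (\<tau> ! Suc i)) e) = (\<Sum>e\<in>E. crossing_vector \<tau> e)"
      by (subst sum.swap) (simp add: crossing_vector_def \<tau>(1))
    finally show ?thesis .
  qed
  then show ?thesis
    unfolding mag_tuples_def by (auto simp: distinct_adj_conv_nth)
qed

lemma walks_ground: "\<tau> \<in> walks C w \<Longrightarrow> e \<notin> E \<Longrightarrow> w e = 0"
proof -
  assume \<tau>: "\<tau> \<in> walks C w" and e: "e \<notin> E"
  have "crossing_vector \<tau> e = 0"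
  proof (rule crossing_vector_constant)
    show "T e = 0" if "T \<in> set \<tau>" for T
      using \<tau> that e tope_zero_iff[of T e] by (auto simp: walks_def)
  qed
  then show "w e = 0" using \<tau> by (simp add: walks_def)
qed

lemma walks_boundary:
  assumes "\<tau> \<in> walks C w"
  shows "keys (list_bd (tope_between (topes L)) \<tau>) \<subseteq> walks C w"
proof
  fix l assume "l \<in> keys (list_bd (tope_between (topes L)) \<tau>)"
  then obtain u a b c v where uv: "\<tau> = u @ a # b # c # v" "l = u @ a # c # v" "tope_between (topes L) a b c"
    by (rule keys_list_bdE)
  have "b \<in> topes L" using assms by (auto simp: walks_def uv(1))
  then have "b e = a e \<or> b e = c e" for e using tope_betweenD(2)[OF uv(3)] by blast
  then show "l \<in> walks C w" unfolding uv(2) using assms uv(1) by (intro walks_delete[of u a b c v]) auto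
qed

text \<open>The complexes of \<open>mag_homology\<close> and of \<open>mag_homology_to\<close> are both of this form.\<close>

definition walk_family :: "(('a \<Rightarrow> int) \<times> ('a \<Rightarrow> nat)) set \<Rightarrow> nat \<Rightarrow> ('a \<Rightarrow> int) list set" where
  "walk_family P k = {\<tau>. length \<tau> = Suc k \<and> (\<exists>(C, w)\<in>P. \<tau> \<in> walks C w)}"

text \<open>The boundary keeps the terminal tope and the crossing vector, so the complex is the
  direct sum of the complexes \<open>Wk p\<close>. By \<open>walks_homology\<close> each summand
  contributes one basis element, represented by \<open>z p\<close>, or none.\<close>

lemma tuple_homology_walk_family:
  fixes P :: "(('a \<Rightarrow> int) \<times> ('a \<Rightarrow> nat)) set" and k :: nat
  assumes P: "\<And>C w. (C, w) \<in> P \<Longrightarrow> C \<in> topes L \<and> (\<forall>e. e \<notin> E \<longrightarrow> w e = 0)"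
  defines "I \<equiv> {(C, w). (C, w) \<in> P \<and> admissible E L w C \<and> kappa E L w = k}"
  shows "tuple_homology (tope_dist L) (walk_family P) k \<cong> free_Abelian_group I"
    "group (tuple_homology (tope_dist L) (walk_family P) k)"
proof -
  let ?bd = "list_bd (tope_between (topes L))"
  let ?D = "frag_extend ?bd" and ?T = "walk_family P"
  define Wk where "Wk p = walks (fst p) (snd p)" for p
  have disj: "p = q" if "\<tau> \<in> Wk p" "\<tau> \<in> Wk q" for p q \<tau>
    using that by (cases p; cases q) (auto simp: Wk_def walks_def)
  have T: "\<tau> \<in> ?T j \<longleftrightarrow> length \<tau> = Suc j \<and> (\<exists>p\<in>P. \<tau> \<in> Wk p)" for \<tau> j
    by (simp add: walk_family_def Wk_def case_prod_beta)
  have TT: "set \<tau> \<subseteq> topes L" if "\<tau> \<in> ?T j" for \<tau> j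
    using that by (auto simp: T Wk_def walks_def)
  have mb: "mag_boundary (tope_dist L) c = ?D c" if "keys c \<subseteq> ?T j" for c j
    using that TT by (intro mag_boundary_eq) blast
  have bdW: "keys (?bd \<tau>) \<subseteq> Wk p" if "\<tau> \<in> Wk p" for p \<tau>
    using walks_boundary that by (simp add: Wk_def)
  have keysD: "keys (?D c) \<subseteq> ?T j" if c: "keys c \<subseteq> ?T (Suc j)" for c j
  proof
    fix l assume "l \<in> keys (?D c)"
    then obtain \<tau> where \<tau>: "\<tau> \<in> keys c" "l \<in> keys (?bd \<tau>)" using keys_frag_extend[of ?bd c] by blast
    obtain p where p: "p \<in> P" "\<tau> \<in> Wk p" "length \<tau> = Suc (Suc j)" using c \<tau>(1) T by blast
    have "l \<in> Wk p" using bdW[OF p(2)] \<tau>(2) by blast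
    moreover have "length l = Suc j" using deg_bd[OF \<tau>(2)] p(3) by simp
    ultimately show "l \<in> ?T j" using p(1) T by blast
  qed
  \<comment> \<open>Projection onto a summand commutes with the boundary, because the sets
    \<open>Wk p\<close> are disjoint and closed under faces.\<close>
  have rD: "restrict_frag (Wk p) (?D c) = rbd (Wk p) (restrict_frag (Wk p) c)" if c: "keys c \<subseteq> ?T j" for p c j
  proof -
    have "keys c \<subseteq> (\<Union>q\<in>P. Wk q)" using c T by blast
    then show ?thesis
    proof (induction c rule: frag_induction)
      case (one \<tau>)
      show ?case
      proof (cases "\<tau> \<in> Wk p")
        case True
        then have "restrict_frag (Wk p) (frag_of \<tau>) = frag_of \<tau>" by (intro restrict_frag_id) simp
        then show ?thesis by (simp add: rbd_def)
      next
        case False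
        obtain q where q: "\<tau> \<in> Wk q" using one by blast
        have "keys (?bd \<tau>) \<inter> Wk p = {}" using bdW[OF q] disj q False by blast
        moreover have "restrict_frag (Wk p) (frag_of \<tau>) = 0" using False by (intro restrict_frag_eq_0) simp
        ultimately show ?thesis by (simp add: restrict_frag_eq_0)
      qed
    qed (simp_all add: frag_extend_diff restrict_frag_diff rbd_diff)
  qed
  have rbdW: "rbd (Wk p) d = ?D d" if "keys d \<subseteq> Wk p" for p d
  proof -
    have "keys (?D d) \<subseteq> Wk p" using keys_frag_extend[of ?bd d] bdW that by blast
    then show ?thesis by (simp add: rbd_def restrict_frag_id)
  qed
  have "\<exists>z. hgen (Wk p) (Suc (kappa E L (snd p))) z \<and> (z = 0 \<longleftrightarrow> \<not> admissible E L (snd p) (fst p))" if "p \<in> P" for p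
  proof -
    have "fst p \<in> topes L" "\<And>e. e \<notin> E \<Longrightarrow> snd p e = 0" using P[of "fst p" "snd p"] that by auto
    then show ?thesis unfolding Wk_def by (rule walks_homology)
  qed
  then obtain z where z: "\<And>p. p \<in> P \<Longrightarrow> hgen (Wk p) (Suc (kappa E L (snd p))) (z p)"
      "\<And>p. p \<in> P \<Longrightarrow> z p = 0 \<longleftrightarrow> \<not> admissible E L (snd p) (fst p)"
    by metis
  have IP: "p \<in> P" if "p \<in> I" for p using that by (auto simp: I_def)
  have kz: "keys (z p) \<subseteq> Wk p" "keys (z p) \<subseteq> {\<tau>. length \<tau> = Suc (kappa E L (snd p))}" "rbd (Wk p) (z p) = 0"
    if "p \<in> P" for p using z(1)[OF that] by (auto simp: hgen_def)
  have zT: "keys (z p) \<subseteq> ?T k" "?D (z p) = 0" if "p \<in> I" for p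
  proof -
    have "kappa E L (snd p) = k" using that by (auto simp: I_def)
    then show "keys (z p) \<subseteq> ?T k" using kz[OF IP[OF that]] IP[OF that] T by blast
    show "?D (z p) = 0" using kz(3)[OF IP[OF that]] rbdW[OF kz(1)[OF IP[OF that]]] by simp
  qed
  define Z where "Z = {c \<in> carrier (free_Abelian_group (?T k)). mag_boundary (tope_dist L) c = 0}"
  define B where "B = mag_boundary (tope_dist L) ` carrier (free_Abelian_group (?T (Suc k)))"
  have Z_iff: "c \<in> Z \<longleftrightarrow> keys c \<subseteq> ?T k \<and> ?D c = 0" for c
    using mb[of c k] by (simp add: Z_def cong: conj_cong)
  have B_iff: "c \<in> B \<longleftrightarrow> (\<exists>d. keys d \<subseteq> ?T (Suc k) \<and> c = ?D d)" for c
  proof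
    assume "c \<in> B"
    then obtain d where d: "keys d \<subseteq> ?T (Suc k)" "c = mag_boundary (tope_dist L) d" by (auto simp: B_def)
    then show "\<exists>d. keys d \<subseteq> ?T (Suc k) \<and> c = ?D d" using mb[OF d(1)] by (intro exI[of _ d]) simp
  next
    assume "\<exists>d. keys d \<subseteq> ?T (Suc k) \<and> c = ?D d"
    then obtain d where d: "keys d \<subseteq> ?T (Suc k)" "c = ?D d" by (elim exE conjE)
    have "c = mag_boundary (tope_dist L) d" unfolding d(2) by (rule mb[OF d(1), symmetric])
    then show "c \<in> B" unfolding B_def using d(1) by (intro image_eqI[of _ _ d]) simp_all
  qed
  have Zd: "x - y \<in> Z" if "x \<in> Z" "y \<in> Z" for x y
    using that keys_diff_subset[of x "?T k" y] by (simp add: Z_iff frag_extend_diff)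
  have Bd: "x - y \<in> B" if xy: "x \<in> B" "y \<in> B" for x y
  proof -
    obtain d d' where "keys d \<subseteq> ?T (Suc k)" "x = ?D d" "keys d' \<subseteq> ?T (Suc k)" "y = ?D d'"
      using xy by (auto simp: B_iff)
    then have "keys (d - d') \<subseteq> ?T (Suc k)" "x - y = ?D (d - d')"
      by (auto simp: frag_extend_diff intro: keys_diff_subset[THEN subsetD])
    then show ?thesis unfolding B_iff by blast
  qed
  have BZ: "B \<subseteq> Z"
  proof
    fix x assume "x \<in> B"
    then obtain d where "keys d \<subseteq> ?T (Suc k)" "x = ?D d" by (auto simp: B_iff)
    then show "x \<in> Z" using keysD[of d k] extend_bd_extend_bd[of d] by (simp add: Z_iff)
  qed
  have zZ: "frag_extend z f \<in> Z" if "keys f \<subseteq> I" for f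
    using that
  proof (induction f rule: frag_induction)
    case (one p)
    then show ?case using zT[of p] by (simp add: Z_iff)
  next
    case (diff a b)
    then show ?case by (simp add: frag_extend_diff Zd)
  qed (simp add: Z_iff)
  have gen: "\<exists>f. keys f \<subseteq> I \<and> c - frag_extend z f \<in> B" if cZ: "c \<in> Z" for c
  proof -
    have c: "keys c \<subseteq> ?T k" "?D c = 0" using cZ by (auto simp: Z_iff)
    \<comment> \<open>The finitely many summands that \<open>c\<close> meets.\<close>
    define Q where "Q = (\<lambda>\<tau>. (last \<tau>, crossing_vector \<tau>)) ` keys c"
    have finQ: "finite Q" by (simp add: Q_def)
    have QP: "Q \<subseteq> P"
    proof
      fix p assume "p \<in> Q"
      then obtain \<tau> where \<tau>: "\<tau> \<in> keys c" "p = (last \<tau>, crossing_vector \<tau>)" by (auto simp: Q_def)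
      obtain q where q: "q \<in> P" "\<tau> \<in> Wk q" using c(1) \<tau>(1) T by blast
      have "q = p" using q(2) \<tau>(2) by (cases q) (auto simp: Wk_def walks_def)
      then show "p \<in> P" using q(1) by simp
    qed
    have csum: "c = (\<Sum>p\<in>Q. restrict_frag (Wk p) c)"
    proof (rule poly_mapping_eqI)
      fix \<tau>
      have "(\<Sum>p\<in>Q. if \<tau> \<in> Wk p then Poly_Mapping.lookup c \<tau> else 0) = Poly_Mapping.lookup c \<tau>"
      proof (cases "\<tau> \<in> keys c")
        case True
        obtain q where q: "q \<in> P" "\<tau> \<in> Wk q" using c(1) True T by blast
        have "q = (last \<tau>, crossing_vector \<tau>)" using q(2) by (cases q) (auto simp: Wk_def walks_def)
        then have "q \<in> Q" using True by (auto simp: Q_def)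
        moreover have "\<tau> \<in> Wk p \<longleftrightarrow> p = q" for p using disj q(2) by blast
        ultimately show ?thesis using finQ by (simp add: sum.delta')
      next
        case False
        then have "Poly_Mapping.lookup c \<tau> = 0" by (simp add: in_keys_iff)
        then show ?thesis by (simp cong: if_cong)
      qed
      then show "Poly_Mapping.lookup c \<tau> = Poly_Mapping.lookup (\<Sum>p\<in>Q. restrict_frag (Wk p) c) \<tau>"
        by (simp add: lookup_sum)
    qed
    have "\<exists>m d. keys d \<subseteq> Wk p \<inter> {\<tau>. length \<tau> = Suc (Suc k)} \<and>
        restrict_frag (Wk p) c = frag_cmul (if Suc (kappa E L (snd p)) = Suc k then m else 0) (z p) + rbd (Wk p) d"
      if pQ: "p \<in> Q" for p
    proof -
      have "rbd (Wk p) (restrict_frag (Wk p) c) = 0" using rD[OF c(1), of p] c(2) by simp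
      moreover have "keys (restrict_frag (Wk p) c) \<subseteq> Wk p \<inter> {\<tau>. length \<tau> = Suc k}"
        using c(1) T by auto
      ultimately show ?thesis using z(1)[OF subsetD[OF QP pQ]] by (intro hgen_homogeneous)
    qed
    then obtain m d where md: "\<And>p. p \<in> Q \<Longrightarrow> keys (d p) \<subseteq> Wk p \<inter> {\<tau>. length \<tau> = Suc (Suc k)}"
        "\<And>p. p \<in> Q \<Longrightarrow> restrict_frag (Wk p) c =
          frag_cmul (if Suc (kappa E L (snd p)) = Suc k then m p else 0) (z p) + rbd (Wk p) (d p)"
      by metis
    define f where "f = (\<Sum>p\<in>Q \<inter> I. frag_cmul (m p) (frag_of p))"
    have kf: "keys f \<subseteq> I" unfolding f_def by (rule keys_sum_subset) auto
    have fz: "frag_extend z f = (\<Sum>p\<in>Q \<inter> I. frag_cmul (m p) (z p))"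
      using finQ by (simp add: f_def frag_extend_sum frag_extend_cmul)
    \<comment> \<open>For an index outside \<open>I\<close> either the degree does not match and the
      coefficient is zero, or the pair is not admissible and \<open>z p\<close> is zero.\<close>
    have coeff: "frag_cmul (if Suc (kappa E L (snd p)) = Suc k then m p else 0) (z p) =
        (if p \<in> I then frag_cmul (m p) (z p) else 0)" if pQ: "p \<in> Q" for p
      using subsetD[OF QP pQ] z(2)[OF subsetD[OF QP pQ]] by (cases p) (auto simp: I_def)
    have "c = (\<Sum>p\<in>Q. (if p \<in> I then frag_cmul (m p) (z p) else 0) + ?D (d p))"
    proof -
      have "restrict_frag (Wk p) c = (if p \<in> I then frag_cmul (m p) (z p) else 0) + ?D (d p)" if "p \<in> Q" for p
        using md(2)[OF that] coeff[OF that] rbdW[of "d p" p] md(1)[OF that] by simp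
      then show ?thesis by (intro trans[OF csum sum.cong] refl)
    qed
    also have "\<dots> = frag_extend z f + ?D (\<Sum>p\<in>Q. d p)"
      unfolding fz sum.distrib using finQ by (simp add: sum.If_cases frag_extend_sum Int_def)
    finally have "c - frag_extend z f = ?D (\<Sum>p\<in>Q. d p)" by (simp add: algebra_simps)
    moreover have "keys (\<Sum>p\<in>Q. d p) \<subseteq> ?T (Suc k)"
    proof (rule keys_sum_subset)
      show "keys (d p) \<subseteq> ?T (Suc k)" if "p \<in> Q" for p
        using md(1)[OF that] subsetD[OF QP that] T by blast
    qed
    ultimately have "c - frag_extend z f \<in> B" unfolding B_iff by blast
    with kf show ?thesis by blast
  qed
  have ind: "f = 0" if kf: "keys f \<subseteq> I" and fB: "frag_extend z f \<in> B" for f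
  proof (rule poly_mapping_eqI)
    fix p
    obtain d where d: "keys d \<subseteq> ?T (Suc k)" "frag_extend z f = ?D d" using fB by (auto simp: B_iff)
    have r: "restrict_frag (Wk p) (frag_extend z f) = frag_cmul (Poly_Mapping.lookup f p) (z p)" if pI: "p \<in> I"
      using kf
    proof (induction f rule: frag_induction)
      case (one q)
      show ?case
      proof (cases "q = p")
        case True
        then show ?thesis using kz(1)[OF IP[OF pI]] by (simp add: restrict_frag_id)
      next
        case False
        have "keys (z q) \<inter> Wk p = {}" using kz(1)[OF IP[OF one]] disj False by blast
        then show ?thesis using False by (simp add: restrict_frag_eq_0)
      qed
    qed (simp_all add: frag_extend_diff restrict_frag_diff lookup_minus frag_cmul_diff_distrib)
    show "Poly_Mapping.lookup f p = Poly_Mapping.lookup 0 p"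
    proof (cases "p \<in> I")
      case True
      have "rbd (Wk p) (restrict_frag (Wk p) d) = frag_cmul (Poly_Mapping.lookup f p) (z p)"
        using rD[OF d(1), of p] r[OF True] d(2) by simp
      moreover have "keys (restrict_frag (Wk p) d) \<subseteq> Wk p" by simp
      ultimately have "frag_cmul (Poly_Mapping.lookup f p) (z p) = 0"
        using hgen_unique[OF z(1)[OF IP[OF True]]] by blast
      moreover have "z p \<noteq> 0" using z(2)[OF IP[OF True]] True by (auto simp: I_def)
      ultimately show ?thesis by simp
    next
      case False
      then have "p \<notin> keys f" using kf by blast
      then show ?thesis by (simp add: in_keys_iff)
    qed
  qed
  have Z0: "0 \<in> Z" by (simp add: Z_iff)
  have B0: "0 \<in> B" unfolding B_iff by (intro exI[of _ 0]) simp
  have ZF: "Z \<subseteq> carrier (free_Abelian_group (?T k))" by (auto simp: Z_iff)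
  note Q = quotient_free_Abelian_group[OF ZF Z0 Zd BZ B0 Bd zZ gen ind]
  show "tuple_homology (tope_dist L) ?T k \<cong> free_Abelian_group I"
    unfolding tuple_homology_def Z_def[symmetric] B_def[symmetric] by (rule Q(1))
  show "group (tuple_homology (tope_dist L) ?T k)"
    unfolding tuple_homology_def Z_def[symmetric] B_def[symmetric] by (rule Q(2))
qed

lemma crossing_tuples_eq: "crossing_tuples L w C = walk_family {(C, w)}"
proof (intro ext Set.set_eqI)
  fix k and \<tau> :: "('a \<Rightarrow> int) list"
  have "\<tau> \<noteq> []" if "length \<tau> = Suc k" using that by (cases \<tau>) simp_all
  then show "\<tau> \<in> crossing_tuples L w C k \<longleftrightarrow> \<tau> \<in> walk_family {(C, w)} k"
    by (simp only: crossing_tuples_def mag_tuples_eq walk_family_def walks_def mem_Collect_eq UN_iff) auto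
qed

lemma mag_tuples_walk_family:
  "(\<lambda>j. mag_tuples (topes L) (tope_dist L) j l) =
    walk_family {(C, w). C \<in> topes L \<and> (\<forall>e. e \<notin> E \<longrightarrow> w e = 0) \<and> (\<Sum>e\<in>E. w e) = l}" (is "_ = walk_family ?P")
proof (intro ext Set.set_eqI iffI)
  fix j \<tau> assume "\<tau> \<in> mag_tuples (topes L) (tope_dist L) j l"
  then have \<tau>: "length \<tau> = Suc j" "set \<tau> \<subseteq> topes L" "distinct_adj \<tau>" "(\<Sum>e\<in>E. crossing_vector \<tau> e) = l"
    by (simp_all add: mag_tuples_eq)
  then have ne: "\<tau> \<noteq> []" by (cases \<tau>) simp_all
  have w: "\<tau> \<in> walks (last \<tau>) (crossing_vector \<tau>)" using \<tau> ne by (simp add: walks_def)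
  have "last \<tau> \<in> topes L" using subsetD[OF \<tau>(2) last_in_set[OF ne]] .
  then have "(last \<tau>, crossing_vector \<tau>) \<in> ?P" using walks_ground[OF w] \<tau>(4) by simp
  with w show "\<tau> \<in> walk_family ?P j"
    by (simp only: walk_family_def mem_Collect_eq) (intro conjI \<tau>(1) bexI[of _ "(last \<tau>, crossing_vector \<tau>)"]; simp)
next
  fix j \<tau> assume "\<tau> \<in> walk_family ?P j"
  then obtain C w where Cw: "length \<tau> = Suc j" "(\<Sum>e\<in>E. w e) = l" "\<tau> \<in> walks C w"
    by (auto simp only: walk_family_def mem_Collect_eq split: prod.splits)
  then show "\<tau> \<in> mag_tuples (topes L) (tope_dist L) j l" by (simp add: mag_tuples_eq walks_def)
qed

end

section \<open>Face flags\<close>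

lemma flag_crossing_pos:
  "(\<Sum>X\<leftarrow>Xs. indicator (zero_set E X) e) \<noteq> (0 :: nat) \<longleftrightarrow> (\<exists>X\<in>set Xs. e \<in> zero_set E X)"
  by (induction Xs) (auto simp: indicator_def)

context simple_oriented_matroid
begin

lemma face_eq_zero_on:
  assumes "C \<in> topes L" "X \<in> L" "covector_le X C"
  shows "X = zero_on C (zero_set E X)"
proof
  fix e show "X e = zero_on C (zero_set E X) e"
    using covector_leD[OF assms(3), of e] in_ground[OF assms(2), of e] outside_ground[OF tope_in_L[OF assms(1)], of e]
    by (cases "X e = 0"; cases "e \<in> E") (simp_all add: zero_on_def zero_set_def)
qed

lemma zero_set_zero_on:
  assumes "C \<in> topes L" "U \<subseteq> E"
  shows "zero_set E (zero_on C U) = U"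
proof -
  have "e \<in> E \<and> zero_on C U e = 0 \<longleftrightarrow> e \<in> U" for e
    using tope_zero_iff[OF assms(1), of e] subsetD[OF assms(2), of e] by (cases "e \<in> U") (simp_all add: zero_on_def)
  then show ?thesis unfolding zero_set_def by blast
qed

lemma face_le_iff:
  assumes "C \<in> topes L" "X \<in> L" "covector_le X C" "covector_le Y C"
  shows "covector_le X Y \<longleftrightarrow> zero_set E Y \<subseteq> zero_set E X"
proof
  assume "covector_le X Y"
  then show "zero_set E Y \<subseteq> zero_set E X" using covector_leD0 by (fastforce simp: zero_set_def)
next
  assume sub: "zero_set E Y \<subseteq> zero_set E X"
  show "covector_le X Y"
  proof (rule covector_leI)
    fix e assume e: "X e \<noteq> 0"
    then have "Y e \<noteq> 0" using sub in_ground[OF assms(2) e] by (auto simp: zero_set_def)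
    then show "X e = Y e" using covector_leD[OF assms(3) e] covector_leD[OF assms(4)] by simp
  qed
qed

lemma face_flags_zero:
  assumes "C \<in> topes L"
  shows "face_flags E L (\<lambda>_. 0) C k = (if k = 0 then {[]} else {})"
proof -
  have "Xs = []" if Xs: "Xs \<in> face_flags E L (\<lambda>_. 0) C k" for Xs
  proof (rule ccontr)
    assume "Xs \<noteq> []"
    then obtain X where X: "X \<in> set Xs" by (meson last_in_set)
    have "e \<notin> zero_set E X" for e
    proof
      assume "e \<in> zero_set E X"
      then have "(\<Sum>X\<leftarrow>Xs. indicator (zero_set E X) e) \<noteq> (0 :: nat)" unfolding flag_crossing_pos using X by blast
      moreover have "(\<Sum>X\<leftarrow>Xs. indicator (zero_set E X) e) = (0 :: nat)"
        using Xs unfolding face_flags_def mem_Collect_eq by meson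
      ultimately show False by simp
    qed
    then have "zero_set E X = {}" by blast
    moreover have "X \<in> L" "covector_le X C" "X \<noteq> C" using Xs X by (simp_all add: face_flags_def)
    ultimately show False using face_eq_zero_on[OF assms, of X] by (simp add: zero_on_def)
  qed
  moreover have "[] \<in> face_flags E L (\<lambda>_. 0) C k \<longleftrightarrow> k = 0" by (auto simp: face_flags_def)
  ultimately show ?thesis by auto
qed

text \<open>The last face of a flag is the least one, so its zero set contains those of all the
  others and is the support \<open>U\<close> of \<open>w\<close>. A face of a tope is determined by
  its zero set, so the last face is forced; dropping it lowers \<open>w\<close> by one on
  \<open>U\<close> and the degree by the rank of \<open>U\<close>.\<close>

lemma face_flags_snoc:
  assumes C: "C \<in> topes L" and w: "\<And>e. w e \<noteq> 0 \<longleftrightarrow> e \<in> U" and U: "U \<subseteq> E" "U \<noteq> {}"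
  shows "Xs \<in> face_flags E L w C k \<longleftrightarrow> (\<exists>Ys i. Xs = Ys @ [zero_on C U] \<and> zero_on C U \<in> L \<and>
    k = i + rank U \<and> Ys \<in> face_flags E L (\<lambda>e. w e - 1) C i)"
proof
  assume Xs: "Xs \<in> face_flags E L w C k"
  have cross: "(\<Sum>X\<leftarrow>Xs. indicator (zero_set E X) e) = w e" for e
    using Xs unfolding face_flags_def mem_Collect_eq by meson
  have wZ: "e \<in> U \<longleftrightarrow> (\<exists>X\<in>set Xs. e \<in> zero_set E X)" for e
    unfolding w[symmetric] cross[symmetric] by (rule flag_crossing_pos)
  obtain Ys X where YX: "Xs = Ys @ [X]"
  proof (cases Xs rule: rev_cases)
    case Nil
    then have "U = {}" using wZ by auto
    then show ?thesis using U(2) by simp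
  qed
  have X: "X \<in> L" "covector_le X C" using Xs by (simp_all add: face_flags_def YX)
  have Ys: "\<forall>Y\<in>set Ys. Y \<in> L \<and> covector_le Y C \<and> Y \<noteq> C" "sorted_wrt (\<lambda>X Y. covector_le Y X) Ys"
    "\<forall>Y\<in>set Ys. covector_le X Y"
    using Xs by (simp_all add: face_flags_def YX sorted_wrt_append)
  have "zero_set E Y \<subseteq> zero_set E X" if "Y \<in> set Ys" for Y
    using face_le_iff[OF C X, of Y] Ys(1,3) that by simp
  then have "e \<in> U \<longleftrightarrow> e \<in> zero_set E X" for e unfolding wZ by (auto simp: YX)
  then have ZX: "zero_set E X = U" by blast
  have XU: "X = zero_on C U" using face_eq_zero_on[OF C X] unfolding ZX .
  have "(\<Sum>X\<leftarrow>Ys. indicator (zero_set E X) e) = w e - 1" for e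
  proof (cases "e \<in> U")
    case True
    then show ?thesis using cross[of e] by (simp add: YX ZX)
  next
    case False
    then show ?thesis using cross[of e] w[of e] by (simp add: YX ZX)
  qed
  then have "Ys \<in> face_flags E L (\<lambda>e. w e - 1) C (\<Sum>X\<leftarrow>Ys. rank (zero_set E X))"
    unfolding face_flags_def using Ys(1,2) by simp
  moreover have "k = (\<Sum>X\<leftarrow>Ys. rank (zero_set E X)) + rank U"
    using Xs unfolding face_flags_def mem_Collect_eq YX by (simp add: ZX)
  ultimately show "\<exists>Ys i. Xs = Ys @ [zero_on C U] \<and> zero_on C U \<in> L \<and>
    k = i + rank U \<and> Ys \<in> face_flags E L (\<lambda>e. w e - 1) C i"
    using X(1) YX unfolding XU by blast
next
  assume "\<exists>Ys i. Xs = Ys @ [zero_on C U] \<and> zero_on C U \<in> L \<and>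
    k = i + rank U \<and> Ys \<in> face_flags E L (\<lambda>e. w e - 1) C i"
  then obtain Ys i where Xs: "Xs = Ys @ [zero_on C U]" and D: "zero_on C U \<in> L" and k: "k = i + rank U"
    and Ys: "Ys \<in> face_flags E L (\<lambda>e. w e - 1) C i" by blast
  have le: "covector_le (zero_on C U) C" by (simp add: covector_le_def zero_on_def)
  note ZD = zero_set_zero_on[OF C U(1)]
  have cross: "(\<Sum>X\<leftarrow>Ys. indicator (zero_set E X) e) = w e - 1" for e
    using Ys unfolding face_flags_def mem_Collect_eq by meson
  have Ys': "\<forall>Y\<in>set Ys. Y \<in> L \<and> covector_le Y C \<and> Y \<noteq> C" "sorted_wrt (\<lambda>X Y. covector_le Y X) Ys"
    "(\<Sum>X\<leftarrow>Ys. rank (zero_set E X)) = i"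
    using Ys by (simp_all add: face_flags_def)
  have "covector_le (zero_on C U) Y" if Y: "Y \<in> set Ys" for Y
  proof -
    have "zero_set E Y \<subseteq> U"
    proof
      fix e assume "e \<in> zero_set E Y"
      then have "(\<Sum>X\<leftarrow>Ys. indicator (zero_set E X) e) \<noteq> (0 :: nat)" unfolding flag_crossing_pos using Y by blast
      then have "w e \<noteq> 0" using cross[of e] by simp
      then show "e \<in> U" by (simp only: w)
    qed
    then show ?thesis using face_le_iff[OF C D le, of Y] Ys'(1) Y ZD by simp
  qed
  moreover have "zero_on C U \<noteq> C"
  proof
    assume eq: "zero_on C U = C"
    obtain e where e: "e \<in> U" using U(2) by blast
    have "zero_on C U e = 0" using e by (simp add: zero_on_def)
    then show False using tope_zero_iff[OF C, of e] subsetD[OF U(1) e] unfolding eq by simp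
  qed
  moreover have "(\<Sum>X\<leftarrow>Xs. indicator (zero_set E X) e) = w e" for e
    using cross[of e] w[of e] by (cases "e \<in> U") (simp_all add: Xs ZD)
  ultimately show "Xs \<in> face_flags E L w C k"
    unfolding face_flags_def mem_Collect_eq using Ys' D le by (auto simp: Xs sorted_wrt_append ZD k)
qed

text \<open>Peeling off the least face repeatedly leaves one candidate: the faces
  \<open>zero_on C (upper_level E w j)\<close> for the nonempty levels, with \<open>j\<close>
  decreasing to 1. They are covectors exactly when the pair is admissible, and their ranks add up to
  \<open>kappa\<close>.\<close>

lemma face_flags_singleton:
  assumes C: "C \<in> topes L" and "\<And>e. e \<notin> E \<Longrightarrow> w e = 0"
  shows "\<exists>F. \<forall>k. face_flags E L w C k = (if admissible E L w C \<and> k = kappa E L w then {F} else {})"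
  using assms(2)
proof (induction "\<Sum>e\<in>E. w e" arbitrary: w rule: less_induct)
  case less
  note wE = less.prems
  show ?case
  proof (cases "\<forall>e. w e = 0")
    case True
    then have w0: "w = (\<lambda>_. 0)" by auto
    have U: "upper_level E w j = {}" if "j \<ge> 1" for j using that by (auto simp: upper_level_def w0)
    have S0: "{j. j \<ge> 1 \<and> upper_level E w j \<noteq> {}} = {}" using U by blast
    have "kappa E L w = 0" unfolding kappa_def S0 by simp
    moreover have "admissible E L w C" using U by (auto simp: admissible_def)
    ultimately show ?thesis unfolding w0 by (intro exI[of _ "[]"]) (simp add: face_flags_zero[OF C])
  next
    case False
    then obtain e0 where e0: "w e0 \<noteq> 0" by auto
    then have e0E: "e0 \<in> E" using wE[of e0] by auto
    define U where "U = upper_level E w 1"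
    define w' where "w' = (\<lambda>e. w e - 1)"
    have wU: "w e \<noteq> 0 \<longleftrightarrow> e \<in> U" for e
      using wE[of e] by (cases "e \<in> E") (auto simp: U_def upper_level_def)
    have U: "U \<subseteq> E" "U \<noteq> {}" using e0 wU by (auto simp: U_def upper_level_def)
    have "(\<Sum>e\<in>E. w' e) < (\<Sum>e\<in>E. w e)"
    proof (rule sum_strict_mono_ex1[OF finite_ground])
      show "\<exists>e\<in>E. w' e < w e" using e0 by (intro bexI[of _ e0] e0E) (simp add: w'_def)
    qed (simp add: w'_def)
    moreover have "w' e = 0" if "e \<notin> E" for e using wE[OF that] by (simp add: w'_def)
    ultimately obtain F where F:
      "\<forall>k. face_flags E L w' C k = (if admissible E L w' C \<and> k = kappa E L w' then {F} else {})"
      using less.hyps by blast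
    have lev: "upper_level E w (Suc j) = upper_level E w' j" if "j \<ge> 1" for j
      using that by (auto simp: upper_level_def w'_def)
    have k: "kappa E L w = rank U + kappa E L w'"
      unfolding U_def using U(2) lev by (intro kappa_shift) (simp_all add: U_def)
    have adm: "admissible E L w C \<longleftrightarrow> zero_on C U \<in> L \<and> admissible E L w' C"
    proof
      assume a: "admissible E L w C"
      have "zero_on C (upper_level E w' j) \<in> L" if "j \<ge> 1" "upper_level E w' j \<noteq> {}" for j
        using a that lev[of j] by (auto simp: admissible_def dest: spec[of _ "Suc j"])
      then show "zero_on C U \<in> L \<and> admissible E L w' C"
        using a U(2) by (auto simp: admissible_def U_def)
    next
      assume a: "zero_on C U \<in> L \<and> admissible E L w' C"
      have "zero_on C (upper_level E w j) \<in> L" if j: "j \<ge> 1" "upper_level E w j \<noteq> {}" for j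
      proof (cases "j = 1")
        case True
        then show ?thesis using a by (simp add: U_def)
      next
        case False
        then obtain i where "j = Suc i" "i \<ge> 1" using j(1) by (cases j) auto
        then show ?thesis using a j(2) lev[of i] by (simp add: admissible_def)
      qed
      then show "admissible E L w C" by (simp add: admissible_def)
    qed
    have "Xs \<in> face_flags E L w C k \<longleftrightarrow>
        Xs \<in> (if admissible E L w C \<and> k = kappa E L w then {F @ [zero_on C U]} else {})" for Xs k
      unfolding face_flags_snoc[OF C wU U] w'_def[symmetric] F[rule_format] adm k by auto
    then show ?thesis by (intro exI[of _ "F @ [zero_on C U]"] allI Set.set_eqI)
  qed
qed

end

theorem theorem6p1:
  fixes E :: "'e set" and L :: "('e \<Rightarrow> int) set"
  assumes "oriented_matroid E L" and "finite E" and "simple_om E L"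
  shows "(\<forall>C\<in>topes L. \<forall>w :: 'e \<Rightarrow> nat. \<forall>k :: nat. (\<forall>e. e \<notin> E \<longrightarrow> w e = 0) \<longrightarrow>
            mag_homology_to L w C k \<cong> free_Abelian_group (face_flags E L w C k) \<and>
            (if admissible E L w C \<and> k = kappa E L w
             then mag_homology_to L w C k \<cong> integer_group
             else trivial_group (mag_homology_to L w C k))) \<and>
         (\<forall>k l. is_free_abelian (mag_homology (topes L) (tope_dist L) k l))"
proof (intro conjI ballI allI impI)
  interpret simple_oriented_matroid E L
    using assms by (simp add: simple_oriented_matroid_def finite_oriented_matroid_def
        finite_oriented_matroid_axioms_def simple_oriented_matroid_axioms_def)
  fix k l
  show "is_free_abelian (mag_homology (topes L) (tope_dist L) k l)"
    unfolding mag_homology_def mag_tuples_walk_family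
    by (rule is_free_abelianI[OF tuple_homology_walk_family]; simp)
next
  interpret simple_oriented_matroid E L
    using assms by (simp add: simple_oriented_matroid_def finite_oriented_matroid_def
        finite_oriented_matroid_axioms_def simple_oriented_matroid_axioms_def)
  fix C :: "'e \<Rightarrow> int" and w :: "'e \<Rightarrow> nat" and k
  assume C: "C \<in> topes L" and wE: "\<forall>e. e \<notin> E \<longrightarrow> w e = 0"
  let ?G = "mag_homology_to L w C k"
  define I where "I = {(C', w'). (C', w') \<in> {(C, w)} \<and> admissible E L w' C' \<and> kappa E L w' = k}"
  have G: "?G \<cong> free_Abelian_group I" "group ?G"
    unfolding mag_homology_to_def crossing_tuples_eq I_def
    by (rule tuple_homology_walk_family; use C wE in simp)+
  have I: "I = (if admissible E L w C \<and> k = kappa E L w then {(C, w)} else {})" by (auto simp: I_def)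
  obtain F where F: "face_flags E L w C k = (if admissible E L w C \<and> k = kappa E L w then {F} else {})"
    using face_flags_singleton[OF C] wE by meson
  \<comment> \<open>Under the same condition both sets are singletons, and otherwise both are
    empty.\<close>
  have "I \<approx> face_flags E L w C k" unfolding I F by (simp add: singleton_eqpoll)
  then have "free_Abelian_group I \<cong> free_Abelian_group (face_flags E L w C k)"
    by (simp add: isomorphic_free_Abelian_groups)
  with G(1) show "?G \<cong> free_Abelian_group (face_flags E L w C k)" by (rule iso_trans)
  show "if admissible E L w C \<and> k = kappa E L w then ?G \<cong> integer_group else trivial_group ?G"
  proof (cases "admissible E L w C \<and> k = kappa E L w")
    case True
    then have "?G \<cong> free_Abelian_group {(C, w)}" using G(1) I by simp
    also have "free_Abelian_group {(C, w)} \<cong> integer_group"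
      by (rule group.iso_sym[OF group_integer_group isomorphic_group_integer_free_Abelian_group_singleton])
    finally show ?thesis by (simp add: True)
  next
    case False
    then have "?G \<cong> free_Abelian_group ({} :: (('e \<Rightarrow> int) \<times> ('e \<Rightarrow> nat)) set)"
      using G(1) unfolding I by (simp only: if_False)
    moreover have "trivial_group (free_Abelian_group ({} :: (('e \<Rightarrow> int) \<times> ('e \<Rightarrow> nat)) set))"
      by (auto simp: trivial_group_def)
    ultimately have "trivial_group ?G"
      using isomorphic_group_triviality G(2) group_free_Abelian_group by blast
    then show ?thesis by (simp only: False if_False)
  qed
qed

end
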